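(* Let $\mathcal C\subset\mathbb R^2_{xz}$ be a smooth simple closed curve, the boundary of a compact domain $\mathcal D\subset\mathbb R^2_{xz}$, such that the projection $p_z:\mathcal C\to\mathbb R^1_x$, $(x,z)\mapsto x$, has only quadratic folding singularities, and suppose that $\mathcal C$ is positively concave or negatively concave. Then any smooth compact surface $\mathcal S\subset\mathbb R^3_{xyz}\cap\{y\ge 0\}$ that bounds $\mathcal C$ must have at least cubic singularities (cusps) under the map $P_z:\mathcal S\to\mathbb R^2_{xy}$, $(x,y,z)\mapsto(x,y)$; that is, some fiber of $P_z$ is tangent to $\mathcal S$ with multiplicity $\geq 3$ at some point of $\mathcal S$.
   Context: $\mathbb R^3_{xyz}$ is the space with coordinates $x,y,z$; $\mathbb R^2_{xz}$ is identified with the plane $\{y=0\}\subset\mathbb R^3_{xyz}$; $P_z:\mathbb R^3_{xyz}\to\mathbb R^2_{xy}$ and $p_z:\mathbb R^2_{xz}\to\mathbb R^1_x$ are the obvious projections along the $z$-direction. "$\mathcal S$ bounds $\mathcal C$" means $\partial\mathcal S=\mathcal C$. The curve $\mathcal C=\partial\mathcal D$ is called positively concave (respectively negatively concave) if the function $x:\mathcal D\to\mathbb R$ has more local maxima than local minima (respectively more local minima than local maxima). Multiplicity convention: a transversal intersection of a fiber with a surface has multiplicity $1$, a quadratic tangency (fold) has multiplicity $2$, a cubic tangency (cusp) has multiplicity $3$. *)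

theory Defs
  imports "HOL-Analysis.Analysis"
begin

(* Points of R^3_xyz are triples (x, y, z), points of R^2_xz are pairs (x, z). *)

definition Pz :: "real \<times> real \<times> real \<Rightarrow> real \<times> real"
  where "Pz = (\<lambda>(x, y, z). (x, y))"

definition pz :: "real \<times> real \<Rightarrow> real"
  where "pz = (\<lambda>(x, z). x)"

definition xz_plane :: "real \<times> real \<Rightarrow> real \<times> real \<times> real"
  where "xz_plane = (\<lambda>(x, z). (x, 0, z))"


(* Meant for open X, where differentiability at a point depends only on the values
   of f on X. The directional derivatives stand for the higher differentials, so that
   all orders stay within one type. *)

primrec Ck_on :: "nat \<Rightarrow> 'a::real_normed_vector set \<Rightarrow> ('a \<Rightarrow> 'b::real_normed_vector) \<Rightarrow> bool"
  where
    "Ck_on 0 X f \<longleftrightarrow> continuous_on X f"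
  | "Ck_on (Suc k) X f \<longleftrightarrow>
       (\<forall>p\<in>X. f differentiable (at p)) \<and>
       (\<forall>v. Ck_on k X (\<lambda>p. frechet_derivative f (at p) v))"

definition smooth_on :: "'a::real_normed_vector set \<Rightarrow> ('a \<Rightarrow> 'b::real_normed_vector) \<Rightarrow> bool"
  where "smooth_on X f \<longleftrightarrow> (\<forall>k. Ck_on k X f)"

definition smooth_diffeo ::
    "'a::real_normed_vector set \<Rightarrow> 'b::real_normed_vector set \<Rightarrow> ('a \<Rightarrow> 'b) \<Rightarrow> ('b \<Rightarrow> 'a) \<Rightarrow> bool"
  where "smooth_diffeo U V \<phi> \<psi> \<longleftrightarrow>
    open U \<and> open V \<and> homeomorphism U V \<phi> \<psi> \<and> smooth_on U \<phi> \<and> smooth_on V \<psi>"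


definition smooth_simple_closed_curve :: "(real \<Rightarrow> real \<times> real) \<Rightarrow> (real \<times> real) set \<Rightarrow> bool"
  where "smooth_simple_closed_curve \<gamma> C \<longleftrightarrow>
    smooth_on UNIV \<gamma> \<and>
    (\<forall>t. vector_derivative \<gamma> (at t) \<noteq> 0) \<and>
    (\<forall>t. \<gamma> (t + 1) = \<gamma> t) \<and>
    inj_on \<gamma> {0..<1} \<and>
    C = range \<gamma>"

(* The condition does not depend on the regular parametrization \<gamma> of the curve. *)

definition only_quadratic_folds :: "(real \<Rightarrow> real \<times> real) \<Rightarrow> bool"
  where "only_quadratic_folds \<gamma> \<longleftrightarrow>
    (\<forall>t. deriv (pz \<circ> \<gamma>) t = 0 \<longrightarrow> deriv (deriv (pz \<circ> \<gamma>)) t \<noteq> 0)"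

definition compact_domain :: "'a::topological_space set \<Rightarrow> bool"
  where "compact_domain D \<longleftrightarrow>
    compact D \<and> connected (interior D) \<and> closure (interior D) = D"

definition local_maxima :: "'a::topological_space set \<Rightarrow> ('a \<Rightarrow> real) \<Rightarrow> 'a set"
  where "local_maxima D f = {p \<in> D. \<forall>\<^sub>F q in at p within D. f q \<le> f p}"

definition local_minima :: "'a::topological_space set \<Rightarrow> ('a \<Rightarrow> real) \<Rightarrow> 'a set"
  where "local_minima D f = {p \<in> D. \<forall>\<^sub>F q in at p within D. f p \<le> f q}"

(* Concavity of the curve C = frontier D, read off from the coordinate x on D. Both
   sets are finite if the projection of the smooth closed curve C has only quadratic
   folds: x has no extrema in the interior of D, and its critical points on C are isolated. *)

definition positively_concave :: "(real \<times> real) set \<Rightarrow> bool"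
  where "positively_concave D \<longleftrightarrow> card (local_maxima D pz) > card (local_minima D pz)"

definition negatively_concave :: "(real \<times> real) set \<Rightarrow> bool"
  where "negatively_concave D \<longleftrightarrow> card (local_minima D pz) > card (local_maxima D pz)"


(* Embedded surfaces with boundary: an ambient diffeomorphism straightens S near p to
   the half plane {(u, v, 0). 0 \<le> u}. Interior points are those sent to u > 0. *)

definition surface_chart ::
    "(real \<times> real \<times> real) set \<Rightarrow> real \<times> real \<times> real \<Rightarrow> (real \<times> real \<times> real) set \<Rightarrow>
     (real \<times> real \<times> real \<Rightarrow> real \<times> real \<times> real) \<Rightarrow> bool"
  where "surface_chart S p U \<phi> \<longleftrightarrow>
    p \<in> U \<and>
    (\<exists>V \<psi>. smooth_diffeo U V \<phi> \<psi> \<and> \<phi> ` (S \<inter> U) = V \<inter> {(u, v, w). 0 \<le> u \<and> w = 0})"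

definition smooth_compact_surface :: "(real \<times> real \<times> real) set \<Rightarrow> bool"
  where "smooth_compact_surface S \<longleftrightarrow> compact S \<and> (\<forall>p\<in>S. \<exists>U \<phi>. surface_chart S p U \<phi>)"

definition surface_boundary :: "(real \<times> real \<times> real) set \<Rightarrow> (real \<times> real \<times> real) set"
  where "surface_boundary S = {p \<in> S. \<exists>U \<phi>. surface_chart S p U \<phi> \<and> fst (\<phi> p) = 0}"

definition bounds :: "(real \<times> real \<times> real) set \<Rightarrow> (real \<times> real) set \<Rightarrow> bool"
  where "bounds S C \<longleftrightarrow> surface_boundary S = xz_plane ` C"


(* The fiber of Pz through p, parametrized by the coordinate z. *)

definition fiber :: "real \<times> real \<times> real \<Rightarrow> real \<Rightarrow> real \<times> real \<times> real"
  where "fiber p = (\<lambda>t. (fst (Pz p), snd (Pz p), t))"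

lemma range_fiber: "range (fiber p) = Pz -` {Pz p}"
  by (auto simp: fiber_def Pz_def split: prod.splits)

lemma fiber_at_height: "fiber p (snd (snd p)) = p"
  by (simp add: fiber_def Pz_def split: prod.splits)

(* At a boundary point of a surface S the zero set of f extends S beyond its boundary,
   hence the inclusion instead of an equality. *)

definition local_equation ::
    "(real \<times> real \<times> real) set \<Rightarrow> real \<times> real \<times> real \<Rightarrow> (real \<times> real \<times> real) set \<Rightarrow>
     (real \<times> real \<times> real \<Rightarrow> real) \<Rightarrow> bool"
  where "local_equation S p U f \<longleftrightarrow>
    open U \<and> p \<in> U \<and> smooth_on U f \<and> (\<forall>q \<in> S \<inter> U. f q = 0) \<and>
    (\<exists>v. frechet_derivative f (at p) v \<noteq> 0)"

(* Infinite if all derivatives vanish, since Inf {} = \<infinity> in enat. *)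

definition vanishing_order :: "(real \<Rightarrow> real) \<Rightarrow> real \<Rightarrow> enat"
  where "vanishing_order g t = Inf (enat ` {k. (deriv ^^ k) g t \<noteq> 0})"

(* Multiplicity m with which the fiber of Pz through a point p of a smooth surface S
   meets S at p: 1 for a transversal intersection, 2 for a quadratic tangency, 3 for a
   cubic one. It does not depend on the local equation: two of them differ, along S near p,
   by a nonvanishing factor, up to a term that is flat at p if p is a boundary point. *)

definition fiber_multiplicity :: "(real \<times> real \<times> real) set \<Rightarrow> real \<times> real \<times> real \<Rightarrow> enat \<Rightarrow> bool"
  where "fiber_multiplicity S p m \<longleftrightarrow>
    (\<exists>U f. local_equation S p U f \<and> m = vanishing_order (f \<circ> fiber p) (snd (snd p)))"

end

theory Submission
  imports Defs
begin

text \<open>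
  Suppose that the fibers meet \<open>S\<close> with multiplicity at most two. Then, over a small disc in the
  half plane \<open>0 \<le> y\<close>, \<open>S\<close> consists of sheets that each fiber meets once (crossings) and of folds,
  over which a pair of crossings is born. So the parity of the number of crossings above a fold is
  constant along each curve of folds; call a fold outer if it is even. Near each point of the half plane,
  count the pairs of crossings born at outer folds. These local functions differ by constants on
  overlaps, so they glue to a function on the simply connected half plane. It is constant far
  away, hence its total increase along the line \<open>y = 0\<close> is zero. Along that line the fibers meet \<open>C\<close>,
  and as membership in \<open>D\<close> is the parity of the crossings above, the outer folds on \<open>C\<close> are precisely
  the local extrema of \<open>x\<close> on \<open>D\<close>: a minimum contributes \<open>1\<close> to the increase and a maximum \<open>-1\<close>.
  Interior points of \<open>S\<close> in the plane \<open>y = 0\<close> contribute nothing.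
\<close>

text \<open>What a cusp would destroy is the gluing. Of the two fold curves that end at a cusp, one
  has one more crossing above it than the other, so exactly one of them is outer, and the count
  changes by one along a small loop around the cusp. The main obstacle is the boundary of
  \<open>S\<close>. Sheets are recognised by counting the points of nearby fibers over the closed
  half plane, not by transversality, so that a boundary point can be a crossing or a fold like any
  other. Where \<open>S\<close> is not tangent to the plane y = 0, it is locally the zero set of a
  function, cut off by the condition that y is nonnegative. Where it is tangent, this description
  fails; convexity along the fiber, together with the sign of y next to the boundary curve, then
  shows that the fiber still crosses once. That argument needs the boundary curve not to be vertical
  at such a point, and a vertical tangent there would already be a cusp. The contradiction is
  finally reached in the form of an equality: \<open>x\<close> has as many local maxima as local
  minima on \<open>D\<close>.\<close>

section \<open>Gluing germs on a rectangle\<close>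

text \<open>\<open>g q\<close> represents the germ at \<open>q\<close>, up to an additive constant, of a locally defined function;
  \<open>G\<close> is a primitive of this family on \<open>A\<close>.\<close>

definition good where
  "good g A G \<longleftrightarrow> (\<forall>q\<in>A. \<exists>c. \<forall>\<^sub>F w in nhds q. w \<in> A \<longrightarrow> G w = g q w + (c::real))"
  for g :: "'a::topological_space \<Rightarrow> 'a \<Rightarrow> real"

lemma goodD: "good g A G \<Longrightarrow> q \<in> A \<Longrightarrow> \<exists>c. \<forall>\<^sub>F w in nhds q. w \<in> A \<longrightarrow> G w = g q w + c"
  unfolding good_def by blast

lemma good_subset:
  assumes "good g A G" "B \<subseteq> A"
  shows "good g B G"
  unfolding good_def
proof
  fix q assume "q \<in> B"
  then obtain c where "\<forall>\<^sub>F w in nhds q. w \<in> A \<longrightarrow> G w = g q w + c"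
    using assms unfolding good_def by blast
  then have "\<forall>\<^sub>F w in nhds q. w \<in> B \<longrightarrow> G w = g q w + c"
    by (rule eventually_mono) (use assms in blast)
  then show "\<exists>c. \<forall>\<^sub>F w in nhds q. w \<in> B \<longrightarrow> G w = g q w + c" ..
qed

lemma locally_constant_on_connected:
  fixes f :: "'a::topological_space \<Rightarrow> real"
  assumes "connected A" and "\<And>q. q \<in> A \<Longrightarrow> \<exists>c. \<forall>\<^sub>F w in nhds q. w \<in> A \<longrightarrow> f w = c"
    and "a \<in> A" "b \<in> A"
  shows "f a = f b"
proof (rule connected_local_const[OF assms(1,3,4)], intro ballI)
  fix q assume "q \<in> A"
  then obtain c where c: "\<forall>\<^sub>F w in nhds q. w \<in> A \<longrightarrow> f w = c"
    using assms(2) by blast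
  from eventually_nhds_x_imp_x[OF c] \<open>q \<in> A\<close> have "f q = c"
    by blast
  with c show "\<forall>\<^sub>F w in at q within A. f q = f w"
    by (auto simp: eventually_at_filter elim: eventually_mono)
qed

text \<open>On the connected overlap the two primitives differ by a constant \<open>k\<close>, so
  \<open>G'\<close> shifted by \<open>k\<close> continues \<open>G\<close>. Closedness gives a point
  outside one of the sets a neighbourhood that misses it; only at common points do two local
  constants have to be compared.\<close>

lemma good_glue:
  assumes G: "good g A G" and G': "good g B G'"
    and "connected (A \<inter> B)" "A \<inter> B \<noteq> {}" "closed A" "closed B"
  shows "\<exists>G. good g (A \<union> B) G"
proof -
  obtain r where r: "r \<in> A" "r \<in> B"
    using assms(4) by blast
  define k where "k = G r - G' r"
  have diff: "G w = G' w + k" if "w \<in> A \<inter> B" for w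
  proof -
    have "G w - G' w = G r - G' r"
    proof (rule locally_constant_on_connected[OF assms(3)])
      fix q assume "q \<in> A \<inter> B"
      then obtain c c' where
        "\<forall>\<^sub>F w in nhds q. w \<in> A \<longrightarrow> G w = g q w + c"
        "\<forall>\<^sub>F w in nhds q. w \<in> B \<longrightarrow> G' w = g q w + c'"
        using goodD[OF G, of q] goodD[OF G', of q] by blast
      then have "\<forall>\<^sub>F w in nhds q. w \<in> A \<inter> B \<longrightarrow> G w - G' w = c - c'"
        by eventually_elim auto
      then show "\<exists>c. \<forall>\<^sub>F w in nhds q. w \<in> A \<inter> B \<longrightarrow> G w - G' w = c" ..
    qed (use that r in auto)
    then show ?thesis by (simp add: k_def)
  qed
  define H where "H = (\<lambda>w. if w \<in> A then G w else G' w + k)"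
  have HB: "H w = G' w + k" if "w \<in> B" for w
    using diff that by (auto simp: H_def)
  have HA: "H w = G w" if "w \<in> A" for w
    using that by (simp add: H_def)
  have "\<exists>c. \<forall>\<^sub>F w in nhds q. w \<in> A \<union> B \<longrightarrow> H w = g q w + c" if q: "q \<in> A \<union> B" for q
  proof -
    have fA: "\<exists>c. \<forall>\<^sub>F w in nhds q. w \<in> A \<longrightarrow> H w = g q w + c" if qA: "q \<in> A"
    proof -
      obtain c where "\<forall>\<^sub>F w in nhds q. w \<in> A \<longrightarrow> G w = g q w + c"
        using goodD[OF G qA] by blast
      then have "\<forall>\<^sub>F w in nhds q. w \<in> A \<longrightarrow> H w = g q w + c"
        by (rule eventually_mono) (simp add: HA)
      then show ?thesis ..
    qed
    have fB: "\<exists>c. \<forall>\<^sub>F w in nhds q. w \<in> B \<longrightarrow> H w = g q w + c" if qB: "q \<in> B"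
    proof -
      obtain c where "\<forall>\<^sub>F w in nhds q. w \<in> B \<longrightarrow> G' w = g q w + c"
        using goodD[OF G' qB] by blast
      then have "\<forall>\<^sub>F w in nhds q. w \<in> B \<longrightarrow> H w = g q w + (c + k)"
        by (rule eventually_mono) (simp add: HB)
      then show ?thesis ..
    qed
    consider "q \<in> A" "q \<in> B" | "q \<notin> A" "q \<in> B" | "q \<in> A" "q \<notin> B"
      using q by blast
    then show ?thesis
    proof cases
      case 1
      then obtain c c' where
        c: "\<forall>\<^sub>F w in nhds q. w \<in> A \<longrightarrow> H w = g q w + c" and
        c': "\<forall>\<^sub>F w in nhds q. w \<in> B \<longrightarrow> H w = g q w + c'"
        using fA fB by blast
      \<comment> \<open>Both relations hold at the centre \<open>q\<close> itself, where they
        describe the same value of \<open>H\<close>.\<close>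
      have "c = c'"
        using eventually_nhds_x_imp_x[OF c] eventually_nhds_x_imp_x[OF c'] 1 by auto
      with c c' have "\<forall>\<^sub>F w in nhds q. w \<in> A \<union> B \<longrightarrow> H w = g q w + c"
        by (auto elim: eventually_elim2)
      then show ?thesis ..
    next
      case 2
      then obtain c where "\<forall>\<^sub>F w in nhds q. w \<in> B \<longrightarrow> H w = g q w + c"
        using fB by blast
      moreover have "\<forall>\<^sub>F w in nhds q. w \<in> - A"
        using assms 2 by (intro eventually_nhds_in_open) auto
      ultimately have "\<forall>\<^sub>F w in nhds q. w \<in> A \<union> B \<longrightarrow> H w = g q w + c"
        by eventually_elim auto
      then show ?thesis ..
    next
      case 3
      then obtain c where "\<forall>\<^sub>F w in nhds q. w \<in> A \<longrightarrow> H w = g q w + c"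
        using fA by blast
      moreover have "\<forall>\<^sub>F w in nhds q. w \<in> - B"
        using assms 3 by (intro eventually_nhds_in_open) auto
      ultimately have "\<forall>\<^sub>F w in nhds q. w \<in> A \<union> B \<longrightarrow> H w = g q w + c"
        by eventually_elim auto
      then show ?thesis ..
    qed
  qed
  then show ?thesis
    unfolding good_def by blast
qed

lemma eventually_nhds_Pair_box:
  fixes x y :: real
  assumes "eventually P (nhds (x, y))"
  obtains d where "0 < d" "\<And>s t. \<bar>s - x\<bar> < d \<Longrightarrow> \<bar>t - y\<bar> < d \<Longrightarrow> P (s, t)"
proof -
  obtain Q R where QR: "eventually Q (nhds x)" "eventually R (nhds y)"
    "\<And>s t. Q s \<Longrightarrow> R t \<Longrightarrow> P (s, t)"
    using assms unfolding nhds_prod eventually_prod_filter by blast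
  then obtain d e where "0 < d" "\<And>s. dist s x < d \<Longrightarrow> Q s" "0 < e" "\<And>t. dist t y < e \<Longrightarrow> R t"
    unfolding eventually_nhds_metric by blast
  with QR(3) show thesis
    by (intro that[of "min d e"]) (auto simp: dist_real_def)
qed

lemma eventually_nhds_Pair_boxI:
  fixes x y :: real
  assumes "0 < d" "\<And>s t. \<bar>s - x\<bar> < d \<Longrightarrow> \<bar>t - y\<bar> < d \<Longrightarrow> P (s, t)"
  shows "eventually P (nhds (x, y))"
  unfolding nhds_prod eventually_prod_filter
  using assms
  by (intro exI[of _ "\<lambda>s. \<bar>s - x\<bar> < d"] exI[of _ "\<lambda>t. \<bar>t - y\<bar> < d"])
     (auto simp: eventually_nhds_metric dist_real_def)

text \<open>Bisection is applied twice: in x, for a thin strip around a fixed height, and then in y,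
  to stack the strips. Neighbouring pieces meet in a set that is connected as
  \<open>good_glue\<close> requires. The cocycle condition says that the germ at \<open>q\<close>
  also represents the germs at nearby points.\<close>

lemma good_rectangle:
  fixes g :: "real \<times> real \<Rightarrow> real \<times> real \<Rightarrow> real"
  assumes ab: "a \<le> b" "c \<le> d"
    and cocycle: "\<And>q. q \<in> {a..b} \<times> {c..d} \<Longrightarrow>
      \<forall>\<^sub>F v in nhds q. v \<in> {a..b} \<times> {c..d} \<longrightarrow>
        (\<exists>k. \<forall>\<^sub>F w in nhds v. w \<in> {a..b} \<times> {c..d} \<longrightarrow> g q w = g v w + k)"
  shows "\<exists>G. good g ({a..b} \<times> {c..d}) G"
proof -
  define Q where "Q = (\<lambda>s t u v. ({s..t} \<inter> {a..b}) \<times> ({u..v} \<inter> {c..d}))"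
  have inner: "\<exists>e>0. \<exists>G. good g (Q a b (y - e) (y + e)) G" if y: "c \<le> y" "y \<le> d" for y
  proof -
    have "a \<le> a \<and> b \<le> b \<longrightarrow> (\<exists>e>0. \<exists>G. good g (Q a b (y - e) (y + e)) G)"
      using \<open>a \<le> b\<close>
    proof (induct rule: Bolzano[where P = "\<lambda>s t. a \<le> s \<and> t \<le> b \<longrightarrow> (\<exists>e>0. \<exists>G. good g (Q s t (y - e) (y + e)) G)"])
      case (trans s t u)
      show ?case
      proof
        assume su: "a \<le> s \<and> u \<le> b"
        with trans have "a \<le> s \<and> t \<le> b" "a \<le> t \<and> u \<le> b" by linarith+
        with trans(1,2) obtain e G e' G' where e: "0 < e" "good g (Q s t (y - e) (y + e)) G"
          "0 < e'" "good g (Q t u (y - e') (y + e')) G'" by blast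
        define m where "m = min e e'"
        have m: "0 < m" using e by (simp add: m_def)
        have "good g (Q s t (y - m) (y + m)) G"
          by (rule good_subset[OF e(2)]) (auto simp: Q_def m_def)
        moreover have "good g (Q t u (y - m) (y + m)) G'"
          by (rule good_subset[OF e(4)]) (auto simp: Q_def m_def)
        moreover have Int: "Q s t (y - m) (y + m) \<inter> Q t u (y - m) (y + m) = ({t} \<inter> {a..b}) \<times> ({y-m..y+m} \<inter> {c..d})"
          using trans by (auto simp: Q_def)
        moreover have "connected (Q s t (y - m) (y + m) \<inter> Q t u (y - m) (y + m))"
          unfolding Int by (intro convex_connected convex_Times convex_Int) auto
        moreover have "closed (Q s t (y - m) (y + m))" "closed (Q t u (y - m) (y + m))"
          by (auto simp: Q_def intro: closed_Times)
        moreover have "(t, y) \<in> Q s t (y - m) (y + m) \<inter> Q t u (y - m) (y + m)"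
          unfolding Int using trans su y m by auto
        ultimately have "\<exists>G. good g (Q s t (y - m) (y + m) \<union> Q t u (y - m) (y + m)) G"
          by (intro good_glue) blast+
        moreover have "Q s t (y - m) (y + m) \<union> Q t u (y - m) (y + m) = Q s u (y - m) (y + m)"
          using trans by (auto simp: Q_def)
        ultimately show "\<exists>e>0. \<exists>G. good g (Q s u (y - e) (y + e)) G" using m by auto
      qed
    next
      case (local x)
      have "(x, y) \<in> {a..b} \<times> {c..d}" using local y by auto
      from cocycle[OF this] obtain e where e: "0 < e"
        "\<And>s t. \<bar>s - x\<bar> < e \<Longrightarrow> \<bar>t - y\<bar> < e \<Longrightarrow> (s, t) \<in> {a..b} \<times> {c..d} \<Longrightarrow>
          (\<exists>k. \<forall>\<^sub>F w in nhds (s, t). w \<in> {a..b} \<times> {c..d} \<longrightarrow> g (x, y) w = g (s, t) w + k)"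
        by (elim eventually_nhds_Pair_box) auto
      \<comment> \<open>By the cocycle condition a single germ is a primitive on a whole box around
        its point.\<close>
      have "good g (Q s t (y - e/2) (y + e/2)) (g (x, y))" if "s \<le> x" "x \<le> t" "t - s < e" for s t
        unfolding good_def
      proof
        fix q assume q: "q \<in> Q s t (y - e/2) (y + e/2)"
        then have "\<bar>fst q - x\<bar> < e" "\<bar>snd q - y\<bar> < e" "q \<in> {a..b} \<times> {c..d}"
          using that \<open>0 < e\<close> by (auto simp: Q_def)
        then obtain k where "\<forall>\<^sub>F w in nhds q. w \<in> {a..b} \<times> {c..d} \<longrightarrow> g (x, y) w = g q w + k"
          using e(2)[of "fst q" "snd q"] by auto
        then show "\<exists>k. \<forall>\<^sub>F w in nhds q. w \<in> Q s t (y - e/2) (y + e/2) \<longrightarrow> g (x, y) w = g q w + k"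
          by (intro exI[of _ k]) (auto simp: Q_def elim: eventually_mono)
      qed
      then show ?case using \<open>0 < e\<close> by (meson half_gt_zero)
    qed
    then show ?thesis by simp
  qed
  have "c \<le> c \<and> d \<le> d \<longrightarrow> (\<exists>G. good g (Q a b c d) G)"
    using \<open>c \<le> d\<close>
  proof (induct rule: Bolzano[where P = "\<lambda>s t. c \<le> s \<and> t \<le> d \<longrightarrow> (\<exists>G. good g (Q a b s t) G)"])
    case (trans s t u)
    show ?case
    proof
      assume su: "c \<le> s \<and> u \<le> d"
      with trans have "c \<le> s \<and> t \<le> d" "c \<le> t \<and> u \<le> d" by linarith+
      with trans(1,2) obtain G G' where G: "good g (Q a b s t) G" "good g (Q a b t u) G'" by blast
      have Int: "Q a b s t \<inter> Q a b t u = {a..b} \<times> ({t} \<inter> {c..d})"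
        using trans by (auto simp: Q_def)
      have "connected (Q a b s t \<inter> Q a b t u)"
        unfolding Int by (intro convex_connected convex_Times convex_Int) auto
      moreover have "closed (Q a b s t)" "closed (Q a b t u)"
        by (auto simp: Q_def intro: closed_Times)
      moreover have "(a, t) \<in> Q a b s t \<inter> Q a b t u"
        unfolding Int using trans su ab by auto
      ultimately have "\<exists>G. good g (Q a b s t \<union> Q a b t u) G"
        using G by (intro good_glue) blast+
      moreover have "Q a b s t \<union> Q a b t u = Q a b s u"
        using trans by (auto simp: Q_def)
      ultimately show "\<exists>G. good g (Q a b s u) G" by auto
    qed
  next
    case (local y)
    then obtain e G where e: "0 < e" "good g (Q a b (y - e) (y + e)) G"
      using inner by blast
    have "good g (Q a b s t) G" if "s \<le> y" "y \<le> t" "t - s < e" for s t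
      using that by (intro good_subset[OF e(2)]) (auto simp: Q_def)
    then show ?case using e(1) by blast
  qed
  then show ?thesis by (simp add: Q_def)
qed

text \<open>The germs vanish on the left, right and top sides, so a primitive is constant there and
  agrees at the two bottom corners; along the bottom side \<open>f\<close> differs from it by a
  constant. This is the form in which simple connectivity enters.\<close>

lemma no_monodromy:
  fixes g :: "real \<times> real \<Rightarrow> real \<times> real \<Rightarrow> real"
  assumes ab: "a \<le> b" "c \<le> d"
    and cocycle: "\<And>q. q \<in> {a..b} \<times> {c..d} \<Longrightarrow>
      \<forall>\<^sub>F v in nhds q. v \<in> {a..b} \<times> {c..d} \<longrightarrow>
        (\<exists>k. \<forall>\<^sub>F w in nhds v. w \<in> {a..b} \<times> {c..d} \<longrightarrow> g q w = g v w + k)"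
    and sides: "\<And>q w. q \<in> {a..b} \<times> {c..d} \<Longrightarrow> fst q = a \<or> fst q = b \<or> snd q = d \<Longrightarrow> g q w = 0"
    and bottom: "\<And>x. x \<in> {a..b} \<Longrightarrow> \<exists>k. \<forall>\<^sub>F t in nhds x. f t = g (x, c) (t, c) + k"
  shows "f a = f b"
proof -
  obtain G where G: "good g ({a..b} \<times> {c..d}) G"
    using good_rectangle[OF ab cocycle] by blast
  have const: "G p = G q" if A: "A \<subseteq> {a..b} \<times> {c..d}" "connected A" "p \<in> A" "q \<in> A"
    "\<And>q. q \<in> A \<Longrightarrow> fst q = a \<or> fst q = b \<or> snd q = d" for A p q
  proof (rule locally_constant_on_connected[OF A(2) _ A(3,4)])
    fix q assume q: "q \<in> A"
    with A(1) obtain k where "\<forall>\<^sub>F w in nhds q. w \<in> {a..b} \<times> {c..d} \<longrightarrow> G w = g q w + k"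
      using G unfolding good_def by blast
    moreover have "g q w = 0" for w using q A sides by blast
    ultimately show "\<exists>k. \<forall>\<^sub>F w in nhds q. w \<in> A \<longrightarrow> G w = k"
      using A(1) by (intro exI[of _ k]) (auto elim!: eventually_mono)
  qed
  have "G (a, c) = G (a, d)"
    by (rule const[of "{a} \<times> {c..d}"]) (use ab in \<open>auto intro!: convex_connected convex_Times\<close>)
  also have "\<dots> = G (b, d)"
    by (rule const[of "{a..b} \<times> {d}"]) (use ab in \<open>auto intro!: convex_connected convex_Times\<close>)
  also have "\<dots> = G (b, c)"
    by (rule const[of "{b} \<times> {c..d}"]) (use ab in \<open>auto intro!: convex_connected convex_Times\<close>)
  finally have Gab: "G (a, c) = G (b, c)" .
  have "f a - G (a, c) = f b - G (b, c)"
  proof (rule locally_constant_on_connected[of "{a..b}" "\<lambda>t. f t - G (t, c)"])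
    fix x assume x: "x \<in> {a..b}"
    then obtain k where k: "\<forall>\<^sub>F t in nhds x. f t = g (x, c) (t, c) + k"
      using bottom by blast
    have "(x, c) \<in> {a..b} \<times> {c..d}" using x ab by auto
    with G obtain m where "\<forall>\<^sub>F w in nhds (x, c). w \<in> {a..b} \<times> {c..d} \<longrightarrow> G w = g (x, c) w + m"
      unfolding good_def by blast
    moreover have "filterlim (\<lambda>t. (t, c)) (nhds (x, c)) (nhds x)"
      by (intro tendsto_intros filterlim_ident)
    ultimately have "\<forall>\<^sub>F t in nhds x. (t, c) \<in> {a..b} \<times> {c..d} \<longrightarrow> G (t, c) = g (x, c) (t, c) + m"
      unfolding filterlim_iff by blast
    with k have "\<forall>\<^sub>F t in nhds x. t \<in> {a..b} \<longrightarrow> f t - G (t, c) = k - m"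
      by eventually_elim (use ab in auto)
    then show "\<exists>k. \<forall>\<^sub>F t in nhds x. t \<in> {a..b} \<longrightarrow> f t - G (t, c) = k" ..
  qed (use ab in auto)
  with Gab show ?thesis by simp
qed

section \<open>Crossings and folds of a family of fibers\<close>

text \<open>\<open>S\<close> lies over the closed half plane, so nearby fibers are sampled only
  there. Below the line the filter is trivial, which is why evaluation at the centre requires
  \<open>0 \<le> snd q\<close>.\<close>

definition upper :: "real \<times> real \<Rightarrow> (real \<times> real) filter"
  where "upper q = inf (nhds q) (principal {v. 0 \<le> snd v})"

lemma eventually_upper:
  "eventually P (upper q) \<longleftrightarrow> (\<forall>\<^sub>F v in nhds q. 0 \<le> snd v \<longrightarrow> P v)"
  by (simp add: upper_def eventually_inf_principal)

lemma eventually_upper_nonneg: "\<forall>\<^sub>F v in upper q. 0 \<le> snd v"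
  by (simp add: eventually_upper)

lemma eventually_upper_imp:
  assumes "eventually P (upper q)" "0 \<le> snd q"
  shows "P q"
  using eventually_nhds_x_imp_x assms unfolding eventually_upper by blast

lemma eventually_upper_upper:
  assumes "eventually P (upper q)"
  shows "\<forall>\<^sub>F v in upper q. eventually P (upper v)"
proof -
  have "\<forall>\<^sub>F v in nhds q. \<forall>\<^sub>F w in nhds v. 0 \<le> snd w \<longrightarrow> P w"
    using assms unfolding eventually_upper by (simp only: eventually_eventually)
  then show ?thesis
    unfolding eventually_upper by (rule eventually_mono) simp
qed

text \<open>\<open>sec v\<close> is the set of heights at which the fiber over \<open>v\<close> meets the surface.\<close>

definition crossing :: "(real \<times> real \<Rightarrow> real set) \<Rightarrow> real \<times> real \<Rightarrow> real \<Rightarrow> bool"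
  where "crossing sec q z \<longleftrightarrow> z \<in> sec q \<and>
    (\<forall>\<^sub>F e in at_right 0. \<forall>\<^sub>F v in upper q. \<exists>\<zeta>. sec v \<inter> ball z e = {\<zeta>})"

definition crossing_chart :: "(real \<times> real \<Rightarrow> real set) \<Rightarrow> real \<Rightarrow> real \<Rightarrow> real \<times> real \<Rightarrow> bool"
  where "crossing_chart sec z e v \<longleftrightarrow> (\<exists>\<zeta>. sec v \<inter> ball z e = {\<zeta>} \<and> crossing sec v \<zeta>)"

text \<open>The alternatives are the base points on the empty side of the image of a fold curve, on
  the image itself, and on the side covered by two sheets.\<close>

definition fold_chart :: "(real \<times> real \<Rightarrow> real set) \<Rightarrow> real \<Rightarrow> real \<Rightarrow> real \<times> real \<Rightarrow> bool"
  where "fold_chart sec z e v \<longleftrightarrow>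
    sec v \<inter> ball z e = {} \<or>
    (\<exists>\<zeta>. sec v \<inter> ball z e = {\<zeta>} \<and> \<not> crossing sec v \<zeta>) \<or>
    (\<exists>\<zeta>\<^sub>1 \<zeta>\<^sub>2. \<zeta>\<^sub>1 \<noteq> \<zeta>\<^sub>2 \<and> sec v \<inter> ball z e = {\<zeta>\<^sub>1, \<zeta>\<^sub>2} \<and> crossing sec v \<zeta>\<^sub>1 \<and> crossing sec v \<zeta>\<^sub>2)"

text \<open>The combinatorial part of the proof rests on these properties alone.
  \<open>stable\<close> is upper semicontinuity: an open condition satisfied along one fiber holds
  along the nearby ones. \<open>fold\<close> is where the bound on the multiplicity enters.\<close>

locale fold_family =
  fixes sec :: "real \<times> real \<Rightarrow> real set"
  assumes stable: "(\<forall>z\<in>sec q. eventually P (nhds z)) \<Longrightarrow> \<forall>\<^sub>F v in upper q. \<forall>\<zeta>\<in>sec v. P \<zeta>"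
    and compact_sec: "compact (sec q)"
    and fold: "0 \<le> snd q \<Longrightarrow> z \<in> sec q \<Longrightarrow> \<not> crossing sec q z \<Longrightarrow>
      \<forall>\<^sub>F e in at_right 0. \<forall>\<^sub>F v in upper q. fold_chart sec z e v"
begin

text \<open>If the fiber over \<open>v\<close> has a single point \<zeta> in the ball, then by
  \<open>stable\<close> the fibers near it have their single point in that ball close to \<zeta>;
  hence \<zeta> is again a crossing.\<close>

lemma eventually_crossing_chart:
  assumes q: "0 \<le> snd q" and cr: "crossing sec q z"
  shows "\<forall>\<^sub>F e in at_right 0. \<forall>\<^sub>F v in upper q. crossing_chart sec z e v"
proof -
  have z: "z \<in> sec q" and ev: "\<forall>\<^sub>F e in at_right 0. \<forall>\<^sub>F v in upper q. \<exists>\<zeta>. sec v \<inter> ball z e = {\<zeta>}"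
    using cr by (auto simp: crossing_def)
  obtain e0 where e0: "0 < e0"
    "\<And>e. 0 < e \<Longrightarrow> e < e0 \<Longrightarrow> \<forall>\<^sub>F v in upper q. \<exists>\<zeta>. sec v \<inter> ball z e = {\<zeta>}"
    using ev unfolding eventually_at_right_field by auto
  have single: "sec q \<inter> ball z e = {z}" if e: "0 < e" "e < e0" for e
  proof -
    obtain \<zeta> where "sec q \<inter> ball z e = {\<zeta>}"
      using eventually_upper_imp[OF e0(2)[OF e] q] by blast
    moreover have "z \<in> sec q \<inter> ball z e" using z e by simp
    ultimately show ?thesis by auto
  qed
  \<comment> \<open>Below \<open>e0 / 2\<close>, the ball of radius \<open>2 * e\<close> still
    isolates \<open>z\<close>. Then no point of \<open>sec q\<close> lies at distance exactly
    \<open>e\<close> from \<open>z\<close>, and by \<open>stable\<close> none does over nearby base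
    points.\<close>
  have "\<forall>\<^sub>F v in upper q. crossing_chart sec z e v" if e: "0 < e" "e < e0 / 2" for e
  proof -
    have "\<forall>\<^sub>F \<xi> in nhds y. \<bar>\<xi> - z\<bar> \<noteq> e" if y: "y \<in> sec q" for y
    proof -
      have "\<bar>y - z\<bar> \<noteq> e"
      proof
        assume "\<bar>y - z\<bar> = e"
        then have "y \<in> sec q \<inter> ball z (2 * e)" "y \<noteq> z"
          using y e by (auto simp: dist_real_def)
        then show False using single[of "2 * e"] e by auto
      qed
      then have "\<forall>\<^sub>F \<xi> in nhds y. \<xi> \<in> {\<xi>. \<bar>\<xi> - z\<bar> \<noteq> e}"
        by (intro eventually_nhds_in_open open_Collect_neq continuous_intros) auto
      then show ?thesis by simp
    qed
    then have "\<forall>\<^sub>F v in upper q. \<forall>\<xi>\<in>sec v. \<bar>\<xi> - z\<bar> \<noteq> e"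
      by (intro stable) blast
    moreover have uniq: "\<forall>\<^sub>F v in upper q. \<exists>\<zeta>. sec v \<inter> ball z e = {\<zeta>}"
      using e e0 by auto
    moreover note eventually_upper_upper[OF uniq]
    ultimately show ?thesis
    proof eventually_elim
      case (elim v)
      then obtain \<zeta> where \<zeta>: "sec v \<inter> ball z e = {\<zeta>}" by blast
      have small: "\<forall>\<^sub>F w in upper v. \<exists>\<xi>. sec w \<inter> ball \<zeta> e' = {\<xi>}"
        if e': "0 < e'" "e' < e - \<bar>\<zeta> - z\<bar>" for e'
      proof -
        have sub: "ball \<zeta> e' \<subseteq> ball z e"
          using e' by (auto simp: dist_real_def)
        have "\<forall>\<^sub>F \<xi> in nhds y. \<xi> \<in> ball z e \<longrightarrow> \<xi> \<in> ball \<zeta> e'" if y: "y \<in> sec v" for y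
        proof (cases "y = \<zeta>")
          case True
          then have "\<forall>\<^sub>F \<xi> in nhds y. \<xi> \<in> ball \<zeta> e'"
            using e' by (intro eventually_nhds_in_open) auto
          then show ?thesis by eventually_elim simp
        next
          case False
          with \<zeta> y have "y \<notin> ball z e" by blast
          moreover have "\<bar>y - z\<bar> \<noteq> e" using elim y by blast
          ultimately have "y \<in> - cball z e" by (auto simp: dist_real_def)
          then have "\<forall>\<^sub>F \<xi> in nhds y. \<xi> \<in> - cball z e"
            by (intro eventually_nhds_in_open) auto
          then show ?thesis by eventually_elim auto
        qed
        then have "\<forall>\<^sub>F w in upper v. \<forall>\<xi>\<in>sec w. \<xi> \<in> ball z e \<longrightarrow> \<xi> \<in> ball \<zeta> e'"
          by (intro stable) blast
        with elim(3) show ?thesis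
        proof eventually_elim
          case (elim w)
          then have "sec w \<inter> ball \<zeta> e' = sec w \<inter> ball z e" using sub by blast
          with elim show ?case by simp
        qed
      qed
      have "\<zeta> \<in> ball z e" using \<zeta> by blast
      then have "0 < e - \<bar>\<zeta> - z\<bar>"
        by (auto simp: dist_real_def)
      with small have "\<forall>\<^sub>F e' in at_right 0. \<forall>\<^sub>F w in upper v. \<exists>\<xi>. sec w \<inter> ball \<zeta> e' = {\<xi>}"
        by (intro eventually_at_rightI[of 0 "e - \<bar>\<zeta> - z\<bar>"]) auto
      with \<zeta> have "crossing sec v \<zeta>" by (auto simp: crossing_def)
      with \<zeta> show ?case by (auto simp: crossing_chart_def)
    qed
  qed
  then show ?thesis
    unfolding eventually_at_right_field using e0(1) by (intro exI[of _ "e0 / 2"]) auto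
qed

lemma eventually_chart:
  assumes "0 \<le> snd q" "z \<in> sec q"
  shows "\<forall>\<^sub>F e in at_right 0. \<forall>\<^sub>F v in upper q.
    if crossing sec q z then crossing_chart sec z e v else fold_chart sec z e v"
  by (cases "crossing sec q z") (use assms fold[of q z] eventually_crossing_chart[of q z] in simp_all)

text \<open>A fiber is compact, and the charts, read at \<open>q\<close> itself, leave at most two
  of its points in a small ball.\<close>

lemma finite_sec:
  assumes "0 \<le> snd q"
  shows "finite (sec q)"
proof (rule ccontr)
  assume "infinite (sec q)"
  then obtain z where z: "z \<in> sec q" "z islimpt sec q"
    using compact_sec[of q] unfolding compact_eq_Bolzano_Weierstrass by blast
  have "\<forall>\<^sub>F e in at_right 0. finite (sec q \<inter> ball z e)"
    using eventually_chart[OF assms z(1)]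
  proof eventually_elim
    case (elim e)
    from eventually_upper_imp[OF elim assms] show ?case
      by (auto simp: crossing_chart_def fold_chart_def split: if_splits)
  qed
  then obtain e where "0 < e" "finite (sec q \<inter> ball z e)"
    unfolding eventually_at_right_field by (meson dense)
  with z(2) show False
    unfolding islimpt_eq_infinite_ball by blast
qed

section \<open>Scales adapted to a fiber, and the germs that count pairs at outer folds\<close>

text \<open>The factor 2 makes the open balls disjoint, so that the points of a nearby fiber split
  into groups, one for each point of \<open>sec q\<close>. A common radius exists because the fiber
  is finite.\<close>

definition admissible :: "real \<times> real \<Rightarrow> real \<Rightarrow> bool"
  where "admissible q e \<longleftrightarrow> 0 < e \<and>
    (\<forall>z\<in>sec q. \<forall>z'\<in>sec q. z \<noteq> z' \<longrightarrow> 2 * e \<le> \<bar>z - z'\<bar>) \<and>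
    (\<forall>\<^sub>F v in upper q. sec v \<subseteq> (\<Union>z\<in>sec q. ball z e)) \<and>
    (\<forall>z\<in>sec q. \<forall>\<^sub>F v in upper q.
      if crossing sec q z then crossing_chart sec z e v else fold_chart sec z e v)"

lemma eventually_admissible:
  assumes q: "0 \<le> snd q"
  shows "\<forall>\<^sub>F e in at_right 0. admissible q e"
proof -
  note fin = finite_sec[OF q]
  have pos: "\<forall>\<^sub>F e in at_right 0. 0 < (e::real)"
    by (simp add: eventually_at_right_less)
  have "\<forall>\<^sub>F e in at_right 0. z \<noteq> z' \<longrightarrow> 2 * e \<le> \<bar>z - z'\<bar>" for z z' :: real
    unfolding eventually_at_right_field
    by (intro exI[of _ "if z = z' then 1 else \<bar>z - z'\<bar> / 2"]) auto
  then have sep: "\<forall>\<^sub>F e in at_right 0. \<forall>z\<in>sec q. \<forall>z'\<in>sec q. z \<noteq> z' \<longrightarrow> 2 * e \<le> \<bar>z - z'\<bar>"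
    by (intro eventually_ball_finite fin ballI)
  have cover: "\<forall>\<^sub>F v in upper q. sec v \<subseteq> (\<Union>z\<in>sec q. ball z e)" if "0 < e" for e
  proof -
    have "\<forall>\<^sub>F v in upper q. \<forall>\<xi>\<in>sec v. \<xi> \<in> (\<Union>z\<in>sec q. ball z e)"
    proof (rule stable, intro ballI eventually_nhds_in_open)
      fix z assume "z \<in> sec q"
      moreover have "z \<in> ball z e" using \<open>0 < e\<close> by simp
      ultimately show "z \<in> (\<Union>z\<in>sec q. ball z e)" by blast
    qed auto
    then show ?thesis by eventually_elim blast
  qed
  have "\<forall>\<^sub>F e in at_right 0. \<forall>z\<in>sec q. \<forall>\<^sub>F v in upper q.
      if crossing sec q z then crossing_chart sec z e v else fold_chart sec z e v"
    by (intro eventually_ball_finite fin ballI eventually_chart q)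
  with pos sep show ?thesis
    by eventually_elim (auto simp: admissible_def intro: cover)
qed

text \<open>Any smaller ball serves equally well: for fibers close to \<open>q\<close> it contains
  the same points, see \<open>eventually_sec_ball_radius\<close>.\<close>

definition radius :: "real \<times> real \<Rightarrow> real"
  where "radius q = (SOME e. admissible q e)"

lemma admissible_radius:
  assumes "0 \<le> snd q"
  shows "admissible q (radius q)"
proof -
  have "\<exists>e. admissible q e"
    using eventually_happens[OF eventually_admissible[OF assms]] trivial_limit_at_right_real by blast
  then show ?thesis unfolding radius_def by (rule someI_ex)
qed

definition above :: "real \<times> real \<Rightarrow> real \<Rightarrow> real set"
  where "above q z = {\<zeta> \<in> sec q. z < \<zeta> \<and> crossing sec q \<zeta>}"

definition outer_fold :: "real \<times> real \<Rightarrow> real \<Rightarrow> bool"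
  where "outer_fold q z \<longleftrightarrow> z \<in> sec q \<and> \<not> crossing sec q z \<and> even (card (above q z))"

text \<open>Entering the image of an outer fold creates a pair of crossings. As the pair has to number two,
  a fiber that merely touches the surface contributes nothing.\<close>

definition germ :: "real \<times> real \<Rightarrow> real \<times> real \<Rightarrow> real"
  where "germ q v = real (card {z. outer_fold q z \<and> card (sec v \<inter> ball z (radius q)) = 2})"

text \<open>Each crossing over \<open>q\<close> persists as one crossing over \<open>v\<close>, and each fold gives none or two.\<close>

lemma even_above_iff:
  assumes fin: "finite (sec q)" "finite (sec v)"
    and sep: "\<forall>z\<in>sec q. \<forall>z'\<in>sec q. z \<noteq> z' \<longrightarrow> 2 * e \<le> \<bar>z - z'\<bar>"
    and cover: "sec v \<subseteq> (\<Union>z\<in>sec q. ball z e)"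
    and chart: "\<And>z. z \<in> sec q \<Longrightarrow>
      if crossing sec q z then crossing_chart sec z e v else fold_chart sec z e v"
    and z: "z \<in> sec q" "sec v \<inter> ball z e = {\<zeta>}"
  shows "even (card (above v \<zeta>)) \<longleftrightarrow> even (card (above q z))"
proof -
  define A where "A = {z'\<in>sec q. z < z'}"
  define cr where "cr = (\<lambda>z'. {\<xi> \<in> sec v \<inter> ball z' e. crossing sec v \<xi>})"
  have \<zeta>: "\<zeta> \<in> ball z e" using z(2) by blast
  \<comment> \<open>Disjoint balls are ordered like their centres, so what lies above \<zeta> comes
    from the points of \<open>sec q\<close> above \<open>z\<close>.\<close>
  have eq: "above v \<zeta> = (\<Union>z'\<in>A. cr z')"
  proof (intro equalityI subsetI)
    fix \<xi> assume \<xi>: "\<xi> \<in> above v \<zeta>"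
    then obtain z' where z': "z' \<in> sec q" "\<xi> \<in> ball z' e"
      using cover by (auto simp: above_def)
    have "z' \<noteq> z" using z(2) z' \<xi> by (auto simp: above_def)
    with sep z' z(1) have "2 * e \<le> \<bar>z - z'\<bar>" by (metis)
    then have "z < z'"
      using \<xi> \<zeta> z'(2) by (auto simp: above_def dist_real_def)
    then show "\<xi> \<in> (\<Union>z'\<in>A. cr z')"
      using z' \<xi> by (auto simp: above_def A_def cr_def)
  next
    fix \<xi> assume "\<xi> \<in> (\<Union>z'\<in>A. cr z')"
    then obtain z' where z': "z' \<in> sec q" "z < z'" "\<xi> \<in> sec v" "\<xi> \<in> ball z' e" "crossing sec v \<xi>"
      by (auto simp: A_def cr_def)
    with sep z(1) have "2 * e \<le> \<bar>z - z'\<bar>" by (metis less_irrefl)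
    then have "\<zeta> < \<xi>"
      using z' \<zeta> by (auto simp: dist_real_def)
    with z' show "\<xi> \<in> above v \<zeta>" by (simp add: above_def)
  qed
  have finA: "finite A" using fin by (simp add: A_def)
  have "card (above v \<zeta>) = (\<Sum>z'\<in>A. card (cr z'))"
    unfolding eq
  proof (rule card_UN_disjoint[OF finA])
    show "\<forall>i\<in>A. finite (cr i)" using fin by (simp add: cr_def)
    show "\<forall>i\<in>A. \<forall>j\<in>A. i \<noteq> j \<longrightarrow> cr i \<inter> cr j = {}"
    proof (intro ballI impI)
      fix i j assume ij: "i \<in> A" "j \<in> A" "i \<noteq> j"
      then have "2 * e \<le> \<bar>i - j\<bar>" using sep by (auto simp: A_def)
      then show "cr i \<inter> cr j = {}" by (auto simp: cr_def dist_real_def)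
    qed
  qed
  \<comment> \<open>Modulo two only the balls with an odd number of crossings matter, and these are
    the balls around crossings of \<open>q\<close>.\<close>
  then have "even (card (above v \<zeta>)) \<longleftrightarrow> even (card {z' \<in> A. odd (card (cr z'))})"
    using even_sum_iff[OF finA] by simp
  also have "{z' \<in> A. odd (card (cr z'))} = above q z"
  proof -
    have "odd (card (cr z')) \<longleftrightarrow> crossing sec q z'" if z': "z' \<in> sec q" for z'
    proof (cases "crossing sec q z'")
      case True
      then obtain \<xi> where \<xi>: "sec v \<inter> ball z' e = {\<xi>}" "crossing sec v \<xi>"
        using chart[OF z'] unfolding crossing_chart_def by auto
      then have "cr z' = {\<xi>}" unfolding cr_def \<xi>(1) by blast
      with True show ?thesis by simp
    next
      case False
      then have "fold_chart sec z' e v" using chart[OF z'] by simp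
      then have "card (cr z') = 0 \<or> card (cr z') = 2"
        unfolding fold_chart_def
      proof (elim disjE exE conjE)
        fix \<zeta>\<^sub>1 \<zeta>\<^sub>2 assume a: "\<zeta>\<^sub>1 \<noteq> \<zeta>\<^sub>2" "sec v \<inter> ball z' e = {\<zeta>\<^sub>1, \<zeta>\<^sub>2}" "crossing sec v \<zeta>\<^sub>1" "crossing sec v \<zeta>\<^sub>2"
        then have "cr z' = {\<zeta>\<^sub>1, \<zeta>\<^sub>2}" unfolding cr_def a(2) by blast
        with a show ?thesis by simp
      next
        fix \<zeta>' assume a: "sec v \<inter> ball z' e = {\<zeta>'}" "\<not> crossing sec v \<zeta>'"
        then have "cr z' = {}" unfolding cr_def a(1) by blast
        then show ?thesis by simp
      next
        assume a: "sec v \<inter> ball z' e = {}"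
        then have "cr z' = {}" unfolding cr_def a by blast
        then show ?thesis by simp
      qed
      with False show ?thesis by auto
    qed
    then show ?thesis by (auto simp: A_def above_def)
  qed
  finally show ?thesis .
qed

text \<open>Refinement of scales: over base points near \<open>v\<close>, the ball about
  \<open>z\<close> at the scale of \<open>q\<close> is exhausted by the balls at the scale of
  \<open>v\<close> whose centres it contains. Points of \<open>sec v\<close> in other balls of
  \<open>q\<close> are too far away to interfere.\<close>

lemma eventually_sec_ball:
  assumes sep: "\<forall>z\<in>sec q. \<forall>z'\<in>sec q. z \<noteq> z' \<longrightarrow> 2 * e \<le> \<bar>z - z'\<bar>"
    and cover: "sec v \<subseteq> (\<Union>z\<in>sec q. ball z e)"
    and z: "z \<in> sec q"
    and e': "0 < e'" "\<forall>z\<in>sec v. \<forall>z'\<in>sec v. z \<noteq> z' \<longrightarrow> 2 * e' \<le> \<bar>z - z'\<bar>"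
  shows "\<forall>\<^sub>F w in upper v. sec w \<inter> ball z e = (\<Union>\<zeta>\<in>sec v \<inter> ball z e. sec w \<inter> ball \<zeta> e')"
proof -
  have "\<forall>\<^sub>F w in upper v. \<forall>\<xi>\<in>sec w. \<xi> \<in> ball z e \<longleftrightarrow> (\<exists>\<zeta>\<in>sec v \<inter> ball z e. \<xi> \<in> ball \<zeta> e')"
  proof (rule stable, intro ballI)
    fix y assume y: "y \<in> sec v"
    then obtain z' where z': "z' \<in> sec q" "y \<in> ball z' e" using cover by blast
    have "\<forall>\<^sub>F \<xi> in nhds y. \<xi> \<in> ball z' e" "\<forall>\<^sub>F \<xi> in nhds y. \<xi> \<in> ball y e'"
      using z' e' by (auto intro: eventually_nhds_in_open simp del: mem_ball)
    then show "\<forall>\<^sub>F \<xi> in nhds y. \<xi> \<in> ball z e \<longleftrightarrow> (\<exists>\<zeta>\<in>sec v \<inter> ball z e. \<xi> \<in> ball \<zeta> e')"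
    proof eventually_elim
      case (elim \<xi>)
      show ?case
      proof (cases "z' = z")
        case True
        with elim y z' show ?thesis by blast
      next
        case False
        then have d: "2 * e \<le> \<bar>z - z'\<bar>" using sep z z' by metis
        then have "\<xi> \<notin> ball z e" using elim by (auto simp: dist_real_def)
        moreover have "\<xi> \<notin> ball \<zeta> e'" if \<zeta>: "\<zeta> \<in> sec v \<inter> ball z e" for \<zeta>
        proof -
          have "\<zeta> \<noteq> y" using \<zeta> z' d by (auto simp: dist_real_def)
          then have "2 * e' \<le> \<bar>\<zeta> - y\<bar>" using e'(2) \<zeta> y by (metis IntD1)
          then show ?thesis using elim by (auto simp: dist_real_def)
        qed
        ultimately show ?thesis by blast
      qed
    qed
  qed
  then show ?thesis by eventually_elim auto
qed

text \<open>Over \<open>v\<close>, an outer fold of \<open>q\<close> has disappeared, has become two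
  crossings, or is still a fold. In the first case its ball stays empty around \<open>v\<close>; in
  the second it keeps two points, which accounts for the constant. The surviving folds correspond to
  the outer folds of \<open>v\<close>, because parity is preserved, and both germs count them
  alike.\<close>

lemma germ_cocycle:
  assumes q: "0 \<le> snd q"
  shows "\<forall>\<^sub>F v in upper q. \<exists>k. \<forall>\<^sub>F w in upper v. germ q w = germ v w + k"
proof -
  define e where "e = radius q"
  have adm: "0 < e" and sep: "\<forall>z\<in>sec q. \<forall>z'\<in>sec q. z \<noteq> z' \<longrightarrow> 2 * e \<le> \<bar>z - z'\<bar>"
    and cover: "\<forall>\<^sub>F v in upper q. sec v \<subseteq> (\<Union>z\<in>sec q. ball z e)"
    and chart: "\<forall>z\<in>sec q. \<forall>\<^sub>F v in upper q.
      if crossing sec q z then crossing_chart sec z e v else fold_chart sec z e v"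
    using admissible_radius[OF q] unfolding admissible_def e_def by blast+
  note fin = finite_sec[OF q]
  have "\<forall>\<^sub>F v in upper q. \<forall>z\<in>sec q.
      if crossing sec q z then crossing_chart sec z e v else fold_chart sec z e v"
    by (rule eventually_ball_finite[OF fin chart])
  with cover eventually_upper_nonneg show ?thesis
  proof eventually_elim
    case (elim v)
    note cov = elim(1) and v = elim(2)
    have ch: "\<And>z. z \<in> sec q \<Longrightarrow>
      if crossing sec q z then crossing_chart sec z e v else fold_chart sec z e v"
      using elim(3) by blast
    define e' where "e' = radius v"
    have e': "0 < e'" and sep': "\<forall>z\<in>sec v. \<forall>z'\<in>sec v. z \<noteq> z' \<longrightarrow> 2 * e' \<le> \<bar>z - z'\<bar>"
      and chart': "\<forall>z\<in>sec v. \<forall>\<^sub>F w in upper v.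
        if crossing sec v z then crossing_chart sec z e' w else fold_chart sec z e' w"
      using admissible_radius[OF v] unfolding admissible_def e'_def by blast+
    note fin' = finite_sec[OF v]
    define Two where "Two = {z. outer_fold q z \<and> card (sec v \<inter> ball z e) = 2}"
    have outer_sec: "z \<in> sec q" "fold_chart sec z e v" if "outer_fold q z" for z
      using that ch[of z] by (auto simp: outer_fold_def)
    have finO: "finite {z. outer_fold q z \<and> P z}" for P
      by (rule finite_subset[OF _ fin]) (auto simp: outer_fold_def)
    have "\<forall>\<^sub>F w in upper v. \<forall>z\<in>sec v.
        if crossing sec v z then crossing_chart sec z e' w else fold_chart sec z e' w"
      by (rule eventually_ball_finite[OF fin' chart'])
    moreover have "\<forall>\<^sub>F w in upper v. \<forall>z\<in>sec q.
        sec w \<inter> ball z e = (\<Union>\<zeta>\<in>sec v \<inter> ball z e. sec w \<inter> ball \<zeta> e')"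
      by (intro eventually_ball_finite fin ballI eventually_sec_ball[OF sep cov] e' sep')
    ultimately have "\<forall>\<^sub>F w in upper v. germ q w = germ v w + real (card Two)"
    proof eventually_elim
      case (elim w)
      define One where "One = {z. outer_fold q z \<and> (\<exists>\<zeta>. sec v \<inter> ball z e = {\<zeta>}) \<and> card (sec w \<inter> ball z e) = 2}"
      \<comment> \<open>Each of the two crossings persists as one point, and the separation at
        \<open>v\<close> keeps these points distinct.\<close>
      have two: "card (sec w \<inter> ball z e) = 2" if "z \<in> Two" for z
      proof -
        have z: "outer_fold q z" "card (sec v \<inter> ball z e) = 2" using that by (auto simp: Two_def)
        obtain \<zeta>\<^sub>1 \<zeta>\<^sub>2 where a: "\<zeta>\<^sub>1 \<noteq> \<zeta>\<^sub>2" "sec v \<inter> ball z e = {\<zeta>\<^sub>1, \<zeta>\<^sub>2}" "crossing sec v \<zeta>\<^sub>1" "crossing sec v \<zeta>\<^sub>2"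
          using outer_sec(2)[OF z(1)] z(2) unfolding fold_chart_def by force
        have in_v: "\<zeta>\<^sub>1 \<in> sec v" "\<zeta>\<^sub>2 \<in> sec v" using a(2) by blast+
        then obtain \<xi>\<^sub>1 \<xi>\<^sub>2 where x: "sec w \<inter> ball \<zeta>\<^sub>1 e' = {\<xi>\<^sub>1}" "sec w \<inter> ball \<zeta>\<^sub>2 e' = {\<xi>\<^sub>2}"
          using elim(1) a unfolding crossing_chart_def by metis
        have "2 * e' \<le> \<bar>\<zeta>\<^sub>1 - \<zeta>\<^sub>2\<bar>" using sep' in_v a by blast
        moreover have "\<xi>\<^sub>1 \<in> ball \<zeta>\<^sub>1 e'" "\<xi>\<^sub>2 \<in> ball \<zeta>\<^sub>2 e'" using x by blast+
        ultimately have "\<xi>\<^sub>1 \<noteq> \<xi>\<^sub>2" by (auto simp: dist_real_def)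
        moreover have "sec w \<inter> ball z e = {\<xi>\<^sub>1, \<xi>\<^sub>2}"
        proof -
          have "sec w \<inter> ball z e = (\<Union>\<zeta>\<in>{\<zeta>\<^sub>1, \<zeta>\<^sub>2}. sec w \<inter> ball \<zeta> e')"
            using elim(2) outer_sec(1)[OF z(1)] unfolding a(2)[symmetric] by blast
          then show ?thesis using x by auto
        qed
        ultimately show ?thesis by simp
      qed
      have "{z. outer_fold q z \<and> card (sec w \<inter> ball z e) = 2} = Two \<union> One"
      proof (intro equalityI subsetI)
        fix z assume "z \<in> {z. outer_fold q z \<and> card (sec w \<inter> ball z e) = 2}"
        then have z: "outer_fold q z" "card (sec w \<inter> ball z e) = 2" by auto
        from outer_sec(2)[OF z(1)] consider "sec v \<inter> ball z e = {}" | "\<exists>\<zeta>. sec v \<inter> ball z e = {\<zeta>}"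
          | "card (sec v \<inter> ball z e) = 2" unfolding fold_chart_def by (metis card_2_iff)
        then show "z \<in> Two \<union> One"
        proof cases
          case 1
          then have "sec w \<inter> ball z e = {}" using elim(2) outer_sec(1)[OF z(1)] by simp
          with z show ?thesis by simp
        qed (use z in \<open>auto simp: Two_def One_def\<close>)
      qed (use two in \<open>auto simp: Two_def One_def\<close>)
      moreover have "Two \<inter> One = {}" by (auto simp: Two_def One_def)
      ultimately have "germ q w = real (card Two) + real (card One)"
        unfolding germ_def e_def[symmetric]
        by (simp add: card_Un_disjoint Two_def One_def finO)
      \<comment> \<open>A surviving fold is matched with the only point of \<open>sec v\<close> in
        its ball.\<close>
      moreover have "card One = card {\<zeta>. outer_fold v \<zeta> \<and> card (sec w \<inter> ball \<zeta> e') = 2}"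
      proof (rule bij_betw_same_card[of "\<lambda>z. the_elem (sec v \<inter> ball z e)"], rule bij_betw_imageI)
        have key: "outer_fold v \<zeta> \<and> card (sec w \<inter> ball \<zeta> e') = 2 \<longleftrightarrow> outer_fold q z \<and> card (sec w \<inter> ball z e) = 2"
          if z: "z \<in> sec q" "sec v \<inter> ball z e = {\<zeta>}" for z \<zeta>
        proof -
          have "\<zeta> \<in> sec v" using z by blast
          moreover have "crossing sec v \<zeta> \<longleftrightarrow> crossing sec q z"
          proof (cases "crossing sec q z")
            case True
            then show ?thesis using ch[OF z(1)] z(2) unfolding crossing_chart_def by auto
          next
            case False
            then have "fold_chart sec z e v" using ch[OF z(1)] by simp
            with False show ?thesis unfolding fold_chart_def z(2) by auto
          qed
          ultimately have "outer_fold v \<zeta> \<longleftrightarrow> outer_fold q z"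
            using even_above_iff[OF fin fin' sep cov ch z] z(1) unfolding outer_fold_def by blast
          moreover have "sec w \<inter> ball z e = sec w \<inter> ball \<zeta> e'"
          proof -
            have "sec w \<inter> ball z e = (\<Union>\<zeta>\<in>{\<zeta>}. sec w \<inter> ball \<zeta> e')"
              using elim(2) z(1) unfolding z(2)[symmetric] by blast
            then show ?thesis by auto
          qed
          ultimately show ?thesis by simp
        qed
        show "inj_on (\<lambda>z. the_elem (sec v \<inter> ball z e)) One"
        proof (rule inj_onI)
          fix z z' assume zz: "z \<in> One" "z' \<in> One" and eq: "the_elem (sec v \<inter> ball z e) = the_elem (sec v \<inter> ball z' e)"
          then obtain \<zeta> \<zeta>' where \<zeta>: "sec v \<inter> ball z e = {\<zeta>}" "sec v \<inter> ball z' e = {\<zeta>'}"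
            unfolding One_def by blast
          with eq have "\<zeta>' = \<zeta>" by (simp only: the_elem_eq)
          with \<zeta> have "\<zeta> \<in> ball z e" "\<zeta> \<in> ball z' e" by blast+
          then have "\<not> 2 * e \<le> \<bar>z - z'\<bar>" by (auto simp: dist_real_def)
          moreover have "z \<in> sec q" "z' \<in> sec q" using zz by (auto simp only: One_def outer_fold_def)
          ultimately show "z = z'" using sep by blast
        qed
        show "(\<lambda>z. the_elem (sec v \<inter> ball z e)) ` One = {\<zeta>. outer_fold v \<zeta> \<and> card (sec w \<inter> ball \<zeta> e') = 2}"
        proof (intro equalityI subsetI)
          fix \<zeta> assume "\<zeta> \<in> (\<lambda>z. the_elem (sec v \<inter> ball z e)) ` One"
          then obtain z where z: "z \<in> One" "\<zeta> = the_elem (sec v \<inter> ball z e)" by blast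
          moreover from z(1) obtain \<zeta>' where "sec v \<inter> ball z e = {\<zeta>'}"
            unfolding One_def by blast
          ultimately have "sec v \<inter> ball z e = {\<zeta>}" by (simp only: the_elem_eq)
          moreover have "z \<in> sec q" "outer_fold q z" "card (sec w \<inter> ball z e) = 2"
            using z(1) unfolding One_def outer_fold_def by blast+
          ultimately show "\<zeta> \<in> {\<zeta>. outer_fold v \<zeta> \<and> card (sec w \<inter> ball \<zeta> e') = 2}"
            using key[of z \<zeta>] by blast
        next
          fix \<zeta> assume "\<zeta> \<in> {\<zeta>. outer_fold v \<zeta> \<and> card (sec w \<inter> ball \<zeta> e') = 2}"
          then have \<zeta>: "outer_fold v \<zeta>" "card (sec w \<inter> ball \<zeta> e') = 2" by auto
          \<comment> \<open>Conversely, a fold over \<open>v\<close> lies in the ball of some point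
            of \<open>sec q\<close>. That point cannot be a crossing, and in its fold chart only the
            case of a single point admits a point that is not a crossing.\<close>
          then have \<zeta>v: "\<zeta> \<in> sec v" "\<not> crossing sec v \<zeta>" by (auto simp: outer_fold_def)
          then obtain z where z: "z \<in> sec q" "\<zeta> \<in> ball z e" using cov by blast
          have "sec v \<inter> ball z e = {\<zeta>}"
          proof (cases "crossing sec q z")
            case True
            then obtain \<xi> where \<xi>: "sec v \<inter> ball z e = {\<xi>}" "crossing sec v \<xi>"
              using ch[OF z(1)] unfolding crossing_chart_def by auto
            moreover have "\<zeta> \<in> sec v \<inter> ball z e" using z \<zeta>v by blast
            ultimately have "\<zeta> = \<xi>" by (metis singletonD)
            with \<xi>(2) \<zeta>v(2) show ?thesis by blast
          next
            case False
            then have "fold_chart sec z e v" using ch[OF z(1)] by simp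
            moreover have "\<zeta> \<in> sec v \<inter> ball z e" using z \<zeta>v by blast
            ultimately show ?thesis using \<zeta>v(2) unfolding fold_chart_def by (metis empty_iff insert_iff)
          qed
          moreover from key[OF z(1) this] \<zeta> this have "z \<in> One" unfolding One_def by blast
          ultimately show "\<zeta> \<in> (\<lambda>z. the_elem (sec v \<inter> ball z e)) ` One"
            by (intro image_eqI[of _ _ z]) (simp only: the_elem_eq)
        qed
      qed
      ultimately show ?case
        by (simp add: germ_def e'_def)
    qed
    then show ?case ..
  qed
qed

lemma germ_empty: "sec q = {} \<Longrightarrow> germ q w = 0"
  by (simp add: germ_def outer_fold_def)

text \<open>Fibers beyond \<open>R\<close> are empty, so the germs vanish on three sides of the
  rectangle over the segment from \<open>- R\<close> to \<open>R\<close>, and \<open>f\<close> is a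
  primitive of them along the fourth.\<close>

lemma total_germ:
  assumes R: "0 \<le> R" "\<And>v. R \<le> \<bar>fst v\<bar> \<or> R \<le> \<bar>snd v\<bar> \<Longrightarrow> sec v = {}"
    and f: "\<And>x. \<exists>k. \<forall>\<^sub>F t in nhds x. f t = germ (x, 0) (t, 0) + k"
  shows "f (- R) = f R"
proof (rule no_monodromy[where g = germ and a = "-R" and b = R and c = 0 and d = R])
  fix q assume q: "q \<in> {- R..R} \<times> {0..R}"
  then have "0 \<le> snd q" by auto
  from germ_cocycle[OF this]
  have "\<forall>\<^sub>F v in nhds q. 0 \<le> snd v \<longrightarrow> (\<exists>k. \<forall>\<^sub>F w in nhds v. 0 \<le> snd w \<longrightarrow> germ q w = germ v w + k)"
    unfolding eventually_upper .
  then show "\<forall>\<^sub>F v in nhds q. v \<in> {- R..R} \<times> {0..R} \<longrightarrow>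
        (\<exists>k. \<forall>\<^sub>F w in nhds v. w \<in> {- R..R} \<times> {0..R} \<longrightarrow> germ q w = germ v w + k)"
  proof (rule eventually_mono, intro impI)
    fix v assume v: "0 \<le> snd v \<longrightarrow> (\<exists>k. \<forall>\<^sub>F w in nhds v. 0 \<le> snd w \<longrightarrow> germ q w = germ v w + k)"
      "v \<in> {- R..R} \<times> {0..R}"
    then obtain k where "\<forall>\<^sub>F w in nhds v. 0 \<le> snd w \<longrightarrow> germ q w = germ v w + k" by auto
    then have "\<forall>\<^sub>F w in nhds v. w \<in> {- R..R} \<times> {0..R} \<longrightarrow> germ q w = germ v w + k"
      by (rule eventually_mono) auto
    then show "\<exists>k. \<forall>\<^sub>F w in nhds v. w \<in> {- R..R} \<times> {0..R} \<longrightarrow> germ q w = germ v w + k" ..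
  qed
next
  fix q w :: "real \<times> real" assume "fst q = -R \<or> fst q = R \<or> snd q = R"
  then show "germ q w = 0" using R by (intro germ_empty R(2)) auto
qed (use R f in auto)

end

section \<open>Transversal and folded points of a smooth surface\<close>

lemma deriv_pos_less:
  fixes h h' :: "real \<Rightarrow> real"
  assumes "a < b" and "\<And>x. a \<le> x \<Longrightarrow> x \<le> b \<Longrightarrow> (h has_real_derivative h' x) (at x)"
    and "\<And>x. a \<le> x \<Longrightarrow> x \<le> b \<Longrightarrow> 0 < h' x"
  shows "h a < h b"
  by (rule DERIV_pos_imp_increasing[OF assms(1)]) (use assms(2,3) in blast)

lemma increasing_zero:
  fixes h h' :: "real \<Rightarrow> real"
  assumes "a < b" and deriv: "\<And>x. a \<le> x \<Longrightarrow> x \<le> b \<Longrightarrow> (h has_real_derivative h' x) (at x)"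
    and pos: "\<And>x. a \<le> x \<Longrightarrow> x \<le> b \<Longrightarrow> 0 < h' x" and ends: "h a < 0" "0 < h b"
  shows "\<exists>\<zeta>. {x \<in> {a<..<b}. h x = 0} = {\<zeta>}"
proof -
  have mono: "h x < h y" if "a \<le> x" "x < y" "y \<le> b" for x y
    using that by (intro deriv_pos_less[of x y h h'] deriv pos) auto
  have cont: "\<forall>x. a \<le> x \<and> x \<le> b \<longrightarrow> isCont h x"
    using deriv DERIV_isCont by blast
  obtain \<zeta> where "a \<le> \<zeta>" "\<zeta> \<le> b" "h \<zeta> = 0"
    using IVT[of h a 0 b] assms(1) ends cont by auto
  moreover from this have "\<zeta> \<noteq> a" "\<zeta> \<noteq> b" using ends by auto
  ultimately have "{x \<in> {a<..<b}. h x = 0} = {\<zeta>}"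
    using mono[of _ \<zeta>] mono[of \<zeta>] by (auto simp: set_eq_iff) (metis less_irrefl less_imp_le linorder_neqE_linordered_idom)
  then show ?thesis ..
qed

context
  fixes h h' h'' :: "real \<Rightarrow> real" and a b :: real
  assumes deriv: "\<forall>x\<in>{a..b}. (h has_real_derivative h' x) (at x)"
    and deriv2: "\<forall>x\<in>{a..b}. (h' has_real_derivative h'' x) (at x)"
    and convex: "\<forall>x\<in>{a..b}. 0 < h'' x"
begin

lemma convex_deriv_less: "a \<le> x \<Longrightarrow> x < y \<Longrightarrow> y \<le> b \<Longrightarrow> h' x < h' y"
  using deriv2 convex by (intro deriv_pos_less[of x y h' h'']) auto

lemma convex_tangent_less:
  assumes "a \<le> x" "x \<le> b" "a \<le> y" "y \<le> b" "x \<noteq> y"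
  shows "h x + h' x * (y - x) < h y"
proof (cases "x < y")
  case True
  then obtain \<xi> where "x < \<xi>" "\<xi> < y" "h y - h x = (y - x) * h' \<xi>"
    using MVT2[of x y h h'] deriv assms by auto
  moreover have "h' x < h' \<xi>" using convex_deriv_less[of x \<xi>] calculation assms by auto
  ultimately show ?thesis using True by (smt (verit) mult.commute mult_less_cancel_left_pos)
next
  case False
  then have "y < x" using assms by simp
  then obtain \<xi> where "y < \<xi>" "\<xi> < x" "h x - h y = (x - y) * h' \<xi>"
    using MVT2[of y x h h'] deriv assms by auto
  moreover have "h' \<xi> < h' x" using convex_deriv_less[of \<xi> x] calculation assms by auto
  ultimately have "h x - h y < (x - y) * h' x" using \<open>y < x\<close> by (simp add: mult_less_cancel_left_pos)
  then show ?thesis by (simp add: algebra_simps)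
qed

text \<open>The tangent at the middle point does not descend towards one of the two ends, and the
  function at that end lies strictly above the tangent.\<close>

lemma convex_between_less:
  assumes "a \<le> x" "x < y" "y < w" "w \<le> b" "h x \<le> m" "h w \<le> m"
  shows "h y < m"
proof -
  have t: "h y + h' y * (x - y) < h x" "h y + h' y * (w - y) < h w"
    using assms by (auto intro!: convex_tangent_less)
  show ?thesis
  proof (cases "0 \<le> h' y")
    case True
    then have "0 \<le> h' y * (w - y)" using assms by simp
    then show ?thesis using t assms by simp
  next
    case False
    then have "0 \<le> h' y * (x - y)" using assms by (simp add: mult_nonpos_nonpos)
    then show ?thesis using t assms by simp
  qed
qed

text \<open>A zero with zero slope is the strict minimum, hence the only zero. Next to a zero with
  nonzero slope the function is negative on one side and, as the ends are positive, returns to zero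
  on that side; of three zeros the middle one would be negative. The second zero has nonzero slope
  too, since otherwise it would be the strict minimum.\<close>

lemma convex_zeros:
  assumes "a < b" and ends: "0 < h a" "0 < h b"
  shows "{x \<in> {a<..<b}. h x = 0} = {} \<or>
    (\<exists>\<zeta>. {x \<in> {a<..<b}. h x = 0} = {\<zeta>} \<and> h' \<zeta> = 0) \<or>
    (\<exists>\<zeta>\<^sub>1 \<zeta>\<^sub>2. \<zeta>\<^sub>1 \<noteq> \<zeta>\<^sub>2 \<and> {x \<in> {a<..<b}. h x = 0} = {\<zeta>\<^sub>1, \<zeta>\<^sub>2} \<and> h' \<zeta>\<^sub>1 \<noteq> 0 \<and> h' \<zeta>\<^sub>2 \<noteq> 0)"
proof (cases "{x \<in> {a<..<b}. h x = 0} = {}")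
  case False
  then obtain x where x: "a < x" "x < b" "h x = 0" by auto
  have cont: "\<And>x. a \<le> x \<and> x \<le> b \<Longrightarrow> isCont h x"
    using deriv DERIV_isCont by (metis atLeastAtMost_iff)
  show ?thesis
  proof (cases "h' x = 0")
    case True
    have "0 < h y" if "a < y" "y < b" "y \<noteq> x" for y
      using convex_tangent_less[of x y] that x True by auto
    then have "{x \<in> {a<..<b}. h x = 0} = {x}" using x by force
    with True show ?thesis by blast
  next
    case False
    have "\<exists>y. a < y \<and> y < b \<and> y \<noteq> x \<and> h y = 0"
    proof (cases "0 < h' x")
      case True
      then obtain d where d: "0 < d" "\<And>k. 0 < k \<Longrightarrow> k < d \<Longrightarrow> h (x - k) < h x"
        using DERIV_pos_inc_left[OF deriv[rule_format, of x]] x by auto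
      \<comment> \<open>Halving both bounds keeps \<open>x - k\<close> inside the interval and
        within the range where \<open>h\<close> lies below its value at \<open>x\<close>.\<close>
      define k where "k = min (d / 2) ((x - a) / 2)"
      have k: "0 < k" "k < d" "a < x - k" using d x by (auto simp: k_def min_def field_simps)
      then have "h (x - k) < 0" using d(2) x by metis
      then obtain y where "a \<le> y" "y \<le> x - k" "h y = 0"
        using IVT2[of h "x - k" 0 a] k ends cont x by force
      moreover have "y \<noteq> a" using calculation ends by auto
      ultimately show ?thesis using k x by (intro exI[of _ y]) auto
    next
      case neg: False
      then have "h' x < 0" using False by simp
      then obtain d where d: "0 < d" "\<And>k. 0 < k \<Longrightarrow> k < d \<Longrightarrow> h (x + k) < h x"
        using DERIV_neg_dec_right[OF deriv[rule_format, of x]] x by auto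
      define k where "k = min (d / 2) ((b - x) / 2)"
      have k: "0 < k" "k < d" "x + k < b" using d x by (auto simp: k_def min_def field_simps)
      then have "h (x + k) < 0" using d(2) x by metis
      then obtain y where "x + k \<le> y" "y \<le> b" "h y = 0"
        using IVT[of h "x + k" 0 b] k ends cont x by force
      moreover have "y \<noteq> b" using calculation ends by auto
      ultimately show ?thesis using k x by (intro exI[of _ y]) auto
    qed
    then obtain y where y: "a < y" "y < b" "y \<noteq> x" "h y = 0" by blast
    have third: False if "a < u" "u < v" "v < w" "w < b" "h u = 0" "h v = 0" "h w = 0" for u v w
      using convex_between_less[of u v w 0] that by auto
    have "h' y \<noteq> 0"
      using convex_tangent_less[of y x] x y by auto
    moreover have "{x \<in> {a<..<b}. h x = 0} = {x, y}"
    proof -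
      have "w = x \<or> w = y" if "a < w" "w < b" "h w = 0" for w
        using third[of x y w] third[of y x w] third[of x w y] third[of y w x] third[of w x y] third[of w y x]
          that x y by (smt (verit))
      then show ?thesis using x y by auto
    qed
    ultimately show ?thesis using y(3) False by (metis)
  qed
qed auto

end

section \<open>Directional derivatives of smooth functions\<close>

text \<open>With the direction as first argument, \<open>pd v\<close> maps smooth functions to
  smooth functions and can be iterated.\<close>

definition pd :: "'a::real_normed_vector \<Rightarrow> ('a \<Rightarrow> 'b::real_normed_vector) \<Rightarrow> 'a \<Rightarrow> 'b"
  where "pd v f = (\<lambda>p. frechet_derivative f (at p) v)"

lemma smooth_on_differentiable: "smooth_on U f \<Longrightarrow> p \<in> U \<Longrightarrow> f differentiable (at p)"
  unfolding smooth_on_def by (metis Ck_on.simps(2))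

lemma smooth_on_has_derivative:
  "smooth_on U f \<Longrightarrow> p \<in> U \<Longrightarrow> (f has_derivative (\<lambda>v. pd v f p)) (at p)"
  using smooth_on_differentiable[of U f p] by (simp add: pd_def frechet_derivative_works)

lemma smooth_on_pd: "smooth_on U f \<Longrightarrow> smooth_on U (pd v f)"
  unfolding smooth_on_def pd_def by (metis Ck_on.simps(2))

lemma smooth_on_continuous: "smooth_on U f \<Longrightarrow> continuous_on U f"
  unfolding smooth_on_def by (metis Ck_on.simps(1))

lemma Ck_on_cong:
  assumes "open U" "Ck_on k U f" "\<And>p. p \<in> U \<Longrightarrow> f p = g p"
  shows "Ck_on k U g"
  using assms(2,3)
proof (induction k arbitrary: f g)
  case 0
  then show ?case by (metis Ck_on.simps(1) continuous_on_cong)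
next
  case (Suc k)
  have *: "(g has_derivative frechet_derivative f (at p)) (at p)" if p: "p \<in> U" for p
  proof (rule has_derivative_transform_within_open[OF _ \<open>open U\<close> p])
    show "(f has_derivative frechet_derivative f (at p)) (at p)"
      using Suc.prems p by (simp add: frechet_derivative_works)
  qed (use Suc.prems in auto)
  then have eq: "frechet_derivative f (at p) v = frechet_derivative g (at p) v" if "p \<in> U" for p v
    using that by (metis frechet_derivative_at)
  have "Ck_on k U (\<lambda>p. frechet_derivative g (at p) v)" for v
  proof (rule Suc.IH)
    show "Ck_on k U (\<lambda>p. frechet_derivative f (at p) v)" using Suc.prems(1) by simp
  qed (rule eq)
  then show ?case using * by (auto simp: differentiable_def)
qed

lemma Ck_on_subset: "Ck_on k U f \<Longrightarrow> V \<subseteq> U \<Longrightarrow> Ck_on k V f"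
proof (induction k arbitrary: f)
  case 0
  then show ?case by (auto intro: continuous_on_subset)
next
  case (Suc k)
  then show ?case unfolding Ck_on.simps by blast
qed

lemma smooth_on_subset: "smooth_on U f \<Longrightarrow> V \<subseteq> U \<Longrightarrow> smooth_on V f"
  unfolding smooth_on_def using Ck_on_subset by blast

lemma Ck_on_linear:
  assumes "bounded_linear L" "open U" "Ck_on k U f"
  shows "Ck_on k U (\<lambda>p. L (f p))"
  using assms(3)
proof (induction k arbitrary: f)
  case 0
  then show ?case
    by (auto intro: bounded_linear.continuous_on[OF assms(1)])
next
  case (Suc k)
  have *: "((\<lambda>p. L (f p)) has_derivative (\<lambda>v. L (frechet_derivative f (at p) v))) (at p)" if "p \<in> U" for p
    using Suc.prems that
    by (intro bounded_linear.has_derivative[OF assms(1)]) (simp add: frechet_derivative_works)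
  have "Ck_on k U (\<lambda>p. frechet_derivative (\<lambda>p. L (f p)) (at p) v)" for v
  proof (rule Ck_on_cong[OF \<open>open U\<close> Suc.IH])
    show "Ck_on k U (\<lambda>p. frechet_derivative f (at p) v)" using Suc.prems by simp
    show "L (frechet_derivative f (at p) v) = frechet_derivative (\<lambda>p. L (f p)) (at p) v" if "p \<in> U" for p
      using frechet_derivative_at[OF *[OF that]] by (rule fun_cong)
  qed
  then show ?case using * by (auto simp: differentiable_def)
qed

lemma smooth_on_linear:
  "bounded_linear L \<Longrightarrow> open U \<Longrightarrow> smooth_on U f \<Longrightarrow> smooth_on U (\<lambda>p. L (f p))"
  unfolding smooth_on_def using Ck_on_linear by blast

lemma pd_linear:
  assumes "bounded_linear L" "smooth_on U f" "p \<in> U"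
  shows "pd v (\<lambda>p. L (f p)) p = L (pd v f p)"
proof -
  have "((\<lambda>p. L (f p)) has_derivative (\<lambda>v. L (pd v f p))) (at p)"
    by (rule bounded_linear.has_derivative[OF assms(1) smooth_on_has_derivative[OF assms(2,3)]])
  then show ?thesis using frechet_derivative_at unfolding pd_def by metis
qed

lemma smooth_on_uminus: "open U \<Longrightarrow> smooth_on U f \<Longrightarrow> smooth_on U (\<lambda>p. - f p)"
  using smooth_on_linear[OF bounded_linear_minus[OF bounded_linear_ident]] .

lemma pd_uminus: "smooth_on U f \<Longrightarrow> p \<in> U \<Longrightarrow> pd v (\<lambda>p. - f p) p = - pd v f p"
  using pd_linear[OF bounded_linear_minus[OF bounded_linear_ident]] .

lemma pd_cong_open:
  assumes "open U" "p \<in> U" "\<And>q. q \<in> U \<Longrightarrow> f q = g q"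
  shows "pd v f p = pd v g p"
proof -
  have "(f has_derivative D) (at p) \<longleftrightarrow> (g has_derivative D) (at p)" for D
    using has_derivative_transform_within_open[OF _ assms(1,2)] assms(3) by metis
  then show ?thesis by (simp add: pd_def frechet_derivative_def)
qed

lemma pd_scaleR: "smooth_on U f \<Longrightarrow> p \<in> U \<Longrightarrow> pd (c *\<^sub>R v) f p = c *\<^sub>R pd v f p"
  using linear_scale[OF has_derivative_linear[OF smooth_on_has_derivative]] by blast

lemma pd_add: "smooth_on U f \<Longrightarrow> p \<in> U \<Longrightarrow> pd (v + w) f p = pd v f p + pd w f p"
  using linear_add[OF has_derivative_linear[OF smooth_on_has_derivative]] by blast

lemma smooth_on_line_deriv:
  fixes f :: "'a::real_normed_vector \<Rightarrow> real"
  assumes "smooth_on U f" "q + t *\<^sub>R v \<in> U"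
  shows "((\<lambda>t. f (q + t *\<^sub>R v)) has_real_derivative pd v f (q + t *\<^sub>R v)) (at t)"
proof -
  have "((\<lambda>t. f (q + t *\<^sub>R v)) has_derivative (\<lambda>s. pd (s *\<^sub>R v) f (q + t *\<^sub>R v))) (at t)"
    by (rule has_derivative_compose[where f = "\<lambda>t. q + t *\<^sub>R v" and g = f,
          OF _ smooth_on_has_derivative[OF assms]])
       (auto intro!: derivative_eq_intros)
  then show ?thesis
    by (simp add: has_field_derivative_def pd_scaleR[OF assms] mult.commute[of _ "pd v f _"])
qed

lemma smooth_on_fiber_deriv:
  fixes f :: "real \<times> real \<times> real \<Rightarrow> real"
  assumes "smooth_on U f" "(x, y, z) \<in> U"
  shows "((\<lambda>z. f (x, y, z)) has_real_derivative pd (0, 0, 1) f (x, y, z)) (at z)"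
  using smooth_on_line_deriv[of U f "(x, y, 0)" z "(0, 0, 1)"] assms by simp

lemma pd_coords:
  fixes f :: "real \<times> real \<times> real \<Rightarrow> real"
  assumes "smooth_on U f" "p \<in> U"
  shows "pd (a, b, c) f p = a * pd (1, 0, 0) f p + b * pd (0, 1, 0) f p + c * pd (0, 0, 1) f p"
proof -
  have "(a, b, c) = a *\<^sub>R (1, 0, 0) + (b *\<^sub>R (0, 1, 0) + c *\<^sub>R (0, 0, 1::real))" by simp
  then show ?thesis
    by (simp only: pd_add[OF assms] pd_scaleR[OF assms]) simp
qed

section \<open>Local equations of the surface at transversal and at folded points\<close>

definition sec :: "(real \<times> real \<times> real) set \<Rightarrow> real \<times> real \<Rightarrow> real set"
  where "sec S v = {z. (fst v, snd v, z) \<in> S}"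

text \<open>The inequality \<open>0 \<le> y\<close> takes the place of the boundary of \<open>S\<close>: near a boundary point at which
  \<open>S\<close> is not tangent to the plane \<open>y = 0\<close>, the zero set of \<open>f\<close> leaves the half space along the boundary.\<close>

definition regular_equation where
  "regular_equation S U f \<longleftrightarrow> open U \<and> smooth_on U f \<and>
    (\<forall>p\<in>U. p \<in> S \<longleftrightarrow> f p = 0 \<and> 0 \<le> fst (snd p)) \<and>
    (\<forall>p\<in>U. \<exists>v. pd v f p \<noteq> 0)"
  for S :: "(real \<times> real \<times> real) set" and f :: "real \<times> real \<times> real \<Rightarrow> real"

lemma regular_equation_uminus:
  "regular_equation S U f \<Longrightarrow> regular_equation S U (\<lambda>p. - f p)"
  unfolding regular_equation_def by (auto simp: smooth_on_uminus pd_uminus)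

text \<open>Base and fiber coordinates are separated: the range of heights is fixed before the base
  point varies, so that a whole piece of each nearby fiber is controlled at once.\<close>

lemma eventually_nhds_fiber:
  fixes x y z :: real
  assumes "eventually P (nhds (x, y, z))"
  obtains e0 where "0 < e0" "\<forall>\<^sub>F v in nhds (x, y). \<forall>\<zeta>. \<bar>\<zeta> - z\<bar> < e0 \<longrightarrow> P (fst v, snd v, \<zeta>)"
proof -
  obtain Q R where QR: "eventually Q (nhds x)" "eventually R (nhds (y, z))"
    "\<And>x w. Q x \<Longrightarrow> R w \<Longrightarrow> P (x, w)"
    using assms unfolding nhds_prod eventually_prod_filter by blast
  obtain R1 R2 where R: "eventually R1 (nhds y)" "eventually R2 (nhds z)"
    "\<And>y z. R1 y \<Longrightarrow> R2 z \<Longrightarrow> R (y, z)"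
    using QR(2) unfolding nhds_prod eventually_prod_filter by blast
  obtain e0 where e0: "0 < e0" "\<And>\<zeta>. dist \<zeta> z < e0 \<Longrightarrow> R2 \<zeta>"
    using R(2) unfolding eventually_nhds_metric by blast
  have "\<forall>\<^sub>F v in nhds (x, y). Q (fst v) \<and> R1 (snd v)"
    unfolding nhds_prod eventually_prod_filter using QR(1) R(1) by auto
  then have "\<forall>\<^sub>F v in nhds (x, y). \<forall>\<zeta>. \<bar>\<zeta> - z\<bar> < e0 \<longrightarrow> P (fst v, snd v, \<zeta>)"
    by eventually_elim (use QR(3) R(3) e0(2) in \<open>auto simp: dist_real_def\<close>)
  with e0(1) show thesis by (rule that)
qed

lemma eventually_smooth_pos:
  fixes g :: "'a::real_normed_vector \<Rightarrow> real"
  assumes "open U" "continuous_on U g" "p \<in> U" "c < g p"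
  shows "\<forall>\<^sub>F q in nhds p. q \<in> U \<and> c < g q"
proof -
  have "\<forall>\<^sub>F q in nhds p. q \<in> U \<inter> g -` {c<..}"
    using assms by (intro eventually_nhds_in_open continuous_open_preimage) auto
  then show ?thesis by eventually_elim auto
qed

lemma eventually_fiber_pos:
  fixes g :: "real \<times> real \<times> real \<Rightarrow> real"
  assumes "open U" "continuous_on U g" "(x, y, z) \<in> U" "0 < g (x, y, z)"
  shows "\<forall>\<^sub>F v in nhds (x, y). 0 < g (fst v, snd v, z)"
proof -
  obtain e0 where "0 < e0" "\<forall>\<^sub>F v in nhds (x, y). \<forall>\<zeta>. \<bar>\<zeta> - z\<bar> < e0 \<longrightarrow> (fst v, snd v, \<zeta>) \<in> U \<and> 0 < g (fst v, snd v, \<zeta>)"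
    using eventually_nhds_fiber[OF eventually_smooth_pos[OF assms]] by blast
  from this(2) show ?thesis by eventually_elim (use \<open>0 < e0\<close> in auto)
qed

lemma ball_real: "ball (z::real) e = {z - e<..<z + e}"
  by (auto simp: dist_real_def)

lemma sec_ball_eq:
  assumes "regular_equation S U f" "0 \<le> snd v" "\<And>\<zeta>. \<bar>\<zeta> - z\<bar> < e \<Longrightarrow> (fst v, snd v, \<zeta>) \<in> U"
  shows "sec S v \<inter> ball z e = {\<zeta> \<in> {z - e<..<z + e}. f (fst v, snd v, \<zeta>) = 0}"
  using assms unfolding regular_equation_def sec_def ball_real by (auto simp: abs_less_iff)

text \<open>The equation increases along every nearby fiber, and its signs at the heights
  \<open>z - e\<close> and \<open>z + e\<close> persist over nearby base points, so it has exactly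
  one zero in between.\<close>

lemma crossing_if_transversal_pos:
  assumes reg: "regular_equation S U f" and p: "(x, y, z) \<in> U" "f (x, y, z) = 0" "0 \<le> y"
    and dz: "0 < pd (0, 0, 1) f (x, y, z)"
  shows "crossing (sec S) (x, y) z"
proof -
  have U: "open U" "smooth_on U f" using reg by (auto simp: regular_equation_def)
  note cont = smooth_on_continuous[OF smooth_on_pd[OF U(2)]]
  obtain e0 where e0: "0 < e0" and
    near: "\<forall>\<^sub>F v in nhds (x, y). \<forall>\<zeta>. \<bar>\<zeta> - z\<bar> < e0 \<longrightarrow>
      (fst v, snd v, \<zeta>) \<in> U \<and> 0 < pd (0, 0, 1) f (fst v, snd v, \<zeta>)"
    using eventually_nhds_fiber[OF eventually_smooth_pos[OF U(1) cont p(1) dz]] by blast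
  have here: "(x, y, \<zeta>) \<in> U" "0 < pd (0, 0, 1) f (x, y, \<zeta>)" if "\<bar>\<zeta> - z\<bar> < e0" for \<zeta>
    using eventually_nhds_x_imp_x[OF near] that by auto
  have "\<forall>\<^sub>F v in upper (x, y). \<exists>\<zeta>. sec S v \<inter> ball z e = {\<zeta>}" if e: "0 < e" "e < e0" for e
  proof -
    have "f (x, y, z) < f (x, y, z + e)"
      using e by (intro deriv_pos_less[of z "z + e" "\<lambda>\<zeta>. f (x, y, \<zeta>)" "\<lambda>\<zeta>. pd (0, 0, 1) f (x, y, \<zeta>)"]
          smooth_on_fiber_deriv[OF U(2)] here) auto
    then have 1: "\<forall>\<^sub>F v in nhds (x, y). 0 < f (fst v, snd v, z + e)"
      using here[of "z + e"] e p by (intro eventually_fiber_pos[OF U(1) smooth_on_continuous[OF U(2)]]) auto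
    have "f (x, y, z - e) < f (x, y, z)"
      using e by (intro deriv_pos_less[of "z - e" z "\<lambda>\<zeta>. f (x, y, \<zeta>)" "\<lambda>\<zeta>. pd (0, 0, 1) f (x, y, \<zeta>)"]
          smooth_on_fiber_deriv[OF U(2)] here) auto
    then have 2: "\<forall>\<^sub>F v in nhds (x, y). 0 < - f (fst v, snd v, z - e)"
      using here[of "z - e"] e p
      by (intro eventually_fiber_pos[OF U(1) continuous_on_minus[OF smooth_on_continuous[OF U(2)]]]) auto
    have "\<forall>\<^sub>F v in nhds (x, y). 0 \<le> snd v \<longrightarrow> (\<exists>\<zeta>. sec S v \<inter> ball z e = {\<zeta>})"
      using 1 2 near
    proof eventually_elim
      case (elim v)
      show ?case
      proof
        assume v: "0 \<le> snd v"
        have "sec S v \<inter> ball z e = {\<zeta> \<in> {z - e<..<z + e}. f (fst v, snd v, \<zeta>) = 0}"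
          using elim e v by (intro sec_ball_eq[OF reg]) auto
        moreover have "\<exists>\<zeta>. {\<zeta> \<in> {z - e<..<z + e}. f (fst v, snd v, \<zeta>) = 0} = {\<zeta>}"
          using elim e
          by (intro increasing_zero[where h' = "\<lambda>\<zeta>. pd (0, 0, 1) f (fst v, snd v, \<zeta>)"] smooth_on_fiber_deriv[OF U(2)]) auto
        ultimately show "\<exists>\<zeta>. sec S v \<inter> ball z e = {\<zeta>}" by metis
      qed
    qed
    then show ?thesis by (simp add: eventually_upper)
  qed
  then have "\<forall>\<^sub>F e in at_right 0. \<forall>\<^sub>F v in upper (x, y). \<exists>\<zeta>. sec S v \<inter> ball z e = {\<zeta>}"
    using e0 by (intro eventually_at_rightI[of 0 e0]) auto
  moreover have "z \<in> sec S (x, y)" using reg p by (auto simp: sec_def regular_equation_def)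
  ultimately show ?thesis by (simp add: crossing_def)
qed

lemma crossing_if_transversal:
  assumes reg: "regular_equation S U f" and p: "(x, y, z) \<in> U" "f (x, y, z) = 0" "0 \<le> y"
    and dz: "pd (0, 0, 1) f (x, y, z) \<noteq> 0"
  shows "crossing (sec S) (x, y) z"
proof (cases "0 < pd (0, 0, 1) f (x, y, z)")
  case False
  have "smooth_on U f" using reg by (simp add: regular_equation_def)
  from pd_uminus[OF this p(1), of "(0, 0, 1)"] False dz
  show ?thesis
    by (intro crossing_if_transversal_pos[OF regular_equation_uminus[OF reg]]) (use p in auto)
qed (rule crossing_if_transversal_pos[OF reg p])


abbreviation dz :: "(real \<times> real \<times> real \<Rightarrow> real) \<Rightarrow> real \<times> real \<times> real \<Rightarrow> real"
  where "dz f \<equiv> pd (0, 0, 1) f"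

lemma dz_dz_uminus:
  assumes "open U" "smooth_on U f" "p \<in> U"
  shows "dz (dz (\<lambda>p. - f p)) p = - dz (dz f) p"
proof -
  have "dz (dz (\<lambda>p. - f p)) p = dz (\<lambda>p. - dz f p) p"
    by (rule pd_cong_open[OF assms(1,3)]) (rule pd_uminus[OF assms(2)])
  then show ?thesis
    by (simp add: pd_uminus[OF smooth_on_pd[OF assms(2)] assms(3)])
qed

context
  fixes S U f x y z
  assumes reg: "regular_equation S U f" and p: "(x, y, z) \<in> U" "f (x, y, z) = 0" "0 \<le> y"
    and crit: "dz f (x, y, z) = 0" and convex: "0 < dz (dz f) (x, y, z)"
begin

lemma equation_smooth: "open U" "smooth_on U f"
  using reg by (auto simp: regular_equation_def)

lemma equation_continuous: "continuous_on U f" "continuous_on U (pd v f)" "continuous_on U (pd w (pd v f))"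
  by (intro smooth_on_continuous smooth_on_pd equation_smooth(2))+

lemma fiber_convex:
  assumes "\<forall>\<zeta>\<in>{a..b}. (x', y', \<zeta>) \<in> U \<and> 0 < dz (dz f) (x', y', \<zeta>)"
  shows "\<forall>\<zeta>\<in>{a..b}. ((\<lambda>\<zeta>. f (x', y', \<zeta>)) has_real_derivative dz f (x', y', \<zeta>)) (at \<zeta>)"
    "\<forall>\<zeta>\<in>{a..b}. ((\<lambda>\<zeta>. dz f (x', y', \<zeta>)) has_real_derivative dz (dz f) (x', y', \<zeta>)) (at \<zeta>)"
    "\<forall>\<zeta>\<in>{a..b}. 0 < dz (dz f) (x', y', \<zeta>)"
  using assms smooth_on_fiber_deriv[OF equation_smooth(2)] smooth_on_fiber_deriv[OF smooth_on_pd[OF equation_smooth(2)]] by blast+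

lemma fiber_pos:
  assumes "\<forall>\<zeta>. \<bar>\<zeta> - z\<bar> < e0 \<longrightarrow> (x, y, \<zeta>) \<in> U \<and> 0 < dz (dz f) (x, y, \<zeta>)" "\<bar>\<zeta> - z\<bar> < e0" "\<zeta> \<noteq> z"
  shows "0 < f (x, y, \<zeta>)"
proof -
  have "\<forall>\<xi>\<in>{min z \<zeta>..max z \<zeta>}. (x, y, \<xi>) \<in> U \<and> 0 < dz (dz f) (x, y, \<xi>)"
    using assms by auto
  from convex_tangent_less[OF fiber_convex[OF this], of z \<zeta>] show ?thesis
    using assms(3) crit p by simp
qed

lemma eventually_ends_pos:
  assumes "\<forall>\<zeta>. \<bar>\<zeta> - z\<bar> < e0 \<longrightarrow> (x, y, \<zeta>) \<in> U \<and> 0 < dz (dz f) (x, y, \<zeta>)" "0 < e" "e < e0"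
  shows "\<forall>\<^sub>F v in nhds (x, y). 0 < f (fst v, snd v, z - e) \<and> 0 < f (fst v, snd v, z + e)"
  using assms
    fiber_pos[OF assms(1), of "z - e"] fiber_pos[OF assms(1), of "z + e"]
  by (intro eventually_conj eventually_fiber_pos[OF equation_smooth(1) equation_continuous(1)]) auto

text \<open>As the derivative along the fiber vanishes, regularity provides a horizontal direction
  in which \<open>f\<close> changes. Moving the base point that way either lifts the convex graph
  off zero or pushes its bottom below zero, leaving no point or two points near \<open>z\<close>,
  whereas a crossing would leave one.\<close>

lemma not_crossing_if_fold_pos: "\<not> crossing (sec S) (x, y) z"
proof
  assume cr: "crossing (sec S) (x, y) z"
  obtain w where "pd w f (x, y, z) \<noteq> 0"
    using reg p(1) unfolding regular_equation_def by blast
  then have ne: "pd (1, 0, 0) f (x, y, z) \<noteq> 0 \<or> pd (0, 1, 0) f (x, y, z) \<noteq> 0"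
    using pd_coords[OF equation_smooth(2) p(1), of "fst w" "fst (snd w)" "snd (snd w)"] crit by auto
  \<comment> \<open>The motion must stay in the half plane, so \<open>d2\<close> is kept nonnegative
    and the sign of the derivative \<open>c\<close> has to be left open.\<close>
  obtain d1 d2 where d: "pd (d1, d2, 0) f (x, y, z) \<noteq> 0" "0 \<le> d2"
  proof (cases "pd (1, 0, 0) f (x, y, z) = 0")
    case True
    then show thesis using ne by (intro that[of 0 1]) auto
  qed (intro that[of 1 0], auto)
  define c where "c = pd (d1, d2, 0) f (x, y, z)"
  have c: "c \<noteq> 0" using d by (simp add: c_def)
  have "\<forall>\<^sub>F q in nhds (x, y, z). q \<in> U \<and> 0 < dz (dz f) q"
    by (rule eventually_smooth_pos[OF equation_smooth(1) equation_continuous(3) p(1) convex])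
  moreover have "\<forall>\<^sub>F q in nhds (x, y, z). q \<in> U \<and> 0 < c * pd (d1, d2, 0) f q"
  proof (rule eventually_smooth_pos[OF equation_smooth(1) _ p(1)])
    show "continuous_on U (\<lambda>q. c * pd (d1, d2, 0) f q)"
      by (intro continuous_intros equation_continuous)
    show "0 < c * pd (d1, d2, 0) f (x, y, z)" using c by (simp add: c_def[symmetric] power2_eq_square[symmetric])
  qed
  ultimately have "\<forall>\<^sub>F q in nhds (x, y, z). q \<in> U \<and> 0 < dz (dz f) q \<and> 0 < c * pd (d1, d2, 0) f q"
    by eventually_elim auto
  then obtain e0 where e0: "0 < e0" and near: "\<forall>\<^sub>F v in nhds (x, y). \<forall>\<zeta>. \<bar>\<zeta> - z\<bar> < e0 \<longrightarrow>
      (fst v, snd v, \<zeta>) \<in> U \<and> 0 < dz (dz f) (fst v, snd v, \<zeta>) \<and> 0 < c * pd (d1, d2, 0) f (fst v, snd v, \<zeta>)"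
    by (rule eventually_nhds_fiber)
  have here: "\<forall>\<zeta>. \<bar>\<zeta> - z\<bar> < e0 \<longrightarrow> (x, y, \<zeta>) \<in> U \<and> 0 < dz (dz f) (x, y, \<zeta>)"
    using eventually_nhds_x_imp_x[OF near] by auto
  obtain e1 where e1: "0 < e1" "\<And>e. 0 < e \<Longrightarrow> e < e1 \<Longrightarrow> \<forall>\<^sub>F v in upper (x, y). \<exists>\<zeta>. sec S v \<inter> ball z e = {\<zeta>}"
    using cr unfolding crossing_def eventually_at_right_field by auto
  define e where "e = min e0 e1 / 2"
  have e: "0 < e" "e < e0" "e < e1" using e0 e1 by (auto simp: e_def)
  have "\<forall>\<^sub>F v in nhds (x, y). 0 \<le> snd v \<longrightarrow> (\<exists>\<zeta>. sec S v \<inter> ball z e = {\<zeta>})"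
    using e1(2)[OF e(1,3)] by (simp add: eventually_upper)
  with near eventually_ends_pos[OF here e(1,2)]
  have ev: "\<forall>\<^sub>F v in nhds (x, y). (\<forall>\<zeta>. \<bar>\<zeta> - z\<bar> < e0 \<longrightarrow>
      (fst v, snd v, \<zeta>) \<in> U \<and> 0 < dz (dz f) (fst v, snd v, \<zeta>) \<and> 0 < c * pd (d1, d2, 0) f (fst v, snd v, \<zeta>)) \<and>
    0 < f (fst v, snd v, z - e) \<and> 0 < f (fst v, snd v, z + e) \<and>
    (0 \<le> snd v \<longrightarrow> (\<exists>\<zeta>. sec S v \<inter> ball z e = {\<zeta>}))"
    by eventually_elim blast
  have "((\<lambda>s. (x + s * d1, y + s * d2)) \<longlongrightarrow> (x + 0 * d1, y + 0 * d2)) (nhds 0)"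
    by (intro tendsto_intros filterlim_ident)
  then have "filterlim (\<lambda>s. (x + s * d1, y + s * d2)) (nhds (x, y)) (nhds 0)" by simp
  from filterlim_iff[THEN iffD1, OF this, rule_format, OF ev]
  obtain s0 where s0: "0 < s0" "\<And>s. \<bar>s\<bar> < s0 \<Longrightarrow> (\<forall>\<zeta>. \<bar>\<zeta> - z\<bar> < e0 \<longrightarrow>
      (x + s * d1, y + s * d2, \<zeta>) \<in> U \<and> 0 < c * pd (d1, d2, 0) f (x + s * d1, y + s * d2, \<zeta>)) \<and>
    0 < f (x + s * d1, y + s * d2, z - e) \<and> 0 < f (x + s * d1, y + s * d2, z + e) \<and>
    (0 \<le> y + s * d2 \<longrightarrow> (\<exists>\<zeta>. sec S (x + s * d1, y + s * d2) \<inter> ball z e = {\<zeta>}))"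
    unfolding eventually_nhds_metric by (auto simp: dist_real_def)
  define s where "s = s0 / 2"
  have s: "0 < s" "s < s0" using s0(1) by (auto simp: s_def)
  define v where "v = (x + s * d1, y + s * d2)"
  have v: "0 \<le> snd v" using s d(2) p(3) by (simp add: v_def)
  have vU: "(fst v, snd v, \<zeta>) \<in> U" if "\<bar>\<zeta> - z\<bar> < e" for \<zeta>
    using s0(2)[of s] s that e by (simp add: v_def)
  obtain \<zeta>0 where "sec S v \<inter> ball z e = {\<zeta>0}"
    using s0(2)[of s] s v by (auto simp: v_def)
  then have zero: "{\<zeta> \<in> {z - e<..<z + e}. f (fst v, snd v, \<zeta>) = 0} = {\<zeta>0}"
    using sec_ball_eq[OF reg v vU] by simp
  have shift: "((\<lambda>s. f (x + s * d1, y + s * d2, \<zeta>)) has_real_derivative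
      pd (d1, d2, 0) f (x + s * d1, y + s * d2, \<zeta>)) (at s)" if "\<bar>\<zeta> - z\<bar> < e0" "\<bar>s\<bar> < s0" for s \<zeta>
    using smooth_on_line_deriv[OF equation_smooth(2), of "(x, y, \<zeta>)" s "(d1, d2, 0)"] s0(2)[of s] that by simp
  show False
  proof (cases "0 < c")
    case True
    \<comment> \<open>For positive \<open>c\<close> the equation is nonnegative over the original
      base point and increases on the way, so the supposed zero over \<open>v\<close> cannot
      exist.\<close>
    have "\<zeta>0 \<in> {\<zeta> \<in> {z - e<..<z + e}. f (fst v, snd v, \<zeta>) = 0}" using zero by blast
    then have "\<bar>\<zeta>0 - z\<bar> < e" "f (fst v, snd v, \<zeta>0) = 0" by auto
    moreover have "f (x + 0 * d1, y + 0 * d2, \<zeta>0) < f (x + s * d1, y + s * d2, \<zeta>0)"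
    proof (rule deriv_pos_less[OF s(1), of "\<lambda>s. f (x + s * d1, y + s * d2, \<zeta>0)"
          "\<lambda>s. pd (d1, d2, 0) f (x + s * d1, y + s * d2, \<zeta>0)"])
      fix s' assume s': "0 \<le> s'" "s' \<le> s"
      show "((\<lambda>s. f (x + s * d1, y + s * d2, \<zeta>0)) has_real_derivative
          pd (d1, d2, 0) f (x + s' * d1, y + s' * d2, \<zeta>0)) (at s')"
        using s s' e calculation(1) by (intro shift) auto
      have "0 < c * pd (d1, d2, 0) f (x + s' * d1, y + s' * d2, \<zeta>0)"
        using s0(2)[of s'] s s' e calculation(1) by auto
      then show "0 < pd (d1, d2, 0) f (x + s' * d1, y + s' * d2, \<zeta>0)"
        using True by (simp add: zero_less_mult_iff)
    qed
    moreover have "0 \<le> f (x, y, \<zeta>0)"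
      using fiber_pos[OF here, of \<zeta>0] calculation(1) e p by (cases "\<zeta>0 = z") auto
    ultimately show False by (simp add: v_def)
  next
    case False
    then have "c < 0" using c by simp
    \<comment> \<open>For negative \<open>c\<close> the value at height \<open>z\<close> drops below
      zero while both ends stay positive, which gives two zeros.\<close>
    have "- f (x + 0 * d1, y + 0 * d2, z) < - f (x + s * d1, y + s * d2, z)"
    proof (rule deriv_pos_less[OF s(1), of "\<lambda>s. - f (x + s * d1, y + s * d2, z)"
          "\<lambda>s. - pd (d1, d2, 0) f (x + s * d1, y + s * d2, z)"])
      fix s' assume s': "0 \<le> s'" "s' \<le> s"
      show "((\<lambda>s. - f (x + s * d1, y + s * d2, z)) has_real_derivative
          - pd (d1, d2, 0) f (x + s' * d1, y + s' * d2, z)) (at s')"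
        using s s' e0 by (intro DERIV_minus shift) auto
      have "0 < c * pd (d1, d2, 0) f (x + s' * d1, y + s' * d2, z)"
        using s0(2)[of s'] s s' e0 by auto
      then show "0 < - pd (d1, d2, 0) f (x + s' * d1, y + s' * d2, z)"
        using \<open>c < 0\<close> by (simp add: zero_less_mult_iff)
    qed
    then have neg: "f (fst v, snd v, z) < 0" using p by (simp add: v_def)
    have ends: "0 < f (fst v, snd v, z - e)" "0 < f (fst v, snd v, z + e)"
      using s0(2)[of s] s by (auto simp: v_def)
    have "isCont (\<lambda>\<zeta>. f (fst v, snd v, \<zeta>)) \<zeta>" if "\<bar>\<zeta> - z\<bar> \<le> e" for \<zeta>
    proof -
      have "(fst v, snd v, \<zeta>) \<in> U" using s0(2)[of s] s that e by (simp add: v_def)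
      from DERIV_isCont[OF smooth_on_fiber_deriv[OF equation_smooth(2) this]] show ?thesis .
    qed
    then have isCont: "z - e \<le> \<zeta> \<and> \<zeta> \<le> z \<Longrightarrow> isCont (\<lambda>\<zeta>. f (fst v, snd v, \<zeta>)) \<zeta>"
      "z \<le> \<zeta> \<and> \<zeta> \<le> z + e \<Longrightarrow> isCont (\<lambda>\<zeta>. f (fst v, snd v, \<zeta>)) \<zeta>" for \<zeta>
      by auto
    obtain \<zeta>1 where z1: "z - e \<le> \<zeta>1" "\<zeta>1 \<le> z" "f (fst v, snd v, \<zeta>1) = 0"
      using IVT2[of "\<lambda>\<zeta>. f (fst v, snd v, \<zeta>)" z 0 "z - e"] ends neg e isCont by force
    obtain \<zeta>2 where z2: "z \<le> \<zeta>2" "\<zeta>2 \<le> z + e" "f (fst v, snd v, \<zeta>2) = 0"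
      using IVT[of "\<lambda>\<zeta>. f (fst v, snd v, \<zeta>)" z 0 "z + e"] ends neg e isCont by force
    have "\<zeta>1 \<noteq> z" "\<zeta>1 \<noteq> z - e" "\<zeta>2 \<noteq> z" "\<zeta>2 \<noteq> z + e" using z1 z2 neg ends by auto
    then have "\<zeta>1 \<in> {\<zeta> \<in> {z - e<..<z + e}. f (fst v, snd v, \<zeta>) = 0}"
      "\<zeta>2 \<in> {\<zeta> \<in> {z - e<..<z + e}. f (fst v, snd v, \<zeta>) = 0}" using z1 z2 e by auto
    then have "\<zeta>1 = \<zeta>0" "\<zeta>2 = \<zeta>0" unfolding zero by auto
    then show False using z1 z2 \<open>\<zeta>1 \<noteq> z\<close> by simp
  qed
qed

end

text \<open>Along nearby fibers the equation stays convex and positive at both ends, so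
  \<open>convex_zeros\<close> applies. Whether the derivative vanishes at a zero tells folds from
  crossings, and this matches the three cases with those of \<open>fold_chart\<close>.\<close>

lemma fold_chart_if_fold_pos:
  assumes reg: "regular_equation S U f" and p: "(x, y, z) \<in> U" "f (x, y, z) = 0" "0 \<le> y"
    and crit: "dz f (x, y, z) = 0" and convex: "0 < dz (dz f) (x, y, z)"
  shows "\<forall>\<^sub>F e in at_right 0. \<forall>\<^sub>F v in upper (x, y). fold_chart (sec S) z e v"
proof -
  have sm: "open U" "smooth_on U f"
    using reg by (auto simp: regular_equation_def)
  obtain e0 where e0: "0 < e0" and near: "\<forall>\<^sub>F v in nhds (x, y). \<forall>\<zeta>. \<bar>\<zeta> - z\<bar> < e0 \<longrightarrow>
      (fst v, snd v, \<zeta>) \<in> U \<and> 0 < dz (dz f) (fst v, snd v, \<zeta>)"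
    using eventually_nhds_fiber[OF eventually_smooth_pos[OF sm(1) smooth_on_continuous[OF smooth_on_pd[OF smooth_on_pd[OF sm(2)]]] p(1) convex]]
    by blast
  have here: "\<forall>\<zeta>. \<bar>\<zeta> - z\<bar> < e0 \<longrightarrow> (x, y, \<zeta>) \<in> U \<and> 0 < dz (dz f) (x, y, \<zeta>)"
    using eventually_nhds_x_imp_x[OF near] by auto
  have "\<forall>\<^sub>F v in upper (x, y). fold_chart (sec S) z e v" if e: "0 < e" "e < e0" for e
  proof -
    have "\<forall>\<^sub>F v in nhds (x, y). 0 \<le> snd v \<longrightarrow> fold_chart (sec S) z e v"
      using near eventually_ends_pos[OF reg p crit convex here e]
    proof eventually_elim
      case (elim v)
      show ?case
      proof
        assume v: "0 \<le> snd v"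
        have vU: "\<forall>\<zeta>\<in>{z - e..z + e}. (fst v, snd v, \<zeta>) \<in> U \<and> 0 < dz (dz f) (fst v, snd v, \<zeta>)"
          using elim(1) e by (simp add: abs_less_iff)
        have eq: "sec S v \<inter> ball z e = {\<zeta> \<in> {z - e<..<z + e}. f (fst v, snd v, \<zeta>) = 0}"
          using vU by (intro sec_ball_eq[OF reg v]) (auto simp: abs_less_iff)
        have tr: "crossing (sec S) v \<zeta>" if "\<zeta> \<in> {z - e<..<z + e}" "f (fst v, snd v, \<zeta>) = 0" "dz f (fst v, snd v, \<zeta>) \<noteq> 0" for \<zeta>
          using crossing_if_transversal[OF reg, of "fst v" "snd v" \<zeta>] that v vU by auto
        have fo: "\<not> crossing (sec S) v \<zeta>" if "\<zeta> \<in> {z - e<..<z + e}" "f (fst v, snd v, \<zeta>) = 0" "dz f (fst v, snd v, \<zeta>) = 0" for \<zeta>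
          using not_crossing_if_fold_pos[OF reg, of "fst v" "snd v" \<zeta>] that v vU by auto
        have "{\<zeta> \<in> {z - e<..<z + e}. f (fst v, snd v, \<zeta>) = 0} = {} \<or>
            (\<exists>\<zeta>. {\<zeta> \<in> {z - e<..<z + e}. f (fst v, snd v, \<zeta>) = 0} = {\<zeta>} \<and> dz f (fst v, snd v, \<zeta>) = 0) \<or>
            (\<exists>\<zeta>\<^sub>1 \<zeta>\<^sub>2. \<zeta>\<^sub>1 \<noteq> \<zeta>\<^sub>2 \<and> {\<zeta> \<in> {z - e<..<z + e}. f (fst v, snd v, \<zeta>) = 0} = {\<zeta>\<^sub>1, \<zeta>\<^sub>2} \<and>
              dz f (fst v, snd v, \<zeta>\<^sub>1) \<noteq> 0 \<and> dz f (fst v, snd v, \<zeta>\<^sub>2) \<noteq> 0)"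
          using elim(2) e by (intro convex_zeros[OF fiber_convex[OF reg p crit convex vU]]) auto
        then show "fold_chart (sec S) z e v"
        proof (elim disjE exE conjE)
          fix \<zeta> assume a: "{\<zeta> \<in> {z - e<..<z + e}. f (fst v, snd v, \<zeta>) = 0} = {\<zeta>}" "dz f (fst v, snd v, \<zeta>) = 0"
          then have "\<zeta> \<in> {\<zeta> \<in> {z - e<..<z + e}. f (fst v, snd v, \<zeta>) = 0}" by blast
          with fo[of \<zeta>] a show ?thesis unfolding fold_chart_def eq by blast
        next
          fix \<zeta>\<^sub>1 \<zeta>\<^sub>2 assume a: "\<zeta>\<^sub>1 \<noteq> \<zeta>\<^sub>2" "{\<zeta> \<in> {z - e<..<z + e}. f (fst v, snd v, \<zeta>) = 0} = {\<zeta>\<^sub>1, \<zeta>\<^sub>2}"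
            "dz f (fst v, snd v, \<zeta>\<^sub>1) \<noteq> 0" "dz f (fst v, snd v, \<zeta>\<^sub>2) \<noteq> 0"
          then have "\<zeta>\<^sub>1 \<in> {\<zeta> \<in> {z - e<..<z + e}. f (fst v, snd v, \<zeta>) = 0}" "\<zeta>\<^sub>2 \<in> {\<zeta> \<in> {z - e<..<z + e}. f (fst v, snd v, \<zeta>) = 0}" by blast+
          with tr[of \<zeta>\<^sub>1] tr[of \<zeta>\<^sub>2] a show ?thesis unfolding fold_chart_def eq by blast
        next
          assume "{\<zeta> \<in> {z - e<..<z + e}. f (fst v, snd v, \<zeta>) = 0} = {}"
          then show ?thesis unfolding fold_chart_def eq by blast
        qed
      qed
    qed
    then show ?thesis by (simp add: eventually_upper)
  qed
  then show ?thesis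
    using e0 by (intro eventually_at_rightI[of 0 e0]) auto
qed

lemma fold_if_tangent:
  assumes reg: "regular_equation S U f" and p: "(x, y, z) \<in> U" "f (x, y, z) = 0" "0 \<le> y"
    and "dz f (x, y, z) = 0" "dz (dz f) (x, y, z) \<noteq> 0"
  shows "\<not> crossing (sec S) (x, y) z"
    and "\<forall>\<^sub>F e in at_right 0. \<forall>\<^sub>F v in upper (x, y). fold_chart (sec S) z e v"
proof -
  have "\<exists>f. regular_equation S U f \<and> f (x, y, z) = 0 \<and> dz f (x, y, z) = 0 \<and> 0 < dz (dz f) (x, y, z)"
  proof (cases "0 < dz (dz f) (x, y, z)")
    case False
    have "open U" "smooth_on U f" using reg by (auto simp: regular_equation_def)
    then show ?thesis
      using assms False
      by (intro exI[of _ "\<lambda>p. - f p"]) (auto simp: regular_equation_uminus pd_uminus dz_dz_uminus)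
  qed (use assms in auto)
  then show "\<not> crossing (sec S) (x, y) z"
    and "\<forall>\<^sub>F e in at_right 0. \<forall>\<^sub>F v in upper (x, y). fold_chart (sec S) z e v"
    using not_crossing_if_fold_pos fold_chart_if_fold_pos p(1,3) by blast+
qed

section \<open>Boundary points\<close>

lemma eventually_nhds_below:
  assumes "eventually P (nhds v)"
  shows "\<exists>t>0. P (fst v :: real, snd v - t :: real)"
proof -
  have "((\<lambda>t. (fst v, snd v - t)) \<longlongrightarrow> (fst v, snd v - 0)) (at_right 0)"
    by (intro tendsto_intros)
  then have "filterlim (\<lambda>t. (fst v, snd v - t)) (nhds v) (at_right 0)" by simp
  from filterlim_iff[THEN iffD1, OF this, rule_format, OF assms]
  have "\<forall>\<^sub>F t in at_right 0. P (fst v, snd v - t)" .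
  then have "\<forall>\<^sub>F t in at_right 0. 0 < t \<and> P (fst v, snd v - t)"
    using eventually_at_right_less[of 0] by eventually_elim auto
  then show ?thesis
    using eventually_happens trivial_limit_at_right_real by blast
qed

text \<open>The model of a boundary point at which \<open>S\<close> is tangent to the plane \<open>y = 0\<close>: \<open>S\<close> is the part
  \<open>0 \<le> G\<close> of the zero set of \<open>F\<close>, and \<open>F\<close> is strictly convex and \<open>G\<close> strictly increasing along
  the fibers. The sign \<open>\<sigma> = 1\<close> is impossible, since then \<open>S\<close> would have points with \<open>y < 0\<close>.\<close>

definition degenerate_model ::
    "real \<Rightarrow> (real \<times> real \<Rightarrow> real \<Rightarrow> real) \<Rightarrow> (real \<times> real \<Rightarrow> real \<Rightarrow> real) \<Rightarrow> (real \<times> real \<Rightarrow> real \<Rightarrow> real) \<Rightarrow>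
     (real \<times> real \<Rightarrow> real \<Rightarrow> real) \<Rightarrow> (real \<times> real \<Rightarrow> real \<Rightarrow> real) \<Rightarrow> real \<times> real \<Rightarrow> real \<Rightarrow> bool"
  where "degenerate_model \<sigma> F F' F'' G G' v \<zeta> \<longleftrightarrow>
      (F v has_real_derivative F' v \<zeta>) (at \<zeta>) \<and> (F' v has_real_derivative F'' v \<zeta>) (at \<zeta>) \<and> 0 < F'' v \<zeta> \<and>
      (G v has_real_derivative G' v \<zeta>) (at \<zeta>) \<and> 0 < G' v \<zeta> \<and>
      isCont (\<lambda>v. F v \<zeta>) v \<and> isCont (\<lambda>v. G v \<zeta>) v \<and>
      (G v \<zeta> = 0 \<longrightarrow> sgn (F v \<zeta>) = \<sigma> * sgn (snd v)) \<and>
      (F v \<zeta> = 0 \<and> 0 \<le> G v \<zeta> \<longrightarrow> 0 \<le> snd v)"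

text \<open>Let \<kappa> be the height at which \<open>G v\<close> vanishes; the zeros of
  \<open>F v\<close> that count are those at or above \<kappa>. For \<sigma> = -1 and
  \<open>0 < snd v\<close>, \<open>F v\<close> is negative at \<kappa> and positive at the upper
  end, and convexity allows only one zero. For \<open>snd v = 0\<close>, \<kappa> itself is a zero,
  and a second one is excluded because a small move below the line would yield a zero where none is
  allowed.\<close>

lemma degenerate_unique:
  fixes F F' F'' G G' :: "real \<times> real \<Rightarrow> real \<Rightarrow> real"
  assumes e: "0 < e" and \<sigma>: "\<sigma> = 1 \<or> \<sigma> = (-1::real)" and q: "snd q = 0"
    and near: "\<forall>\<^sub>F v in nhds q. \<forall>\<zeta>\<in>{z - e..z + e}.
      degenerate_model \<sigma> F F' F'' G G' v \<zeta>"
    and base: "F q z = 0" "F' q z = 0" "G q z = 0"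
  shows "\<forall>\<^sub>F v in upper q. \<exists>\<zeta>. {\<zeta> \<in> {z - e<..<z + e}. F v \<zeta> = 0 \<and> 0 \<le> G v \<zeta>} = {\<zeta>} \<and> (snd v = 0 \<longrightarrow> G v \<zeta> = 0)"
proof -
  define I where "I = {z - e..z + e}"
  define ok where "ok = (\<lambda>v. (\<forall>\<zeta>\<in>I.
      degenerate_model \<sigma> F F' F'' G G' v \<zeta>))"
  have Gmono: "G v a < G v b" if "ok v" "a \<in> I" "b \<in> I" "a < b" for v a b
    using that by (intro deriv_pos_less[of a b "G v" "G' v"]) (auto simp: ok_def degenerate_model_def I_def)
  have between: "F v b < 0" if "ok v" "a \<in> I" "c \<in> I" "a < b" "b < c" "F v a \<le> 0" "F v c \<le> 0" for v a b c
    using that by (intro convex_between_less[of "z - e" "z + e" "F v" "F' v" "F'' v" a b c 0]) (auto simp: ok_def degenerate_model_def I_def)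
  have root: "\<exists>\<xi>. a < \<xi> \<and> \<xi> < b \<and> F v \<xi> = 0" if "ok v" "a \<in> I" "b \<in> I" "a < b"
    "F v a < 0 \<and> 0 < F v b \<or> F v b < 0 \<and> 0 < F v a" for v a b
  proof -
    have cont: "\<forall>x. a \<le> x \<and> x \<le> b \<longrightarrow> isCont (F v) x"
    proof (intro allI impI)
      fix x assume "a \<le> x \<and> x \<le> b"
      then have "(F v has_real_derivative F' v x) (at x)"
        using that(1-3) unfolding ok_def degenerate_model_def I_def by auto
      then show "isCont (F v) x" by (rule DERIV_isCont)
    qed
    have "\<exists>\<xi>\<ge>a. \<xi> \<le> b \<and> F v \<xi> = 0"
      using that(4,5) IVT[of "F v" a 0 b] IVT2[of "F v" b 0 a] cont by auto
    then show ?thesis using that(5) by (metis less_irrefl order.not_eq_order_implies_strict)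
  qed
  have ok: "\<forall>\<^sub>F v in nhds q. ok v" using near by (simp add: ok_def I_def)
  have okq: "ok q" by (rule eventually_nhds_x_imp_x[OF ok])
  have zI: "z \<in> I" "z - e \<in> I" "z + e \<in> I" using e by (auto simp: I_def)
  have F_end: "0 < F q (z + e)"
    using convex_tangent_less[of "z - e" "z + e" "F q" "F' q" "F'' q" z "z + e"] okq e base
    by (auto simp: ok_def degenerate_model_def I_def)
  have G_end: "G q (z - e) < 0" "0 < G q (z + e)"
    using Gmono[OF okq, of "z - e" z] Gmono[OF okq, of z "z + e"] e base zI by auto
  have tends: "((\<lambda>v. F v \<zeta>) \<longlongrightarrow> F v0 \<zeta>) (nhds v0)" "((\<lambda>v. G v \<zeta>) \<longlongrightarrow> G v0 \<zeta>) (nhds v0)"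
    if "ok v0" "\<zeta> \<in> I" for v0 \<zeta>
  proof -
    have "isCont (\<lambda>v. F v \<zeta>) v0" "isCont (\<lambda>v. G v \<zeta>) v0"
      using that by (auto simp: ok_def degenerate_model_def)
    then show "((\<lambda>v. F v \<zeta>) \<longlongrightarrow> F v0 \<zeta>) (nhds v0)" "((\<lambda>v. G v \<zeta>) \<longlongrightarrow> G v0 \<zeta>) (nhds v0)"
      using tendsto_at_iff_tendsto_nhds[of "\<lambda>v. F v \<zeta>" v0] tendsto_at_iff_tendsto_nhds[of "\<lambda>v. G v \<zeta>" v0]
      by (simp_all add: isCont_def)
  qed
  define good where "good = (\<lambda>v. ok v \<and> 0 < F v (z + e) \<and> G v (z - e) < 0 \<and> 0 < G v (z + e))"
  have good: "\<forall>\<^sub>F v in nhds q. good v"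
    using ok order_tendstoD(1)[OF tends(1)[OF okq zI(3)] F_end]
      order_tendstoD(2)[OF tends(2)[OF okq zI(2)] G_end(1)] order_tendstoD(1)[OF tends(2)[OF okq zI(3)] G_end(2)]
    by eventually_elim (simp add: good_def)
  have kappa: "\<exists>\<kappa>. \<kappa> \<in> I \<and> z - e < \<kappa> \<and> \<kappa> < z + e \<and> G v \<kappa> = 0" if gv: "good v" for v
  proof -
    have "\<forall>x. z - e \<le> x \<and> x \<le> z + e \<longrightarrow> isCont (G v) x"
    proof (intro allI impI)
      fix x assume "z - e \<le> x \<and> x \<le> z + e"
      then have "(G v has_real_derivative G' v x) (at x)"
        using that unfolding good_def ok_def degenerate_model_def I_def by auto
      then show "isCont (G v) x" by (rule DERIV_isCont)
    qed
    then obtain \<kappa> where "z - e \<le> \<kappa>" "\<kappa> \<le> z + e" "G v \<kappa> = 0"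
      using IVT[of "G v" "z - e" 0 "z + e"] gv e by (auto simp: good_def)
    moreover have "\<kappa> \<noteq> z - e" "\<kappa> \<noteq> z + e" using calculation gv by (auto simp: good_def)
    ultimately show ?thesis by (intro exI[of _ \<kappa>]) (auto simp: I_def)
  qed
  have sgnF: "sgn (F v \<kappa>) = \<sigma> * sgn (snd v)" if "good v" "\<kappa> \<in> I" "G v \<kappa> = 0" for v \<kappa>
    using that by (auto simp: good_def ok_def degenerate_model_def)
  have inS: "0 \<le> snd v" if "good v" "\<xi> \<in> I" "F v \<xi> = 0" "0 \<le> G v \<xi>" for v \<xi>
    using that by (auto simp: good_def ok_def degenerate_model_def)
  \<comment> \<open>With the other sign, a base point below the line would have \<open>F\<close>
    negative at \<kappa> and positive at the upper end, hence a zero that \<open>inS\<close>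
    forbids.\<close>
  have \<sigma>: "\<sigma> = -1"
  proof (rule ccontr)
    assume "\<sigma> \<noteq> -1"
    then have "\<sigma> = 1" using \<sigma> by simp
    obtain t where t: "0 < t" "good (fst q, snd q - t)"
      using eventually_nhds_below[OF good] by blast
    define v where "v = (fst q, snd q - t)"
    have v: "good v" "snd v < 0" using t q by (auto simp: v_def)
    obtain \<kappa> where \<kappa>: "\<kappa> \<in> I" "\<kappa> < z + e" "G v \<kappa> = 0" using kappa[OF v(1)] by blast
    have "sgn (F v \<kappa>) = -1" using sgnF[OF v(1) \<kappa>(1,3)] v(2) \<open>\<sigma> = 1\<close> by simp
    then have "F v \<kappa> < 0" by (simp add: sgn_real_def split: if_splits)
    then obtain \<xi> where \<xi>: "\<kappa> < \<xi>" "\<xi> < z + e" "F v \<xi> = 0"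
      using root[of v \<kappa> "z + e"] v \<kappa> zI by (auto simp: good_def)
    then have "\<xi> \<in> I" using \<kappa> by (auto simp: I_def)
    moreover have "0 \<le> G v \<xi>" using Gmono[of v \<kappa> \<xi>] v \<kappa> \<xi> calculation by (auto simp: good_def)
    ultimately show False using inS[OF v(1)] \<xi> v(2) by fastforce
  qed
  have "\<forall>\<^sub>F v in nhds q. \<forall>\<^sub>F w in nhds v. good w"
    using good by (simp add: eventually_eventually)
  with good have "\<forall>\<^sub>F v in nhds q. 0 \<le> snd v \<longrightarrow> (\<exists>\<zeta>. {\<zeta> \<in> {z - e<..<z + e}. F v \<zeta> = 0 \<and> 0 \<le> G v \<zeta>} = {\<zeta>} \<and> (snd v = 0 \<longrightarrow> G v \<zeta> = 0))"
  proof eventually_elim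
    case (elim v)
    then have okv: "ok v" by (simp add: good_def)
    obtain \<kappa> where \<kappa>: "\<kappa> \<in> I" "z - e < \<kappa>" "\<kappa> < z + e" "G v \<kappa> = 0" using kappa[OF elim(1)] by blast
    have side: "0 \<le> G v \<zeta> \<longleftrightarrow> \<kappa> \<le> \<zeta>" if "\<zeta> \<in> {z - e<..<z + e}" for \<zeta>
      using Gmono[OF okv, of \<kappa> \<zeta>] Gmono[OF okv, of \<zeta> \<kappa>] \<kappa> that
      by (cases \<kappa> \<zeta> rule: linorder_cases) (auto simp: I_def)
    show ?case
    proof
      assume "0 \<le> snd v"
      then consider "0 < snd v" | "snd v = 0" by linarith
      then show "\<exists>\<zeta>. {\<zeta> \<in> {z - e<..<z + e}. F v \<zeta> = 0 \<and> 0 \<le> G v \<zeta>} = {\<zeta>} \<and> (snd v = 0 \<longrightarrow> G v \<zeta> = 0)"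
      proof cases
        case 1
        have "sgn (F v \<kappa>) = -1" using sgnF[OF elim(1) \<kappa>(1,4)] 1 \<sigma> by simp
        then have neg: "F v \<kappa> < 0" by (simp add: sgn_real_def split: if_splits)
        then obtain \<xi> where \<xi>: "\<kappa> < \<xi>" "\<xi> < z + e" "F v \<xi> = 0"
          using root[of v \<kappa> "z + e"] elim(1) \<kappa> zI by (auto simp: good_def)
        have "\<zeta> = \<xi>" if "\<kappa> \<le> \<zeta>" "\<zeta> < z + e" "F v \<zeta> = 0" for \<zeta>
        proof -
          have "\<kappa> < \<zeta>" using that neg by (cases "\<kappa> = \<zeta>") auto
          moreover have "\<zeta> \<in> I" "\<xi> \<in> I" using that \<xi> \<kappa> by (auto simp: I_def)
          ultimately show ?thesis
            using between[OF okv \<kappa>(1), of \<zeta> \<xi>] between[OF okv \<kappa>(1), of \<xi> \<zeta>] neg \<xi> that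
            by (cases \<xi> \<zeta> rule: linorder_cases) auto
        qed
        then have "{\<zeta> \<in> {z - e<..<z + e}. F v \<zeta> = 0 \<and> 0 \<le> G v \<zeta>} = {\<xi>}"
          using \<xi> \<kappa> side by (auto simp del: greaterThanLessThan_iff) (auto simp: I_def)
        with 1 show ?thesis by auto
      next
        case 2
        have "sgn (F v \<kappa>) = 0" using sgnF[OF elim(1) \<kappa>(1,4)] 2 by simp
        then have zero: "F v \<kappa> = 0" by (simp add: sgn_zero_iff)
        have "\<zeta> = \<kappa>" if \<zeta>: "\<kappa> \<le> \<zeta>" "\<zeta> < z + e" "F v \<zeta> = 0" for \<zeta>
        proof (rule ccontr)
          assume "\<zeta> \<noteq> \<kappa>"
          then have less: "\<kappa> < \<zeta>" using \<zeta> by simp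
          \<comment> \<open>Between two zeros \<open>F\<close> is negative. At \<open>m\<close> this
            survives for a base point \<open>w\<close> slightly below the line, where
            \<open>F\<close> is positive at the zero of \<open>G\<close>; in between there would be
            a zero over a point outside the half plane.\<close>
          define m where "m = (\<kappa> + \<zeta>) / 2"
          have m: "\<kappa> < m" "m < \<zeta>" "m \<in> I" "\<zeta> \<in> I" using less \<zeta> \<kappa> by (auto simp: m_def I_def)
          have "F v m < 0" using between[OF okv \<kappa>(1), of \<zeta> m] m \<zeta> zero by auto
          moreover have "0 < G v m" using Gmono[OF okv \<kappa>(1), of m] m \<kappa> by auto
          ultimately have "\<forall>\<^sub>F w in nhds v. F w m < 0" "\<forall>\<^sub>F w in nhds v. 0 < G w m"
            using order_tendstoD(2)[OF tends(1)[OF okv m(3)]] order_tendstoD(1)[OF tends(2)[OF okv m(3)]] by auto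
          with elim(2) have "\<forall>\<^sub>F w in nhds v. good w \<and> F w m < 0 \<and> 0 < G w m"
            by eventually_elim auto
          from eventually_nhds_below[OF this] obtain t where
            t: "0 < t" "good (fst v, snd v - t) \<and> F (fst v, snd v - t) m < 0 \<and> 0 < G (fst v, snd v - t) m" by blast
          define w where "w = (fst v, snd v - t)"
          have w: "good w" "F w m < 0" "0 < G w m" "snd w < 0" using t 2 by (auto simp: w_def)
          obtain \<kappa>' where k: "\<kappa>' \<in> I" "\<kappa>' < z + e" "G w \<kappa>' = 0" using kappa[OF w(1)] by blast
          have okw: "ok w" using w by (simp add: good_def)
          have "\<kappa>' < m" using Gmono[OF okw m(3) k(1)] k w by (cases \<kappa>' m rule: linorder_cases) auto
          have "sgn (F w \<kappa>') = 1" using sgnF[OF w(1) k(1,3)] w(4) \<sigma> by simp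
          then have "0 < F w \<kappa>'" by (simp add: sgn_real_def split: if_splits)
          then obtain \<xi> where \<xi>: "\<kappa>' < \<xi>" "\<xi> < m" "F w \<xi> = 0"
            using root[OF okw k(1) m(3) \<open>\<kappa>' < m\<close>] w by auto
          then have "\<xi> \<in> I" using k m by (auto simp: I_def)
          moreover have "0 \<le> G w \<xi>" using Gmono[OF okw k(1), of \<xi>] k \<xi> calculation by auto
          ultimately show False using inS[OF w(1)] \<xi> w(4) by fastforce
        qed
        then have "{\<zeta> \<in> {z - e<..<z + e}. F v \<zeta> = 0 \<and> 0 \<le> G v \<zeta>} = {\<kappa>}"
          using \<kappa> side zero by (auto simp del: greaterThanLessThan_iff) (auto simp: I_def)
        with \<kappa> show ?thesis by auto
      qed
    qed
  qed
  then show ?thesis by (simp add: eventually_upper)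
qed

section \<open>The multiplicity bound and straightening charts\<close>

text \<open>Otherwise \<open>f\<close> would vanish to order at least three along the fiber,
  possibly to infinite order, and as a local equation it would itself witness that multiplicity. A
  local equation has to vanish on \<open>S\<close> but may vanish beyond it, so boundary points are
  covered.\<close>

lemma dz_neq_0_if_no_cusp:
  assumes nocusp: "\<And>m. fiber_multiplicity S (x, y, z) m \<Longrightarrow> m < 3"
    and U: "open U" "smooth_on U f" and p: "(x, y, z) \<in> U" "f (x, y, z) = 0"
    and zero: "\<And>r. r \<in> S \<Longrightarrow> r \<in> U \<Longrightarrow> f r = 0" and ne: "pd v f (x, y, z) \<noteq> 0"
  shows "dz f (x, y, z) \<noteq> 0 \<or> dz (dz f) (x, y, z) \<noteq> 0"
proof (rule ccontr)
  assume "\<not> ?thesis"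
  then have z0: "dz f (x, y, z) = 0" "dz (dz f) (x, y, z) = 0" by auto
  have eq: "local_equation S (x, y, z) U f"
    using assms unfolding local_equation_def pd_def by blast
  define g where "g = f \<circ> fiber (x, y, z)"
  have g: "g = (\<lambda>t. f (x, y, t))" by (simp add: g_def fiber_def Pz_def fun_eq_iff)
  have d: "deriv g t = dz f (x, y, t)" if "(x, y, t) \<in> U" for t
    unfolding g by (rule DERIV_imp_deriv[OF smooth_on_fiber_deriv[OF U(2) that]])
  have "filterlim (\<lambda>t. (x, y, t)) (nhds (x, y, z)) (nhds z)"
    by (intro tendsto_intros filterlim_ident)
  then have "\<forall>\<^sub>F t in nhds z. (x, y, t) \<in> U"
    using filterlim_iff[THEN iffD1, rule_format, of _ _ _ "\<lambda>r. r \<in> U"] eventually_nhds_in_open[OF U(1) p(1)] by blast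
  then have "\<forall>\<^sub>F t in nhds z. deriv g t = dz f (x, y, t)" by eventually_elim (rule d)
  then have "deriv (deriv g) z = deriv (\<lambda>t. dz f (x, y, t)) z" by (rule deriv_cong_ev) simp
  also have "\<dots> = dz (dz f) (x, y, z)"
    by (rule DERIV_imp_deriv[OF smooth_on_fiber_deriv[OF smooth_on_pd[OF U(2)] p(1)]])
  finally have "deriv (deriv g) z = 0" using z0 by simp
  moreover have "deriv g z = 0" "g z = 0" using d[OF p(1)] z0 p by (auto simp: g)
  ultimately have "3 \<le> k" if "(deriv ^^ k) g z \<noteq> 0" for k
  proof -
    have "k \<noteq> 0" using that \<open>g z = 0\<close> by (cases k) auto
    moreover have "k \<noteq> 1" "k \<noteq> 2"
      using that \<open>deriv (deriv g) z = 0\<close> \<open>deriv g z = 0\<close> by (auto simp: numeral_2_eq_2)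
    ultimately show ?thesis by simp
  qed
  then have "3 \<le> vanishing_order g z"
    unfolding vanishing_order_def by (auto intro!: Inf_greatest simp: numeral_eq_enat)
  moreover have "fiber_multiplicity S (x, y, z) (vanishing_order g z)"
    using eq unfolding fiber_multiplicity_def g_def by auto
  ultimately show False using nocusp by (metis not_less)
qed


locale straightening_chart =
  fixes S U V :: "(real \<times> real \<times> real) set" and \<phi> \<psi> :: "real \<times> real \<times> real \<Rightarrow> real \<times> real \<times> real"
  assumes diffeo: "smooth_diffeo U V \<phi> \<psi>"
    and image: "\<phi> ` (S \<inter> U) = V \<inter> {(u, v, w). 0 \<le> u \<and> w = 0}"
    and upper_half: "S \<subseteq> {(x, y, z). 0 \<le> y}"
begin

text \<open>\<open>S\<close> is given by \<open>eqn = 0\<close> and \<open>0 \<le> edge\<close>,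
  with its boundary at \<open>edge = 0\<close>. These are functions on \<open>U\<close>, whereas
  \<open>height\<close> lives on \<open>V\<close>: it is y expressed in the coordinates of the
  chart.\<close>

definition eqn :: "real \<times> real \<times> real \<Rightarrow> real" where "eqn q = snd (snd (\<phi> q))"
definition edge :: "real \<times> real \<times> real \<Rightarrow> real" where "edge q = fst (\<phi> q)"
definition height :: "real \<times> real \<times> real \<Rightarrow> real" where "height v = fst (snd (\<psi> v))"

lemma chart:
  "open U" "open V" "smooth_on U \<phi>" "smooth_on V \<psi>"
  "q \<in> U \<Longrightarrow> \<phi> q \<in> V" "q \<in> U \<Longrightarrow> \<psi> (\<phi> q) = q" "v \<in> V \<Longrightarrow> \<psi> v \<in> U" "v \<in> V \<Longrightarrow> \<phi> (\<psi> v) = v"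
  using diffeo unfolding smooth_diffeo_def homeomorphism_def by auto

lemma linear_coords:
  "bounded_linear (\<lambda>q::real \<times> real \<times> real. fst q)"
  "bounded_linear (\<lambda>q::real \<times> real \<times> real. fst (snd q))"
  "bounded_linear (\<lambda>q::real \<times> real \<times> real. snd (snd q))"
  by (intro bounded_linear_fst bounded_linear_fst_comp bounded_linear_snd_comp bounded_linear_snd)+

lemma smooth_coords: "smooth_on U eqn" "smooth_on U edge" "smooth_on V height"
  unfolding eqn_def edge_def height_def
  using smooth_on_linear[OF linear_coords(3) chart(1,3)] smooth_on_linear[OF linear_coords(1) chart(1,3)]
    smooth_on_linear[OF linear_coords(2) chart(2,4)] by simp_all

lemma pd_coords_eq:
  "q \<in> U \<Longrightarrow> pd v eqn q = snd (snd (pd v \<phi> q))"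
  "q \<in> U \<Longrightarrow> pd v edge q = fst (pd v \<phi> q)"
  "r \<in> V \<Longrightarrow> pd v height r = fst (snd (pd v \<psi> r))"
  unfolding eqn_def edge_def height_def
  using pd_linear[OF linear_coords(3) chart(3)] pd_linear[OF linear_coords(1) chart(3)]
    pd_linear[OF linear_coords(2) chart(4)] by auto

lemma pd_inverse:
  assumes q: "q \<in> U"
  shows "pd (pd w \<phi> q) \<psi> (\<phi> q) = w" "pd (pd w \<psi> (\<phi> q)) \<phi> q = w"
proof -
  have \<phi>: "(\<phi> has_derivative (\<lambda>v. pd v \<phi> q)) (at q)"
    by (rule smooth_on_has_derivative[OF chart(3) q])
  have \<psi>: "(\<psi> has_derivative (\<lambda>v. pd v \<psi> (\<phi> q))) (at (\<phi> q))"
    by (rule smooth_on_has_derivative[OF chart(4) chart(5)[OF q]])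
  from has_derivative_compose[OF \<phi> \<psi>]
  have "((\<lambda>q. \<psi> (\<phi> q)) has_derivative (\<lambda>w. pd (pd w \<phi> q) \<psi> (\<phi> q))) (at q)" .
  then have "((\<lambda>q. q) has_derivative (\<lambda>w. pd (pd w \<phi> q) \<psi> (\<phi> q))) (at q)"
    using chart(6) by (rule has_derivative_transform_within_open[OF _ chart(1) q])
  then have "(\<lambda>w. pd (pd w \<phi> q) \<psi> (\<phi> q)) = (\<lambda>w. w)"
    using has_derivative_ident by (rule has_derivative_unique)
  then show "pd (pd w \<phi> q) \<psi> (\<phi> q) = w" by metis
  have "(\<phi> has_derivative (\<lambda>v. pd v \<phi> q)) (at (\<psi> (\<phi> q)))"
    using \<phi> q by (simp add: chart)
  from has_derivative_compose[OF \<psi> this]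
  have "((\<lambda>v. \<phi> (\<psi> v)) has_derivative (\<lambda>w. pd (pd w \<psi> (\<phi> q)) \<phi> q)) (at (\<phi> q))" .
  then have "((\<lambda>v. v) has_derivative (\<lambda>w. pd (pd w \<psi> (\<phi> q)) \<phi> q)) (at (\<phi> q))"
    using chart(8) by (rule has_derivative_transform_within_open[OF _ chart(2) chart(5)[OF q]])
  then have "(\<lambda>w. pd (pd w \<psi> (\<phi> q)) \<phi> q) = (\<lambda>w. w)"
    using has_derivative_ident by (rule has_derivative_unique)
  then show "pd (pd w \<psi> (\<phi> q)) \<phi> q = w" by metis
qed

lemma mem_surface_iff:
  assumes "q \<in> U"
  shows "q \<in> S \<longleftrightarrow> eqn q = 0 \<and> 0 \<le> edge q"
proof -
  have "q \<in> S \<longleftrightarrow> \<phi> q \<in> \<phi> ` (S \<inter> U)"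
  proof
    assume "\<phi> q \<in> \<phi> ` (S \<inter> U)"
    then obtain r where r: "r \<in> S" "r \<in> U" "\<phi> q = \<phi> r" by blast
    have "q = \<psi> (\<phi> r)" unfolding r(3)[symmetric] by (rule chart(6)[OF assms, symmetric])
    then show "q \<in> S" using chart(6)[OF r(2)] r(1) by (simp only:)
  qed (use assms in blast)
  also have "\<dots> \<longleftrightarrow> eqn q = 0 \<and> 0 \<le> edge q"
    unfolding image using chart(5)[OF assms] by (cases "\<phi> q") (auto simp: eqn_def edge_def)
  finally show ?thesis .
qed

text \<open>The witness is the vector that the derivative of the chart maps to the third coordinate
  direction.\<close>

lemma pd_eqn_neq_0: "q \<in> U \<Longrightarrow> \<exists>v. pd v eqn q \<noteq> 0"
  by (rule exI[of _ "pd (0, 0, 1) \<psi> (\<phi> q)"]) (simp add: pd_coords_eq pd_inverse)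

lemma height_nonneg: "v \<in> V \<Longrightarrow> 0 \<le> fst v \<Longrightarrow> snd (snd v) = 0 \<Longrightarrow> 0 \<le> height v"
  using mem_surface_iff[of "\<psi> v"] upper_half
  by (auto simp: height_def eqn_def edge_def chart split: prod.splits)

text \<open>Away from the edge \<open>S\<close> is the full zero set of \<open>eqn\<close>, and y is
  nonnegative on it because all of \<open>S\<close> lies in the half space.\<close>

lemma regular_equation_interior:
  "regular_equation S {q \<in> U. 0 < edge q} eqn"
proof -
  have "open {q \<in> U. 0 < edge q}"
    using continuous_open_preimage[OF smooth_on_continuous[OF smooth_coords(2)] chart(1) open_greaterThan[of 0]]
    by (simp add: Int_def vimage_def)
  moreover have "smooth_on {q \<in> U. 0 < edge q} eqn"
    by (rule smooth_on_subset[OF smooth_coords(1)]) auto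
  moreover have "q \<in> S \<longleftrightarrow> eqn q = 0 \<and> 0 \<le> fst (snd q)" if "q \<in> U" "0 < edge q" for q
    using mem_surface_iff[OF that(1)] that(2) upper_half by (cases q) auto
  ultimately show ?thesis
    using pd_eqn_neq_0 unfolding regular_equation_def by blast
qed

end

section \<open>Calculus in a chart at a boundary point\<close>

locale boundary_chart = straightening_chart +
  fixes p :: "real \<times> real \<times> real"
  assumes p: "p \<in> U" "eqn p = 0" "edge p = 0"
    and edge_height: "\<And>q. q \<in> U \<Longrightarrow> eqn q = 0 \<Longrightarrow> edge q = 0 \<Longrightarrow> fst (snd q) = 0"
begin

definition b :: real where "b = fst (snd (\<phi> p))"

lemma \<phi>_p: "\<phi> p = (0, b, 0)"
  using p by (simp add: eqn_def edge_def b_def prod_eq_iff)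

lemma b_V: "(0, b, 0) \<in> V"
  using chart(5)[OF p(1)] by (simp add: \<phi>_p)

lemma height_edge: "(0, s, 0) \<in> V \<Longrightarrow> height (0, s, 0) = 0"
  using edge_height[of "\<psi> (0, s, 0)"] by (simp add: height_def eqn_def edge_def chart)

lemma eventually_edge_V: "\<forall>\<^sub>F s in nhds b. (0, s, 0) \<in> V"
proof -
  have "filterlim (\<lambda>s. (0::real, s, 0::real)) (nhds (0, b, 0)) (nhds b)"
    by (intro tendsto_intros filterlim_ident)
  from filterlim_iff[THEN iffD1, rule_format, OF this eventually_nhds_in_open[OF chart(2) b_V]]
  show ?thesis .
qed

lemma pd_height_edge: "pd (0, 1, 0) height (0, b, 0) = 0"
proof -
  have "((\<lambda>s. height (0, s, 0)) has_real_derivative pd (0, 1, 0) height (0, b, 0)) (at b)"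
    using smooth_on_line_deriv[OF smooth_coords(3), of "(0, 0, 0)" b "(0, 1, 0)"] b_V by simp
  moreover have "\<forall>\<^sub>F s in nhds b. height (0, s, 0) = 0"
    using eventually_edge_V by eventually_elim (rule height_edge)
  then have "((\<lambda>s. height (0, s, 0)) has_real_derivative 0) (at b)"
    by (subst DERIV_cong_ev[OF refl _ refl]) auto
  ultimately show ?thesis by (rule DERIV_unique)
qed

text \<open>Chain rule for y = \<open>height\<close> composed with \<open>\<phi>\<close>; the
  derivative along the edge drops out since y vanishes there. The tangent plane of \<open>S\<close>
  is the kernel of the derivative of \<open>eqn\<close>, so
  \<open>pd (1, 0, 0) height (0, b, 0)\<close> vanishes exactly when \<open>S\<close> is tangent to
  the plane y = 0 at \<open>p\<close>. All case distinctions at boundary points are made on this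
  number.\<close>

lemma pd_height_\<phi>: "fst (snd w) = fst (pd w \<phi> p) * pd (1, 0, 0) height (0, b, 0) + pd w eqn p * pd (0, 0, 1) height (0, b, 0)"
proof -
  have "fst (snd w) = fst (snd (pd (pd w \<phi> p) \<psi> (\<phi> p)))"
    by (simp add: pd_inverse p)
  also have "\<dots> = pd (pd w \<phi> p) height (0, b, 0)"
    using b_V by (simp add: pd_coords_eq \<phi>_p)
  also have "\<dots> = fst (pd w \<phi> p) * pd (1, 0, 0) height (0, b, 0) + pd w eqn p * pd (0, 0, 1) height (0, b, 0)"
    using pd_coords[OF smooth_coords(3) b_V, of "fst (pd w \<phi> p)" "fst (snd (pd w \<phi> p))" "snd (snd (pd w \<phi> p))"]
    by (simp add: pd_height_edge pd_coords_eq p)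
  finally show ?thesis .
qed

end

lemma eventually_nhds_triple_box:
  fixes x y z :: real
  assumes "eventually P (nhds (x, y, z))"
  obtains d where "0 < d" "\<And>r s t. \<bar>r - x\<bar> < d \<Longrightarrow> \<bar>s - y\<bar> < d \<Longrightarrow> \<bar>t - z\<bar> < d \<Longrightarrow> P (r, s, t)"
proof -
  obtain e where e: "0 < e" "\<forall>\<^sub>F v in nhds (x, y). \<forall>\<zeta>. \<bar>\<zeta> - z\<bar> < e \<longrightarrow> P (fst v, snd v, \<zeta>)"
    using assms by (rule eventually_nhds_fiber)
  obtain d where "0 < d" "\<And>r s. \<bar>r - x\<bar> < d \<Longrightarrow> \<bar>s - y\<bar> < d \<Longrightarrow> \<forall>\<zeta>. \<bar>\<zeta> - z\<bar> < e \<longrightarrow> P (r, s, \<zeta>)"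
    using e(2) by (elim eventually_nhds_Pair_box) auto
  with e(1) show thesis by (intro that[of "min d e"]) auto
qed

text \<open>The part of a ball below the plane y = 0 is convex, and \<open>f\<close> has no zero on
  it, so \<open>f\<close> has one sign there; the plane inherits the weak inequality in the
  limit.\<close>

lemma touching_sign:
  fixes f :: "real \<times> real \<times> real \<Rightarrow> real"
  assumes "open U" "continuous_on U f" "p \<in> U"
    and ne: "\<And>q. q \<in> U \<Longrightarrow> fst (snd q) < 0 \<Longrightarrow> f q \<noteq> 0"
  shows "\<exists>\<tau>. (\<tau> = 1 \<or> \<tau> = -1) \<and> (\<forall>\<^sub>F q in nhds p. fst (snd q) = 0 \<longrightarrow> 0 \<le> \<tau> * f q)"
proof -
  obtain d where d: "0 < d" "ball p d \<subseteq> U" using assms(1,3) open_contains_ball by blast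
  define L where "L = ball p d \<inter> {q. fst (snd q) < 0}"
  have "convex {q :: real \<times> real \<times> real. fst (snd q) < 0}"
  proof -
    have "{q :: real \<times> real \<times> real. fst (snd q) < 0} = UNIV \<times> {..<0} \<times> UNIV" by auto
    then show ?thesis by (auto intro!: convex_Times)
  qed
  then have "connected L" unfolding L_def by (intro convex_connected convex_Int convex_ball)
  moreover have contL: "continuous_on L f"
    by (rule continuous_on_subset[OF assms(2)]) (use d in \<open>auto simp: L_def\<close>)
  ultimately have conn: "connected (f ` L)" by (intro connected_continuous_image)
  have "0 \<notin> f ` L" using ne d by (auto simp: L_def)
  then have sign: "(\<forall>q\<in>L. 0 < f q) \<or> (\<forall>q\<in>L. 0 < - f q)"
    using connectedD_interval[OF conn, of _ _ 0] by (metis image_eqI linorder_neqE_linordered_idom neg_0_less_iff_less less_imp_le)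
  then obtain \<tau> :: real where \<tau>: "\<tau> = 1 \<or> \<tau> = -1" "\<And>q. q \<in> L \<Longrightarrow> 0 < \<tau> * f q"
    by (metis mult_1 mult_minus1)
  have "0 \<le> \<tau> * f q" if q: "q \<in> ball p d" "fst (snd q) = 0" for q
  proof (rule tendsto_lowerbound)
    define q' where "q' = (\<lambda>t. (fst q, fst (snd q) - t, snd (snd q)))"
    have "(q' \<longlongrightarrow> (fst q, fst (snd q) - 0, snd (snd q))) (at_right 0)"
      unfolding q'_def by (intro tendsto_intros)
    then have lim: "(q' \<longlongrightarrow> q) (at_right 0)" by simp
    have "\<forall>\<^sub>F t in at_right 0. q' t \<in> ball p d"
      using filterlim_iff[THEN iffD1, rule_format, OF lim eventually_nhds_in_open[OF open_ball q(1)]] .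
    with eventually_at_right_less[of 0] show "\<forall>\<^sub>F t in at_right 0. 0 \<le> \<tau> * f (q' t)"
      by eventually_elim (use q(2) in \<open>intro less_imp_le \<tau>(2), simp add: L_def q'_def\<close>)
    have "isCont f q"
      using continuous_on_interior[OF assms(2)] assms(1) d q interior_open by blast
    from isCont_tendsto_compose[OF this lim]
    show "((\<lambda>t. \<tau> * f (q' t)) \<longlongrightarrow> \<tau> * f q) (at_right 0)" by (intro tendsto_intros)
  qed simp
  moreover have "\<forall>\<^sub>F q in nhds p. q \<in> ball p d"
    using d by (intro eventually_nhds_in_open) auto
  ultimately have "\<forall>\<^sub>F q in nhds p. fst (snd q) = 0 \<longrightarrow> 0 \<le> \<tau> * f q"
    by (auto elim: eventually_mono)
  with \<tau>(1) show ?thesis by blast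
qed

context boundary_chart
begin

text \<open>Otherwise the derivative of \<open>eqn\<close> would be a multiple of that of y, and
  \<open>S\<close> would be tangent to the plane y = 0. But \<open>w\<close>, which is tangent to
  \<open>S\<close> and transversal to the edge, has a nonzero y-component by
  \<open>u\<close>.\<close>

lemma pd_x_neq_0:
  assumes u: "pd (1, 0, 0) height (0, b, 0) \<noteq> 0" and dz: "dz eqn p = 0"
  shows "pd (1, 0, 0) eqn p \<noteq> 0"
proof
  assume dx: "pd (1, 0, 0) eqn p = 0"
  define w where "w = pd (1, 0, 0) \<psi> (0, b, 0)"
  have w: "pd w \<phi> p = (1, 0, 0)" using pd_inverse(2)[OF p(1)] by (simp add: w_def \<phi>_p)
  have "fst (snd w) \<noteq> 0" using pd_height_\<phi>[of w] u p(1) by (simp add: w pd_coords_eq)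
  moreover have "pd w eqn p = 0" using p(1) by (simp add: w pd_coords_eq)
  then have "fst (snd w) * pd (0, 1, 0) eqn p = 0"
    using pd_coords[OF smooth_coords(1) p(1), of "fst w" "fst (snd w)" "snd (snd w)"] dx dz by simp
  ultimately have dy: "pd (0, 1, 0) eqn p = 0" by simp
  obtain v where "pd v eqn p \<noteq> 0" using pd_eqn_neq_0[OF p(1)] by blast
  then show False
    using pd_coords[OF smooth_coords(1) p(1), of "fst v" "fst (snd v)" "snd (snd v)"] dx dy dz by simp
qed

text \<open>Since \<open>S\<close> stays in the half space, y cannot decrease from its value 0 on
  the edge towards the inside.\<close>

lemma pd_height_pos:
  assumes u: "pd (1, 0, 0) height (0, b, 0) \<noteq> 0"
  shows "0 < pd (1, 0, 0) height (0, b, 0)"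
proof (rule ccontr)
  assume "\<not> 0 < pd (1, 0, 0) height (0, b, 0)"
  then have neg: "pd (1, 0, 0) height (0, b, 0) < 0" using u by simp
  have "((\<lambda>t. height (t, b, 0)) has_real_derivative pd (1, 0, 0) height (0, b, 0)) (at 0)"
    using smooth_on_line_deriv[OF smooth_coords(3), of "(0, b, 0)" 0 "(1, 0, 0)"] b_V by simp
  from DERIV_neg_dec_right[OF this neg] obtain d where
    d: "0 < d" "\<And>h. 0 < h \<Longrightarrow> h < d \<Longrightarrow> height (0 + h, b, 0) < height (0, b, 0)" by auto
  have "\<forall>\<^sub>F v in nhds (0, b, 0). v \<in> V" by (rule eventually_nhds_in_open[OF chart(2) b_V])
  then obtain d' where d': "0 < d'"
    "\<And>r s t. \<bar>r - 0\<bar> < d' \<Longrightarrow> \<bar>s - b\<bar> < d' \<Longrightarrow> \<bar>t - 0\<bar> < d' \<Longrightarrow> (r, s, t) \<in> V"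
    by (rule eventually_nhds_triple_box) blast
  define h where "h = min d d' / 2"
  have h: "0 < h" "h < d" "h < d'" using d d' by (auto simp: h_def)
  have "0 \<le> height (h, b, 0)" by (rule height_nonneg) (use d'(2) d' h in auto)
  then show False using d(2)[OF h(1,2)] height_edge[OF b_V] by simp
qed

text \<open>On the sheet \<open>eqn = 0\<close> near \<open>p\<close>, y increases with
  \<open>edge\<close> and both vanish on the boundary curve. So they have the same sign, and
  \<open>0 \<le> edge\<close> may be replaced by the condition that y is nonnegative.\<close>

lemma regular_equation_boundary:
  assumes u: "pd (1, 0, 0) height (0, b, 0) \<noteq> 0"
  shows "\<exists>W. regular_equation S W eqn \<and> p \<in> W \<and> W \<subseteq> U \<and> (\<forall>r\<in>W. r \<in> S \<and> fst (snd r) = 0 \<longrightarrow> edge r = 0)"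
proof -
  have "\<forall>\<^sub>F v in nhds (0, b, 0). v \<in> V \<and> 0 < pd (1, 0, 0) height v"
    by (rule eventually_smooth_pos[OF chart(2) smooth_on_continuous[OF smooth_on_pd[OF smooth_coords(3)]] b_V pd_height_pos[OF u]])
  then obtain d where d: "0 < d"
    "\<And>r s t. \<bar>r - 0\<bar> < d \<Longrightarrow> \<bar>s - b\<bar> < d \<Longrightarrow> \<bar>t - 0\<bar> < d \<Longrightarrow> (r, s, t) \<in> V \<and> 0 < pd (1, 0, 0) height (r, s, t)"
    by (rule eventually_nhds_triple_box) blast
  \<comment> \<open>A box in the coordinates of the chart, so that the segment from a point of the
    sheet to the edge stays where y is monotone.\<close>
  define B where "B = {-d<..<d} \<times> {b - d<..<b + d} \<times> {-d<..<d}"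
  define W where "W = U \<inter> \<phi> -` B"
  have "open W" unfolding W_def B_def
    by (intro continuous_open_preimage smooth_on_continuous chart open_Times) auto
  have pW: "p \<in> W" using p d by (simp add: W_def B_def \<phi>_p)
  have mono: "height (r, s, 0) < height (r', s, 0)" if "\<bar>s - b\<bar> < d" "-d < r" "r < r'" "r' < d" for r r' s
  proof (rule deriv_pos_less[OF that(3), of "\<lambda>r. height (r, s, 0)" "\<lambda>r. pd (1, 0, 0) height (r, s, 0)"])
    fix t assume t: "r \<le> t" "t \<le> r'"
    then have *: "(t, s, 0) \<in> V \<and> 0 < pd (1, 0, 0) height (t, s, 0)" using that d by (intro d(2)) auto
    then show "0 < pd (1, 0, 0) height (t, s, 0)" by simp
    show "((\<lambda>r. height (r, s, 0)) has_real_derivative pd (1, 0, 0) height (t, s, 0)) (at t)"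
      using smooth_on_line_deriv[OF smooth_coords(3), of "(0, s, 0)" t "(1, 0, 0)"] * by simp
  qed
  have key: "sgn (fst (snd r)) = sgn (edge r)" if r: "r \<in> W" "eqn r = 0" for r
  proof -
    obtain s where s: "\<phi> r = (edge r, s, 0)" "\<bar>s - b\<bar> < d" "\<bar>edge r\<bar> < d"
      using r by (cases "\<phi> r") (auto simp: W_def B_def edge_def eqn_def)
    have "(0, s, 0) \<in> V" using d(2)[of 0 s 0] s d by simp
    then have h0: "height (0, s, 0) = 0" by (rule height_edge)
    have "\<psi> (\<phi> r) = r" using r by (intro chart) (simp add: W_def)
    then have "fst (snd r) = height (edge r, s, 0)" by (simp add: height_def s(1))
    with mono[OF s(2), of 0 "edge r"] mono[OF s(2), of "edge r" 0] s(3) h0 d(1) show ?thesis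
      by (cases "edge r" "0::real" rule: linorder_cases) (auto simp: sgn_real_def)
  qed
  have "r \<in> S \<longleftrightarrow> eqn r = 0 \<and> 0 \<le> fst (snd r)" if r: "r \<in> W" for r
    using mem_surface_iff[of r] key[OF r] r by (auto simp: W_def sgn_real_def split: if_splits)
  moreover have "edge r = 0" if "r \<in> W" "r \<in> S" "fst (snd r) = 0" for r
    using mem_surface_iff[of r] key[of r] that by (auto simp: W_def sgn_zero_iff)
  moreover have "smooth_on W eqn" by (rule smooth_on_subset[OF smooth_coords(1)]) (simp add: W_def)
  moreover have "\<exists>v. pd v eqn r \<noteq> 0" if "r \<in> W" for r
    using pd_eqn_neq_0 that by (simp add: W_def)
  ultimately show ?thesis
    using pW \<open>open W\<close> by (intro exI[of _ W]) (auto simp: regular_equation_def W_def)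
qed

text \<open>If the boundary curve \<open>a(s)\<close> had a vertical tangent at \<open>p\<close>, differentiating the relation
  \<open>(\<partial>\<^sub>x f)(a) a\<^sub>x' + (\<partial>\<^sub>z f)(a) a\<^sub>z' = 0\<close> at \<open>p\<close>, where \<open>\<partial>\<^sub>x f = \<partial>\<^sub>z f = 0\<close> and \<open>a\<^sub>x' = 0\<close>,
  would give \<open>\<partial>\<^sub>z\<^sup>2 f = 0\<close>, a cusp.\<close>

lemma degenerate_pd_edge:
  assumes u: "pd (1, 0, 0) height (0, b, 0) = 0" and zz: "dz (dz eqn) p \<noteq> 0"
  shows "dz eqn p = 0" "pd (0, 0, 1) height (0, b, 0) \<noteq> 0" "dz edge p \<noteq> 0"
proof -
  have h: "fst (snd w) = pd w eqn p * pd (0, 0, 1) height (0, b, 0)" for w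
    using pd_height_\<phi>[of w] u by simp
  show w: "pd (0, 0, 1) height (0, b, 0) \<noteq> 0" using h[of "(0, 1, 0)"] by auto
  show z0: "dz eqn p = 0" using h[of "(0, 0, 1)"] w by simp
  have x0: "pd (1, 0, 0) eqn p = 0" using h[of "(1, 0, 0)"] w by simp
  show "dz edge p \<noteq> 0"
  proof
    assume "dz edge p = 0"
    \<comment> \<open>With the vertical derivatives of \<open>edge\<close> and \<open>eqn\<close>
      both zero, the chart maps the vertical direction to \<open>m\<close> times the direction of
      the edge.\<close>
    define m where "m = fst (snd (pd (0, 0, 1) \<phi> p))"
    have "pd (0, 0, 1) \<phi> p = m *\<^sub>R (0, 1, 0)"
      using \<open>dz edge p = 0\<close> z0 p(1) by (simp add: m_def pd_coords_eq prod_eq_iff)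
    then have "pd (m *\<^sub>R (0, 1, 0)) \<psi> (0, b, 0) = (0, 0, 1)"
      using pd_inverse(1)[OF p(1), of "(0, 0, 1)"] by (simp add: \<phi>_p)
    then have "m *\<^sub>R pd (0, 1, 0) \<psi> (0, b, 0) = (0, 0, 1)"
      by (simp only: pd_scaleR[OF chart(4) b_V])
    then have m0: "m \<noteq> 0" by (auto simp: prod_eq_iff)
    have "pd (0, 1, 0) \<psi> (0, b, 0) = (1 / m) *\<^sub>R (m *\<^sub>R pd (0, 1, 0) \<psi> (0, b, 0))"
      using m0 by simp
    also have "\<dots> = (0, 0, 1 / m)" unfolding \<open>m *\<^sub>R _ = _\<close> by simp
    finally have m: "m \<noteq> 0" "pd (0, 1, 0) \<psi> (0, b, 0) = (0, 0, 1 / m)"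
      using m0 by auto
    define a where "a = (\<lambda>s. \<psi> (0, s, 0))"
    define a' where "a' = (\<lambda>s. pd (0, 1, 0) \<psi> (0, s, 0))"
    have path: "((\<lambda>s. (0, s, 0)) has_derivative (\<lambda>t. t *\<^sub>R (0::real, 1, 0::real))) (at s)" for s :: real
      by (auto intro!: derivative_eq_intros)
    have a: "(a has_derivative (\<lambda>t. t *\<^sub>R a' s)) (at s)" if "(0, s, 0) \<in> V" for s
      using has_derivative_compose[OF path smooth_on_has_derivative[OF chart(4) that]]
      unfolding a_def a'_def by (simp only: pd_scaleR[OF chart(4) that])
    have comp: "((\<lambda>s. h (a s)) has_real_derivative pd (a' s) h (a s)) (at s)"
      if V: "(0, s, 0) \<in> V" and h: "smooth_on U h" for h :: "real \<times> real \<times> real \<Rightarrow> real" and s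
    proof -
      have aU: "a s \<in> U" using V by (simp add: a_def chart)
      from has_derivative_compose[OF a[OF V] smooth_on_has_derivative[OF h aU]]
      show ?thesis
        by (simp add: has_field_derivative_def pd_scaleR[OF h aU] mult_commute_abs)
    qed
    have der: "((\<lambda>s. L (a' s)) has_real_derivative L (pd (0, 1, 0) (pd (0, 1, 0) \<psi>) (0, b, 0))) (at b)"
      if L: "bounded_linear L" for L :: "real \<times> real \<times> real \<Rightarrow> real"
    proof -
      have "((\<lambda>s. a' s) has_derivative (\<lambda>t. t *\<^sub>R pd (0, 1, 0) (pd (0, 1, 0) \<psi>) (0, b, 0))) (at b)"
        using has_derivative_compose[OF path smooth_on_has_derivative[OF smooth_on_pd[OF chart(4)] b_V]]
        unfolding a'_def by (simp only: pd_scaleR[OF smooth_on_pd[OF chart(4)] b_V])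
      from bounded_linear.has_derivative[OF L this] show ?thesis
        by (simp add: has_field_derivative_def linear_scale[OF bounded_linear.linear[OF L]] mult_commute_abs)
    qed
    \<comment> \<open>The derivative of \<open>eqn\<close> along the boundary curve; its y-term is
      omitted because the curve stays in the plane y = 0.\<close>
    define k where "k = (\<lambda>s. fst (a' s) * pd (1, 0, 0) eqn (a s) + snd (snd (a' s)) * dz eqn (a s))"
    have k0: "k s = 0" if V: "\<forall>\<^sub>F s in nhds s. (0, s, 0) \<in> V" for s
    proof -
      have V': "(0, s, 0) \<in> V" using eventually_nhds_x_imp_x[OF V] .
      then have aU: "a s \<in> U" by (simp add: a_def chart)
      have "\<forall>\<^sub>F s in nhds s. eqn (a s) = 0"
        using V by eventually_elim (simp add: eqn_def a_def chart)
      then have "((\<lambda>s. eqn (a s)) has_real_derivative 0) (at s)"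
        by (subst DERIV_cong_ev[OF refl _ refl]) auto
      then have 1: "pd (a' s) eqn (a s) = 0"
        using comp[OF V' smooth_coords(1)] DERIV_unique by blast
      have "\<forall>\<^sub>F s in nhds s. fst (snd (a s)) = 0"
        using V by eventually_elim (simp add: a_def height_edge[unfolded height_def])
      then have "((\<lambda>s. fst (snd (a s))) has_real_derivative 0) (at s)"
        by (subst DERIV_cong_ev[OF refl _ refl]) auto
      moreover have "((\<lambda>s. fst (snd (a s))) has_real_derivative fst (snd (a' s))) (at s)"
        using bounded_linear.has_derivative[OF linear_coords(2) a[OF V']]
        by (simp add: has_field_derivative_def mult_commute_abs)
      ultimately have "fst (snd (a' s)) = 0" using DERIV_unique by blast
      moreover have "pd (fst (a' s), fst (snd (a' s)), snd (snd (a' s))) eqn (a s) = 0"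
        using 1 by (simp only: prod.collapse)
      ultimately show ?thesis
        using pd_coords[OF smooth_coords(1) aU, of "fst (a' s)" "fst (snd (a' s))" "snd (snd (a' s))"]
        by (simp add: k_def)
    qed
    have "\<forall>\<^sub>F s in nhds b. \<forall>\<^sub>F s in nhds s. (0, s, 0) \<in> V"
      using eventually_edge_V by (simp add: eventually_eventually)
    then have "\<forall>\<^sub>F s in nhds b. k s = 0" by eventually_elim (rule k0)
    then have "(k has_real_derivative 0) (at b)"
      by (subst DERIV_cong_ev[OF refl _ refl]) auto
    moreover have ab: "a b = p" using chart(6)[OF p(1)] by (simp add: a_def \<phi>_p)
    have a'b: "a' b = (0, 0, 1 / m)" by (simp add: a'_def m)
    \<comment> \<open>In the product rule the second derivatives of the curve meet the x- and
      z-derivatives of \<open>eqn\<close>, which vanish at \<open>p\<close>. As the velocity at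
      \<open>b\<close> is \<open>(0, 0, 1 / m)\<close>, only the term with
      \<open>dz (dz eqn)\<close> is left.\<close>
    have "(k has_real_derivative (1 / m) * (1 / m) * dz (dz eqn) p) (at b)"
    proof -
      have "pd (0, 0, 1 / m) (dz eqn) p = (1 / m) * dz (dz eqn) p"
        using pd_scaleR[OF smooth_on_pd[OF smooth_coords(1)] p(1), of "1 / m" "(0, 0, 1)"] by simp
      then show ?thesis
        unfolding k_def
        using DERIV_add[OF DERIV_mult[OF der[OF linear_coords(1)] comp[OF b_V smooth_on_pd[OF smooth_coords(1)], of "(1, 0, 0)"]]
            DERIV_mult[OF der[OF linear_coords(3)] comp[OF b_V smooth_on_pd[OF smooth_coords(1)], of "(0, 0, 1)"]]]
        by (simp add: ab a'b x0 z0 mult.commute mult.left_commute)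
    qed
    ultimately have "(1 / m) * (1 / m) * dz (dz eqn) p = 0" using DERIV_unique by blast
    with m zz show False by simp
  qed
qed

text \<open>On the wall \<open>edge = 0\<close>, y is a strictly monotone function of
  \<open>eqn\<close> for a fixed second coordinate, and both vanish on the boundary curve.\<close>

lemma eventually_sgn_height:
  assumes w: "pd (0, 0, 1) height (0, b, 0) \<noteq> 0"
  shows "\<forall>\<^sub>F r in nhds p. r \<in> U \<and> (edge r = 0 \<longrightarrow> sgn (fst (snd r)) = sgn (pd (0, 0, 1) height (0, b, 0)) * sgn (eqn r))"
proof -
  define \<kappa> where "\<kappa> = sgn (pd (0, 0, 1) height (0, b, 0))"
  have \<kappa>: "\<kappa> = 1 \<or> \<kappa> = -1" using w by (auto simp: \<kappa>_def sgn_real_def)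
  have "\<forall>\<^sub>F v in nhds (0, b, 0). v \<in> V \<and> 0 < \<kappa> * pd (0, 0, 1) height v"
  proof (rule eventually_smooth_pos[OF chart(2) _ b_V])
    show "continuous_on V (\<lambda>v. \<kappa> * pd (0, 0, 1) height v)"
      by (intro continuous_on_mult continuous_on_const smooth_on_continuous smooth_on_pd smooth_coords)
    show "0 < \<kappa> * pd (0, 0, 1) height (0, b, 0)"
      using w by (auto simp: \<kappa>_def sgn_real_def)
  qed
  then obtain d where d: "0 < d"
    "\<And>r s t. \<bar>r - 0\<bar> < d \<Longrightarrow> \<bar>s - b\<bar> < d \<Longrightarrow> \<bar>t - 0\<bar> < d \<Longrightarrow> (r, s, t) \<in> V \<and> 0 < \<kappa> * pd (0, 0, 1) height (r, s, t)"
    by (rule eventually_nhds_triple_box) blast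
  define B where "B = {-d<..<d} \<times> {b - d<..<b + d} \<times> {-d<..<d}"
  have "open (U \<inter> \<phi> -` B)" unfolding B_def
    by (intro continuous_open_preimage smooth_on_continuous chart open_Times) auto
  then have "\<forall>\<^sub>F r in nhds p. r \<in> U \<inter> \<phi> -` B"
    by (rule eventually_nhds_in_open) (use p d in \<open>simp add: B_def \<phi>_p\<close>)
  then show ?thesis
  proof eventually_elim
    case (elim r)
    have "sgn (fst (snd r)) = \<kappa> * sgn (eqn r)" if e0: "edge r = 0"
    proof -
      obtain s where s: "\<phi> r = (0, s, eqn r)" "\<bar>s - b\<bar> < d" "\<bar>eqn r\<bar> < d"
        using elim e0 by (cases "\<phi> r") (auto simp: B_def edge_def eqn_def)
      have mono: "\<kappa> * height (0, s, t) < \<kappa> * height (0, s, t')" if "-d < t" "t < t'" "t' < d" for t t'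
      proof (rule deriv_pos_less[OF that(2), of "\<lambda>t. \<kappa> * height (0, s, t)" "\<lambda>t. \<kappa> * pd (0, 0, 1) height (0, s, t)"])
        fix x assume "t \<le> x" "x \<le> t'"
        then have *: "(0, s, x) \<in> V \<and> 0 < \<kappa> * pd (0, 0, 1) height (0, s, x)" using that s d by (intro d(2)) auto
        then show "0 < \<kappa> * pd (0, 0, 1) height (0, s, x)" by simp
        have "((\<lambda>t. height (0, s, t)) has_real_derivative pd (0, 0, 1) height (0, s, x)) (at x)"
          using smooth_on_line_deriv[OF smooth_coords(3), of "(0, s, 0)" x "(0, 0, 1)"] * by simp
        then show "((\<lambda>t. \<kappa> * height (0, s, t)) has_real_derivative \<kappa> * pd (0, 0, 1) height (0, s, x)) (at x)"
          by (rule DERIV_cmult)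
      qed
      have "(0, s, 0) \<in> V" using d(2)[of 0 s 0] s d by simp
      then have h0: "height (0, s, 0) = 0" by (rule height_edge)
      have "\<psi> (\<phi> r) = r" using elim by (intro chart) simp
      then have "fst (snd r) = height (0, s, eqn r)" by (simp add: height_def s(1))
      with mono[of 0 "eqn r"] mono[of "eqn r" 0] s(3) h0 d(1) \<kappa> show ?thesis
        by (cases "eqn r" "0::real" rule: linorder_cases) (auto simp: sgn_real_def)
    qed
    with elim show ?case by (simp add: \<kappa>_def)
  qed
qed

text \<open>The fiber satisfies the degenerate model, so it is met once. The model also places the
  single point over the line y = 0 on the edge; hence near \<open>p\<close> the surface meets the
  plane y = 0 only in its boundary.\<close>

lemma degenerate_crossing:
  assumes u: "pd (1, 0, 0) height (0, b, 0) = 0" and zz: "dz (dz eqn) p \<noteq> 0"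
  shows "crossing (sec S) (fst p, fst (snd p)) (snd (snd p))"
    and "\<forall>\<^sub>F r in nhds p. r \<in> S \<and> fst (snd r) = 0 \<longrightarrow> edge r = 0"
proof -
  note deg = degenerate_pd_edge[OF u zz]
  obtain x z where pxz: "p = (x, 0, z)"
    using edge_height[OF p] by (cases p) auto
  define \<rho> \<tau> \<kappa> where "\<rho> = sgn (dz edge p)" and "\<tau> = sgn (dz (dz eqn) p)" and "\<kappa> = sgn (pd (0, 0, 1) height (0, b, 0))"
  have \<rho>: "\<rho> = 1 \<or> \<rho> = -1" and \<tau>: "\<tau> = 1 \<or> \<tau> = -1" and \<kappa>: "\<kappa> = 1 \<or> \<kappa> = -1"
    using deg zz by (auto simp: \<rho>_def \<tau>_def \<kappa>_def sgn_real_def)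
  have \<rho>2: "\<rho> * (\<rho> * t) = t" for t using \<rho> by auto
  have "\<forall>\<^sub>F r in nhds p. r \<in> U \<and> 0 < \<rho> * dz edge r"
  proof (rule eventually_smooth_pos[OF chart(1) _ p(1)])
    show "continuous_on U (\<lambda>r. \<rho> * dz edge r)"
      by (intro continuous_on_mult continuous_on_const smooth_on_continuous smooth_on_pd smooth_coords)
    show "0 < \<rho> * dz edge p" using deg by (auto simp: \<rho>_def sgn_real_def)
  qed
  moreover have "\<forall>\<^sub>F r in nhds p. r \<in> U \<and> 0 < \<tau> * dz (dz eqn) r"
  proof (rule eventually_smooth_pos[OF chart(1) _ p(1)])
    show "continuous_on U (\<lambda>r. \<tau> * dz (dz eqn) r)"
      by (intro continuous_on_mult continuous_on_const smooth_on_continuous smooth_on_pd smooth_coords)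
    show "0 < \<tau> * dz (dz eqn) p" using zz by (auto simp: \<tau>_def sgn_real_def)
  qed
  moreover note eventually_sgn_height[OF deg(2)]
  ultimately have "\<forall>\<^sub>F r in nhds (x, 0, z). r \<in> U \<and> 0 < \<rho> * dz edge r \<and> 0 < \<tau> * dz (dz eqn) r \<and>
      (edge r = 0 \<longrightarrow> sgn (fst (snd r)) = \<kappa> * sgn (eqn r))"
    unfolding pxz[symmetric] \<kappa>_def by eventually_elim auto
  then obtain e0 where e0: "0 < e0" "\<forall>\<^sub>F v in nhds (x, 0). \<forall>\<zeta>. \<bar>\<zeta> - z\<bar> < e0 \<longrightarrow>
      (fst v, snd v, \<zeta>) \<in> U \<and> 0 < \<rho> * dz edge (fst v, snd v, \<zeta>) \<and> 0 < \<tau> * dz (dz eqn) (fst v, snd v, \<zeta>) \<and>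
      (edge (fst v, snd v, \<zeta>) = 0 \<longrightarrow> sgn (snd v) = \<kappa> * sgn (eqn (fst v, snd v, \<zeta>)))"
    by (rule eventually_nhds_fiber) auto
  have der: "((\<lambda>\<zeta>. h (s, t, \<rho> * \<zeta>)) has_real_derivative \<rho> * dz h (s, t, \<rho> * \<zeta>)) (at \<zeta>)"
    if h: "smooth_on U h" and U: "(s, t, \<rho> * \<zeta>) \<in> U" for h s t \<zeta>
    using smooth_on_line_deriv[OF h, of "(s, t, 0)" \<zeta> "\<rho> *\<^sub>R (0, 0, 1)"] pd_scaleR[OF h U, of \<rho> "(0, 0, 1)"] U
    by (simp add: mult.commute)
  have cont: "isCont (\<lambda>v. h (fst v, snd v, c)) v" if h: "smooth_on U h" and U: "(fst v, snd v, c) \<in> U"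
    for h :: "real \<times> real \<times> real \<Rightarrow> real" and v c
  proof -
    have "isCont h (fst v, snd v, c)"
      using smooth_on_continuous[OF h] chart(1) U by (simp add: continuous_on_eq_continuous_at)
    moreover have "isCont (\<lambda>v. (fst v, snd v, c)) v"
      by (intro isCont_Pair isCont_fst isCont_snd continuous_ident continuous_const)
    ultimately show ?thesis using isCont_o2[of v "\<lambda>v. (fst v, snd v, c)" h] by blast
  qed
  have main: "\<forall>\<^sub>F v in upper (x, 0). \<exists>\<zeta>. sec S v \<inter> ball z e = {\<zeta>} \<and> (snd v = 0 \<longrightarrow> edge (fst v, snd v, \<zeta>) = 0)"
    if e: "0 < e" "e < e0" for e
  proof -
    \<comment> \<open>The factor \<tau> makes \<open>eqn\<close> convex along the fiber. Replacing
      \<zeta> by \<open>\<rho> * \<zeta>\<close> reverses the fiber if \<open>edge\<close> decreases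
      along it; since \<rho> squares to 1, the second derivative is not affected.\<close>
    define F where "F = (\<lambda>v \<zeta>. \<tau> * eqn (fst v, snd v, \<rho> * \<zeta>))"
    define G where "G = (\<lambda>v \<zeta>. edge (fst v, snd v, \<rho> * \<zeta>))"
    have abs: "\<bar>\<rho> * \<zeta> - z\<bar> = \<bar>\<zeta> - \<rho> * z\<bar>" for \<zeta> using \<rho> by auto
    have "\<forall>\<^sub>F v in upper (x, 0). \<exists>\<zeta>. {\<zeta> \<in> {\<rho> * z - e<..<\<rho> * z + e}. F v \<zeta> = 0 \<and> 0 \<le> G v \<zeta>} = {\<zeta>} \<and> (snd v = 0 \<longrightarrow> G v \<zeta> = 0)"
    proof (rule degenerate_unique[OF e(1), where \<sigma> = "\<tau> * \<kappa>" and F' = "\<lambda>v \<zeta>. \<tau> * (\<rho> * dz eqn (fst v, snd v, \<rho> * \<zeta>))"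
          and F'' = "\<lambda>v \<zeta>. \<tau> * dz (dz eqn) (fst v, snd v, \<rho> * \<zeta>)" and G' = "\<lambda>v \<zeta>. \<rho> * dz edge (fst v, snd v, \<rho> * \<zeta>)"])
      show "\<tau> * \<kappa> = 1 \<or> \<tau> * \<kappa> = - 1" using \<tau> \<kappa> by auto
      show "F (x, 0) (\<rho> * z) = 0" "\<tau> * (\<rho> * dz eqn (fst (x, 0), snd (x, 0), \<rho> * (\<rho> * z))) = 0" "G (x, 0) (\<rho> * z) = 0"
        using p deg(1) by (simp_all add: F_def G_def \<rho>2 pxz)
      show "\<forall>\<^sub>F v in nhds (x, 0). \<forall>\<zeta>\<in>{\<rho> * z - e..\<rho> * z + e}.
          degenerate_model (\<tau> * \<kappa>) F (\<lambda>v \<zeta>. \<tau> * (\<rho> * dz eqn (fst v, snd v, \<rho> * \<zeta>)))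
            (\<lambda>v \<zeta>. \<tau> * dz (dz eqn) (fst v, snd v, \<rho> * \<zeta>)) G (\<lambda>v \<zeta>. \<rho> * dz edge (fst v, snd v, \<rho> * \<zeta>)) v \<zeta>"
      proof (rule eventually_mono[OF e0(2)], rule ballI)
        fix v \<zeta>
        assume *: "\<forall>\<zeta>. \<bar>\<zeta> - z\<bar> < e0 \<longrightarrow>
          (fst v, snd v, \<zeta>) \<in> U \<and> 0 < \<rho> * dz edge (fst v, snd v, \<zeta>) \<and> 0 < \<tau> * dz (dz eqn) (fst v, snd v, \<zeta>) \<and>
          (edge (fst v, snd v, \<zeta>) = 0 \<longrightarrow> sgn (snd v) = \<kappa> * sgn (eqn (fst v, snd v, \<zeta>)))"
          and "\<zeta> \<in> {\<rho> * z - e..\<rho> * z + e}"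
        then have "\<bar>\<rho> * \<zeta> - z\<bar> < e0" using e unfolding abs by auto
        with * have U: "(fst v, snd v, \<rho> * \<zeta>) \<in> U" and pos: "0 < \<rho> * dz edge (fst v, snd v, \<rho> * \<zeta>)"
          "0 < \<tau> * dz (dz eqn) (fst v, snd v, \<rho> * \<zeta>)"
          and sg: "edge (fst v, snd v, \<rho> * \<zeta>) = 0 \<longrightarrow> sgn (snd v) = \<kappa> * sgn (eqn (fst v, snd v, \<rho> * \<zeta>))"
          by blast+
        have "(F v has_real_derivative \<tau> * (\<rho> * dz eqn (fst v, snd v, \<rho> * \<zeta>))) (at \<zeta>)"
          unfolding F_def by (intro DERIV_cmult der smooth_coords U)
        moreover have "((\<lambda>\<zeta>. \<tau> * (\<rho> * dz eqn (fst v, snd v, \<rho> * \<zeta>))) has_real_derivative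
            \<tau> * (\<rho> * (\<rho> * dz (dz eqn) (fst v, snd v, \<rho> * \<zeta>)))) (at \<zeta>)"
          by (intro DERIV_cmult der smooth_on_pd smooth_coords U)
        then have "((\<lambda>\<zeta>. \<tau> * (\<rho> * dz eqn (fst v, snd v, \<rho> * \<zeta>))) has_real_derivative
            \<tau> * dz (dz eqn) (fst v, snd v, \<rho> * \<zeta>)) (at \<zeta>)"
          by (simp only: \<rho>2)
        moreover have "(G v has_real_derivative \<rho> * dz edge (fst v, snd v, \<rho> * \<zeta>)) (at \<zeta>)"
          unfolding G_def by (intro der smooth_coords U)
        moreover have "isCont (\<lambda>v. F v \<zeta>) v" "isCont (\<lambda>v. G v \<zeta>) v"
          unfolding F_def G_def by (intro isCont_mult continuous_const cont smooth_coords U)+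
        moreover have "G v \<zeta> = 0 \<longrightarrow> sgn (F v \<zeta>) = \<tau> * \<kappa> * sgn (snd v)"
          using sg \<tau> \<kappa> by (auto simp: G_def F_def sgn_mult)
        moreover have "0 \<le> snd v" if "F v \<zeta> = 0" "0 \<le> G v \<zeta>"
        proof -
          have "(fst v, snd v, \<rho> * \<zeta>) \<in> S"
            using that \<tau> by (auto simp: mem_surface_iff[OF U] F_def G_def)
          then show ?thesis using upper_half by auto
        qed
        ultimately show "degenerate_model (\<tau> * \<kappa>) F (\<lambda>v \<zeta>. \<tau> * (\<rho> * dz eqn (fst v, snd v, \<rho> * \<zeta>)))
            (\<lambda>v \<zeta>. \<tau> * dz (dz eqn) (fst v, snd v, \<rho> * \<zeta>)) G (\<lambda>v \<zeta>. \<rho> * dz edge (fst v, snd v, \<rho> * \<zeta>)) v \<zeta>"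
          unfolding degenerate_model_def using pos by blast
      qed
    qed simp
    moreover have "\<forall>\<^sub>F v in upper (x, 0). \<forall>\<zeta>. \<bar>\<zeta> - z\<bar> < e0 \<longrightarrow> (fst v, snd v, \<zeta>) \<in> U"
      using e0(2) unfolding eventually_upper by eventually_elim blast
    ultimately show ?thesis
    proof eventually_elim
      case (elim v)
      then obtain \<zeta> where \<zeta>: "{\<zeta> \<in> {\<rho> * z - e<..<\<rho> * z + e}. F v \<zeta> = 0 \<and> 0 \<le> G v \<zeta>} = {\<zeta>}" "snd v = 0 \<longrightarrow> G v \<zeta> = 0"
        by blast
      have "\<xi> \<in> sec S v \<inter> ball z e \<longleftrightarrow> \<rho> * \<xi> \<in> {\<zeta> \<in> {\<rho> * z - e<..<\<rho> * z + e}. F v \<zeta> = 0 \<and> 0 \<le> G v \<zeta>}" for \<xi>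
      proof -
        have b: "\<xi> \<in> ball z e \<longleftrightarrow> \<rho> * \<xi> \<in> {\<rho> * z - e<..<\<rho> * z + e}"
          using \<rho> by (auto simp: ball_real)
        have "\<xi> \<in> sec S v \<longleftrightarrow> F v (\<rho> * \<xi>) = 0 \<and> 0 \<le> G v (\<rho> * \<xi>)" if "\<xi> \<in> ball z e"
        proof -
          have "\<bar>\<xi> - z\<bar> < e0" using that e by (auto simp: dist_real_def)
          then have "(fst v, snd v, \<xi>) \<in> U" using elim(2) by blast
          then show ?thesis using \<tau> by (auto simp: sec_def mem_surface_iff F_def G_def \<rho>2)
        qed
        with b show ?thesis by blast
      qed
      then have "\<xi> \<in> sec S v \<inter> ball z e \<longleftrightarrow> \<xi> = \<rho> * \<zeta>" for \<xi>
        unfolding \<zeta>(1) using \<rho>2 by (metis singleton_iff)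
      then have "sec S v \<inter> ball z e = {\<rho> * \<zeta>}" by blast
      then show ?case using \<zeta>(2) by (auto simp: G_def)
    qed
  qed
  have "\<forall>\<^sub>F e in at_right 0. \<forall>\<^sub>F v in upper (x, 0). \<exists>\<zeta>. sec S v \<inter> ball z e = {\<zeta>}"
  proof (rule eventually_at_rightI[of 0 e0])
    fix e assume "e \<in> {0<..<e0}"
    then have "0 < e" "e < e0" by auto
    from main[OF this] show "\<forall>\<^sub>F v in upper (x, 0). \<exists>\<zeta>. sec S v \<inter> ball z e = {\<zeta>}"
      by eventually_elim blast
  qed (rule e0(1))
  moreover have "z \<in> sec S (x, 0)"
    using mem_surface_iff[OF p(1)] p by (simp add: sec_def pxz)
  ultimately show "crossing (sec S) (fst p, fst (snd p)) (snd (snd p))"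
    by (simp add: crossing_def pxz)
  define e where "e = e0 / 2"
  have e: "0 < e" "e < e0" using e0(1) by (auto simp: e_def)
  have "filterlim (\<lambda>r. (fst r, fst (snd r))) (nhds (fst p, fst (snd p))) (nhds p)"
    by (intro tendsto_intros filterlim_ident)
  then have "filterlim (\<lambda>r. (fst r, fst (snd r))) (nhds (x, 0)) (nhds p)"
    by (simp add: pxz)
  from filterlim_iff[THEN iffD1, rule_format, OF this main[OF e, unfolded eventually_upper]]
  have "\<forall>\<^sub>F r in nhds p. 0 \<le> fst (snd r) \<longrightarrow>
      (\<exists>\<zeta>. sec S (fst r, fst (snd r)) \<inter> ball z e = {\<zeta>} \<and> (fst (snd r) = 0 \<longrightarrow> edge (fst r, fst (snd r), \<zeta>) = 0))"
    by (simp add: pxz)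
  moreover have "\<forall>\<^sub>F r in nhds p. snd (snd r) \<in> ball z e"
  proof -
    have "filterlim (\<lambda>r. snd (snd r)) (nhds (snd (snd p))) (nhds p)"
      by (intro tendsto_intros filterlim_ident)
    from filterlim_iff[THEN iffD1, rule_format, OF this, of "\<lambda>t. t \<in> ball z e"]
    show ?thesis using e eventually_nhds_in_open[of "ball z e" z] by (simp add: pxz)
  qed
  ultimately show "\<forall>\<^sub>F r in nhds p. r \<in> S \<and> fst (snd r) = 0 \<longrightarrow> edge r = 0"
  proof eventually_elim
    case (elim r)
    show ?case
    proof
      assume r: "r \<in> S \<and> fst (snd r) = 0"
      then obtain \<zeta> where \<zeta>: "sec S (fst r, fst (snd r)) \<inter> ball z e = {\<zeta>}" "edge (fst r, fst (snd r), \<zeta>) = 0"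
        using elim by auto
      have "snd (snd r) \<in> sec S (fst r, fst (snd r)) \<inter> ball z e"
      proof -
        have "(fst r, fst (snd r), snd (snd r)) \<in> S"
          using r[THEN conjunct1] by (simp only: prod.collapse)
        then show ?thesis using elim(2) by (simp add: sec_def)
      qed
      then have "snd (snd r) = \<zeta>" unfolding \<zeta>(1) by simp
      with \<zeta>(2) show "edge r = 0" by (cases r) auto
    qed
  qed
qed

end

section \<open>Surfaces without cusps\<close>

text \<open>The points of a nearby fiber gather around \<open>sec q\<close>, and those in the ball
  of radius \<open>radius q\<close> about \<open>z\<close> gather around \<open>z\<close>.
  Statements about small radii can thus be applied to the radius used in
  \<open>germ\<close>.\<close>

lemma (in fold_family) eventually_sec_ball_radius:
  assumes q: "0 \<le> snd q" and z: "z \<in> sec q" and e: "0 < e" "e \<le> radius q"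
  shows "\<forall>\<^sub>F v in upper q. sec v \<inter> ball z (radius q) = sec v \<inter> ball z e"
proof -
  have r: "0 < radius q" "\<forall>z\<in>sec q. \<forall>z'\<in>sec q. z \<noteq> z' \<longrightarrow> 2 * radius q \<le> \<bar>z - z'\<bar>"
    using admissible_radius[OF q] unfolding admissible_def by blast+
  have "\<forall>\<^sub>F v in upper q. \<forall>\<xi>\<in>sec v. \<xi> \<in> ball z (radius q) \<longrightarrow> \<xi> \<in> ball z e"
  proof (rule stable, intro ballI)
    fix z' assume z': "z' \<in> sec q"
    show "\<forall>\<^sub>F \<xi> in nhds z'. \<xi> \<in> ball z (radius q) \<longrightarrow> \<xi> \<in> ball z e"
    proof (cases "z' = z")
      case True
      have "\<forall>\<^sub>F \<xi> in nhds z'. \<xi> \<in> ball z e"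
        using True e by (intro eventually_nhds_in_open) auto
      then show ?thesis by eventually_elim blast
    next
      case False
      then have d: "2 * radius q \<le> \<bar>z - z'\<bar>" using r(2)[rule_format, OF z z'] by simp
      have "\<forall>\<^sub>F \<xi> in nhds z'. \<xi> \<in> ball z' (radius q)"
        using r(1) by (intro eventually_nhds_in_open) auto
      then show ?thesis
        by eventually_elim (use d in \<open>auto simp: dist_real_def\<close>)
    qed
  qed
  then show ?thesis
    by eventually_elim (use e in auto)
qed

section \<open>Every point of a surface without cusps is a crossing or a fold\<close>

text \<open>The sign is normalised: along the fiber the equation has a strict local minimum at
  \<open>p\<close>.\<close>

definition tangent_equation where
  "tangent_equation S U f p \<longleftrightarrow> regular_equation S U f \<and> p \<in> U \<and> f p = 0 \<and> dz f p = 0 \<and> 0 < dz (dz f) p"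

lemma tangent_equation_exists:
  assumes "regular_equation S U f" "p \<in> U" "f p = 0" "dz f p = 0" "dz (dz f) p \<noteq> 0"
  obtains \<tau> :: real where "\<tau> = 1 \<or> \<tau> = -1" "tangent_equation S U (\<lambda>q. \<tau> * f q) p"
    "\<And>v. pd v (\<lambda>q. \<tau> * f q) p = \<tau> * pd v f p"
proof (cases "0 < dz (dz f) p")
  case True
  then show thesis using assms by (intro that[of 1]) (auto simp: tangent_equation_def)
next
  case False
  have "open U" "smooth_on U f" using assms by (auto simp: regular_equation_def)
  then show thesis
    using assms False
    by (intro that[of "-1"]) (auto simp: tangent_equation_def regular_equation_uminus pd_uminus dz_dz_uminus)
qed

locale cuspless_surface =
  fixes S :: "(real \<times> real \<times> real) set" and C :: "(real \<times> real) set"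
  assumes surface: "smooth_compact_surface S"
    and upper_half: "S \<subseteq> {(x, y, z). 0 \<le> y}"
    and bdry: "bounds S C"
    and nocusp: "\<And>p m. p \<in> S \<Longrightarrow> fiber_multiplicity S p m \<Longrightarrow> m < 3"
begin

lemma boundary_iff: "(x, y, z) \<in> surface_boundary S \<longleftrightarrow> y = 0 \<and> (x, z) \<in> C"
  using bdry unfolding bounds_def xz_plane_def by auto

lemma C_subset: "(x, z) \<in> C \<Longrightarrow> (x, 0, z) \<in> S"
  using boundary_iff[of x 0 z] by (auto simp: surface_boundary_def)

lemma interior_chart:
  assumes "p \<in> S" "p \<notin> surface_boundary S"
  obtains U f where "regular_equation S U f" "p \<in> U" "f p = 0" "dz f p \<noteq> 0 \<or> dz (dz f) p \<noteq> 0"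
    "\<And>q. q \<in> U \<Longrightarrow> f q = 0 \<Longrightarrow> q \<in> S"
proof -
  obtain U \<phi> where c: "surface_chart S p U \<phi>"
    using surface assms(1) unfolding smooth_compact_surface_def by blast
  then obtain V \<psi> where V: "p \<in> U" "smooth_diffeo U V \<phi> \<psi>" "\<phi> ` (S \<inter> U) = V \<inter> {(u, v, w). 0 \<le> u \<and> w = 0}"
    unfolding surface_chart_def by blast
  interpret straightening_chart S U V \<phi> \<psi>
    using V upper_half by unfold_locales
  have "fst (\<phi> p) \<noteq> 0" using assms c by (auto simp: surface_boundary_def)
  then have e: "0 < edge p" and f: "eqn p = 0"
    using mem_surface_iff[OF V(1)] assms(1) by (auto simp: edge_def)
  let ?W = "{q \<in> U. 0 < edge q}"
  note reg = regular_equation_interior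
  have "dz eqn p \<noteq> 0 \<or> dz (dz eqn) p \<noteq> 0"
  proof -
    obtain x y z where p: "p = (x, y, z)" by (cases p)
    obtain v where v: "pd v eqn p \<noteq> 0" using pd_eqn_neq_0[OF V(1)] by blast
    show ?thesis
      using dz_neq_0_if_no_cusp[of S x y z U eqn v] nocusp[OF assms(1)] chart(1) smooth_coords(1) V(1) f v
        mem_surface_iff unfolding p by blast
  qed
  then show thesis
    using reg V(1) e f mem_surface_iff by (intro that[of ?W eqn]) auto
qed

text \<open>The cases are whether or not \<open>S\<close> is tangent to the plane y = 0. If it is,
  the degenerate model gives a crossing. If not, \<open>S\<close> is locally a zero set cut by the
  half space, and the derivative along the fiber separates crossings from folds. In both cases the
  nearby points of \<open>S\<close> in the plane y = 0 belong to the boundary.\<close>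

lemma boundary_structure:
  assumes "(x, z) \<in> C"
  shows "\<forall>\<^sub>F r in nhds (x, 0, z). r \<in> S \<and> fst (snd r) = 0 \<longrightarrow> (fst r, snd (snd r)) \<in> C"
    and "crossing (sec S) (x, 0) z \<or> (\<exists>U f. tangent_equation S U f (x, 0, z) \<and> pd (1, 0, 0) f (x, 0, z) \<noteq> 0)"
proof -
  define p where "p = (x, 0::real, z)"
  have pB: "p \<in> surface_boundary S" using assms by (simp add: p_def boundary_iff)
  then have pS: "p \<in> S" by (simp add: surface_boundary_def)
  obtain U \<phi> where c: "surface_chart S p U \<phi>" "fst (\<phi> p) = 0"
    using pB unfolding surface_boundary_def by blast
  then obtain V \<psi> where V: "p \<in> U" "smooth_diffeo U V \<phi> \<psi>" "\<phi> ` (S \<inter> U) = V \<inter> {(u, v, w). 0 \<le> u \<and> w = 0}"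
    unfolding surface_chart_def by blast
  interpret straightening_chart S U V \<phi> \<psi>
    using V upper_half by unfold_locales
  have bd: "q \<in> surface_boundary S" if "q \<in> U" "eqn q = 0" "edge q = 0" for q
  proof -
    have "surface_chart S q U \<phi>" using V that(1) unfolding surface_chart_def by blast
    moreover have "q \<in> S" using mem_surface_iff[OF that(1)] that by simp
    ultimately show ?thesis using that(3) unfolding surface_boundary_def edge_def by blast
  qed
  interpret boundary_chart S U V \<phi> \<psi> p
  proof
    show "p \<in> U" by fact
    show "eqn p = 0" using mem_surface_iff[OF V(1)] pS by simp
    show "edge p = 0" using c by (simp add: edge_def)
    fix q assume "q \<in> U" "eqn q = 0" "edge q = 0"
    from bd[OF this] show "fst (snd q) = 0" by (cases q) (simp add: boundary_iff)
  qed
  obtain v where v: "pd v eqn p \<noteq> 0" using pd_eqn_neq_0[OF V(1)] by blast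
  have nc: "dz eqn p \<noteq> 0 \<or> dz (dz eqn) p \<noteq> 0"
    using dz_neq_0_if_no_cusp[of S x 0 z U eqn v] nocusp[OF pS] chart(1) smooth_coords(1) V(1) v
      mem_surface_iff pS unfolding p_def by blast
  have inC: "(fst r, snd (snd r)) \<in> C" if "r \<in> U" "r \<in> S" "edge r = 0" for r
    using bd[of r] that mem_surface_iff[OF that(1)] by (cases r) (simp add: boundary_iff)
  have evU: "\<forall>\<^sub>F r in nhds p. r \<in> U" by (rule eventually_nhds_in_open[OF chart(1) V(1)])
  have "(\<forall>\<^sub>F r in nhds p. r \<in> S \<and> fst (snd r) = 0 \<longrightarrow> edge r = 0) \<and>
    (crossing (sec S) (x, 0) z \<or> (\<exists>U f. tangent_equation S U f p \<and> pd (1, 0, 0) f p \<noteq> 0))"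
  proof (cases "pd (1, 0, 0) height (0, b, 0) = 0")
    case True
    have "dz (dz eqn) p \<noteq> 0"
    proof
      assume zz: "dz (dz eqn) p = 0"
      with nc have z1: "dz eqn p \<noteq> 0" by simp
      \<comment> \<open>The derivative of y in the direction y shows that the coefficient of
        \<open>eqn\<close> is nonzero; in the direction z it shows that the product vanishes,
        against \<open>z1\<close>.\<close>
      have "pd (0, 0, 1) height (0, b, 0) \<noteq> 0" "dz eqn p * pd (0, 0, 1) height (0, b, 0) = 0"
        using pd_height_\<phi>[of "(0, 1, 0)"] pd_height_\<phi>[of "(0, 0, 1)"] True by auto
      with z1 show False by simp
    qed
    from degenerate_crossing[OF True this] show ?thesis by (simp add: p_def)
  next
    case False
    from regular_equation_boundary[OF False] obtain W where
      W: "regular_equation S W eqn" "p \<in> W" "\<forall>r\<in>W. r \<in> S \<and> fst (snd r) = 0 \<longrightarrow> edge r = 0" by blast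
    have "\<forall>\<^sub>F r in nhds p. r \<in> W"
      using W by (intro eventually_nhds_in_open) (auto simp: regular_equation_def)
    then have 1: "\<forall>\<^sub>F r in nhds p. r \<in> S \<and> fst (snd r) = 0 \<longrightarrow> edge r = 0"
      by eventually_elim (use W(3) in blast)
    show ?thesis
    proof (cases "dz eqn p = 0")
      case True
      then have "dz (dz eqn) p \<noteq> 0" using nc by simp
      with W True p(2) obtain \<tau> :: real where "\<tau> = 1 \<or> \<tau> = -1" "tangent_equation S W (\<lambda>q. \<tau> * eqn q) p"
        "\<And>v. pd v (\<lambda>q. \<tau> * eqn q) p = \<tau> * pd v eqn p" by (elim tangent_equation_exists) auto
      with pd_x_neq_0[OF False True] 1 show ?thesis by force
    next
      case False
      with crossing_if_transversal[OF W(1), of x 0 z] W p 1 show ?thesis by (simp add: p_def)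
    qed
  qed
  then have *: "\<forall>\<^sub>F r in nhds p. r \<in> S \<and> fst (snd r) = 0 \<longrightarrow> edge r = 0"
    and **: "crossing (sec S) (x, 0) z \<or> (\<exists>U f. tangent_equation S U f p \<and> pd (1, 0, 0) f p \<noteq> 0)" by auto
  from * evU show "\<forall>\<^sub>F r in nhds (x, 0, z). r \<in> S \<and> fst (snd r) = 0 \<longrightarrow> (fst r, snd (snd r)) \<in> C"
    unfolding p_def[symmetric] by eventually_elim (use inC in blast)
  from ** show "crossing (sec S) (x, 0) z \<or> (\<exists>U f. tangent_equation S U f (x, 0, z) \<and> pd (1, 0, 0) f (x, 0, z) \<noteq> 0)"
    by (simp add: p_def)
qed

lemma tangent_or_crossing:
  assumes "(x, y, z) \<in> S"
  shows "crossing (sec S) (x, y) z \<or> (\<exists>U f. tangent_equation S U f (x, y, z))"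
proof (cases "(x, y, z) \<in> surface_boundary S")
  case True
  then have "y = 0" "(x, z) \<in> C" by (simp_all add: boundary_iff)
  from boundary_structure(2)[OF this(2)] this(1) show ?thesis by blast
next
  case False
  have y: "0 \<le> y" using assms upper_half by auto
  obtain U f where
    U: "regular_equation S U f" "(x, y, z) \<in> U" "f (x, y, z) = 0" "dz f (x, y, z) \<noteq> 0 \<or> dz (dz f) (x, y, z) \<noteq> 0"
    by (rule interior_chart[OF assms False])
  show ?thesis
  proof (cases "dz f (x, y, z) = 0")
    case True
    with U(4) have "dz (dz f) (x, y, z) \<noteq> 0" by simp
    from tangent_equation_exists[OF U(1-3) True this] show ?thesis by blast
  next
    case False
    then show ?thesis using crossing_if_transversal[OF U(1-3) y] by blast
  qed
qed

text \<open>At an interior point of \<open>S\<close> in the plane y = 0 the equation has no zero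
  below the plane, hence one sign on it. Its restriction to the fiber, which lies in the plane, has
  an extremum at \<open>z\<close>, and the absence of cusps makes the second derivative nonzero.
  Normalising that derivative to be positive also makes the equation nonnegative on the
  plane.\<close>

lemma touching_tangent:
  assumes "(x, 0, z) \<in> S" "(x, z) \<notin> C"
  shows "\<exists>U f. tangent_equation S U f (x, 0, z) \<and> (\<forall>\<^sub>F q in nhds (x, 0, z). fst (snd q) = 0 \<longrightarrow> 0 \<le> f q)"
proof -
  define p where "p = (x, 0::real, z)"
  have p: "p \<in> S" "p \<notin> surface_boundary S" using assms by (auto simp: p_def boundary_iff)
  obtain U f where
    U: "regular_equation S U f" "p \<in> U" "f p = 0" "dz f p \<noteq> 0 \<or> dz (dz f) p \<noteq> 0"
    "\<And>q. q \<in> U \<Longrightarrow> f q = 0 \<Longrightarrow> q \<in> S" by (rule interior_chart[OF p]) blast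
  have sm: "open U" "smooth_on U f" using U(1) by (auto simp: regular_equation_def)
  have "\<exists>\<tau>. (\<tau> = 1 \<or> \<tau> = -1) \<and> (\<forall>\<^sub>F q in nhds p. fst (snd q) = 0 \<longrightarrow> 0 \<le> \<tau> * f q)"
  proof (rule touching_sign[OF sm(1) smooth_on_continuous[OF sm(2)] U(2)])
    fix q assume "q \<in> U" "fst (snd q) < 0"
    then show "f q \<noteq> 0" using U(5)[of q] upper_half by (cases q) auto
  qed
  then obtain \<sigma> :: real where \<sigma>: "\<sigma> = 1 \<or> \<sigma> = -1" "\<forall>\<^sub>F q in nhds p. fst (snd q) = 0 \<longrightarrow> 0 \<le> \<sigma> * f q" by blast
  have "filterlim (\<lambda>t. (x, 0::real, t)) (nhds p) (nhds z)"
    unfolding p_def by (intro tendsto_intros filterlim_ident)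
  from filterlim_iff[THEN iffD1, rule_format, OF this \<sigma>(2)]
  have nonneg: "\<forall>\<^sub>F t in nhds z. 0 \<le> \<sigma> * f (x, 0, t)" by simp
  have der: "((\<lambda>t. \<sigma> * f (x, 0, t)) has_real_derivative \<sigma> * dz f p) (at z)"
    unfolding p_def by (intro DERIV_cmult smooth_on_fiber_deriv[OF sm(2)]) (use U(2) in \<open>simp add: p_def\<close>)
  obtain d where d: "0 < d" "\<And>t. \<bar>z - t\<bar> < d \<Longrightarrow> 0 \<le> \<sigma> * f (x, 0, t)"
    using nonneg unfolding eventually_nhds_metric by (auto simp: dist_real_def abs_minus_commute)
  have "\<sigma> * dz f p = 0"
    by (rule DERIV_local_min[OF der d(1)]) (use d(2) U(3) in \<open>auto simp: p_def\<close>)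
  then have z0: "dz f p = 0" using \<sigma>(1) by auto
  then have "dz (dz f) p \<noteq> 0" using U(4) by simp
  then obtain \<tau> :: real where \<tau>: "\<tau> = 1 \<or> \<tau> = -1" "tangent_equation S U (\<lambda>q. \<tau> * f q) p"
    by (rule tangent_equation_exists[OF U(1-3) z0])
  define g where "g = (\<lambda>q. \<tau> * f q)"
  have tg: "regular_equation S U g" "g p = 0" "dz g p = 0" "0 < dz (dz g) p"
    using \<tau>(2) by (auto simp: tangent_equation_def g_def)
  obtain e0 where e0: "0 < e0" "\<forall>\<^sub>F v in nhds (x, 0). \<forall>\<zeta>. \<bar>\<zeta> - z\<bar> < e0 \<longrightarrow> (fst v, snd v, \<zeta>) \<in> U \<and> 0 < dz (dz g) (fst v, snd v, \<zeta>)"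
  proof (rule eventually_nhds_fiber[of "\<lambda>q. q \<in> U \<and> 0 < dz (dz g) q"])
    have "smooth_on U g" using tg(1) by (simp add: regular_equation_def)
    then show "\<forall>\<^sub>F q in nhds (x, 0, z). q \<in> U \<and> 0 < dz (dz g) q"
      using U(2) tg(4) sm(1) unfolding p_def
      by (intro eventually_smooth_pos smooth_on_continuous smooth_on_pd)
  qed
  have "\<forall>\<zeta>. \<bar>\<zeta> - z\<bar> < e0 \<longrightarrow> (x, 0, \<zeta>) \<in> U \<and> 0 < dz (dz g) (x, 0, \<zeta>)"
    using eventually_nhds_x_imp_x[OF e0(2)] by simp
  \<comment> \<open>The two signs are compared at a height other than \<open>z\<close>, where the
    normalised equation is strictly positive.\<close>
  from fiber_pos[OF tg(1) _ _ _ _ _ this, of "z + min d e0 / 2"] tg U(2) d(1) e0(1)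
  have "0 < g (x, 0, z + min d e0 / 2)" by (auto simp: p_def)
  moreover have "0 \<le> \<sigma> * f (x, 0, z + min d e0 / 2)" using d(1) e0(1) by (intro d(2)) auto
  ultimately have "\<sigma> = \<tau>" using \<sigma>(1) \<tau>(1) by (auto simp: g_def)
  then show ?thesis using \<sigma>(2) \<tau>(2) unfolding p_def by blast
qed

lemma tangent_not_crossing:
  assumes "tangent_equation S U f (x, y, z)" "0 \<le> y"
  shows "\<not> crossing (sec S) (x, y) z"
    and "\<forall>\<^sub>F e in at_right 0. \<forall>\<^sub>F v in upper (x, y). fold_chart (sec S) z e v"
  using fold_if_tangent[of S U f x y z] assms unfolding tangent_equation_def by auto

lemma compact_S: "compact S"
  using surface by (simp add: smooth_compact_surface_def)

sublocale fold_family "sec S"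
proof
  fix q :: "real \<times> real" and P :: "real \<Rightarrow> bool"
  assume P: "\<forall>z\<in>sec S q. eventually P (nhds z)"
  define Oset where "Oset = {\<zeta>. eventually P (nhds \<zeta>)}"
  have "open Oset"
    unfolding Oset_def open_subopen[of "Collect _"] eventually_nhds by blast
  \<comment> \<open>The projection of the part of \<open>S\<close> at heights outside
    \<open>Oset\<close>. It is compact and misses \<open>q\<close>, so its complement is a
    neighbourhood of \<open>q\<close>.\<close>
  define K where "K = (\<lambda>r. (fst r, fst (snd r))) ` (S \<inter> (\<lambda>r. snd (snd r)) -` (- Oset))"
  have "compact (S \<inter> (\<lambda>r. snd (snd r)) -` (- Oset))"
    using \<open>open Oset\<close> by (intro compact_Int_closed compact_S continuous_closed_vimage) (auto intro!: continuous_intros)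
  then have "compact K"
    unfolding K_def by (intro compact_continuous_image) (auto intro!: continuous_intros)
  then have "open (- K)" by (simp add: compact_imp_closed open_Compl)
  moreover have "q \<in> - K"
    using P by (auto simp: K_def Oset_def sec_def)
  ultimately have "\<forall>\<^sub>F v in nhds q. v \<in> - K" by (rule eventually_nhds_in_open)
  then have "\<forall>\<^sub>F v in nhds q. \<forall>\<zeta>\<in>sec S v. P \<zeta>"
  proof eventually_elim
    case (elim v)
    show ?case
    proof
      fix \<zeta> assume "\<zeta> \<in> sec S v"
      then have "\<zeta> \<in> Oset" using elim by (force simp: K_def sec_def image_iff)
      then show "P \<zeta>" by (auto simp: Oset_def dest: eventually_nhds_x_imp_x)
    qed
  qed
  then show "\<forall>\<^sub>F v in upper q. \<forall>\<zeta>\<in>sec S v. P \<zeta>"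
    unfolding eventually_upper by eventually_elim blast
next
  fix q :: "real \<times> real"
  have "sec S q = (\<lambda>r. snd (snd r)) ` (S \<inter> (\<lambda>r. (fst r, fst (snd r))) -` {q})"
    by (auto simp: sec_def image_iff) force
  moreover have "compact (S \<inter> (\<lambda>r. (fst r, fst (snd r))) -` {q})"
    by (intro compact_Int_closed compact_S continuous_closed_vimage) (auto intro!: continuous_intros)
  ultimately show "compact (sec S q)"
    by (auto intro!: compact_continuous_image continuous_intros)
next
  fix q z assume "0 \<le> snd q" "z \<in> sec S q" "\<not> crossing (sec S) q z"
  moreover obtain x y where "q = (x, y)" by (cases q)
  ultimately show "\<forall>\<^sub>F e in at_right 0. \<forall>\<^sub>F v in upper q. fold_chart (sec S) z e v"
    using tangent_or_crossing[of x y z] tangent_not_crossing(2) by (auto simp: sec_def)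
qed

end

section \<open>Extrema of the spanned domain\<close>

lemma eventually_upper_line:
  assumes "\<forall>\<^sub>F v in upper (x, 0). P v"
  shows "\<forall>\<^sub>F t in nhds x. P (t, 0)"
proof -
  have "filterlim (\<lambda>t. (t, 0::real)) (nhds (x, 0)) (nhds x)"
    by (intro tendsto_intros filterlim_ident)
  from filterlim_iff[THEN iffD1, rule_format, OF this assms[unfolded eventually_upper]]
  show ?thesis by simp
qed

lemma open_shift:
  fixes q :: "real \<times> real"
  assumes "open W" "q \<in> W"
  obtains t where "0 < t" "(fst q + t, snd q) \<in> W" "(fst q - t, snd q) \<in> W"
proof -
  have "\<forall>\<^sub>F w in nhds (fst q, snd q). w \<in> W"
    using assms by (simp add: eventually_nhds_in_open)
  then obtain d where "0 < d" "\<And>s t. \<bar>s - fst q\<bar> < d \<Longrightarrow> \<bar>t - snd q\<bar> < d \<Longrightarrow> (s, t) \<in> W"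
    by (rule eventually_nhds_Pair_box) blast
  then show thesis by (intro that[of "d / 2"]) auto
qed

lemma local_maxima_iff: "p \<in> local_maxima D f \<longleftrightarrow> p \<in> D \<and> (\<forall>\<^sub>F q in nhds p. q \<in> D \<longrightarrow> f q \<le> f p)"
  unfolding local_maxima_def eventually_at_filter
  by (auto elim!: eventually_mono)

lemma local_minima_iff: "p \<in> local_minima D f \<longleftrightarrow> p \<in> D \<and> (\<forall>\<^sub>F q in nhds p. q \<in> D \<longrightarrow> f p \<le> f q)"
  unfolding local_minima_def eventually_at_filter
  by (auto elim!: eventually_mono)

lemma pz_eq: "pz q = fst q"
  by (simp add: pz_def split: prod.splits)

locale spanned_domain = cuspless_surface +
  fixes D :: "(real \<times> real) set"
  assumes domain: "compact_domain D" and frontier_D: "frontier D = C"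
begin

lemma compact_D: "compact D" and closure_interior_D: "closure (interior D) = D"
  using domain by (auto simp: compact_domain_def)

lemma closed_D: "closed D"
  using compact_D by (rule compact_imp_closed)

lemma C_D: "C \<subseteq> D"
  using frontier_subset_closed[OF closed_D] frontier_D by simp

lemma interior_D: "interior D = D - C"
  using frontier_D closed_D interior_subset by (auto simp: frontier_def)

lemma same_side:
  assumes "connected T" "T \<inter> C = {}" "p \<in> T" "q \<in> T"
  shows "p \<in> D \<longleftrightarrow> q \<in> D"
  using connected_Int_frontier[OF assms(1), of D] assms(2-4) frontier_D by blast

lemma mem_C_sec: "(x, z) \<in> C \<Longrightarrow> z \<in> sec S (x, 0)"
  using C_subset by (simp add: sec_def)

text \<open>\<open>S\<close> may touch the plane y = 0 at interior points as well, but not close to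
  its boundary.\<close>

lemma eventually_C_iff:
  assumes "(x, z) \<in> C"
  shows "\<forall>\<^sub>F r in nhds (x, z). snd r \<in> sec S (fst r, 0) \<longleftrightarrow> r \<in> C"
proof -
  have "((\<lambda>r. (fst r, 0::real, snd r)) \<longlongrightarrow> (fst (x, z), 0, snd (x, z))) (nhds (x, z))"
    by (intro tendsto_intros filterlim_ident)
  then have "filterlim (\<lambda>r. (fst r, 0::real, snd r)) (nhds (x, 0, z)) (nhds (x, z))" by simp
  from filterlim_iff[THEN iffD1, rule_format, OF this boundary_structure(1)[OF assms]]
  show ?thesis by eventually_elim (use mem_C_sec in \<open>auto simp: sec_def\<close>)
qed

lemma interior_near:
  assumes "p \<in> D" "open W" "p \<in> W"
  shows "W \<inter> interior D \<noteq> {}"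
proof -
  have "p \<in> closure (interior D)" using assms(1) by (simp add: closure_interior_D)
  then show ?thesis using assms(2,3) open_Int_closure_eq_empty by blast
qed

lemma interior_not_extremal:
  assumes "p \<in> D" "p \<notin> C"
  shows "p \<notin> local_maxima D pz" "p \<notin> local_minima D pz"
proof -
  have shift: "\<exists>t>0. (fst p + t, snd p) \<in> W \<inter> D \<and> (fst p - t, snd p) \<in> W \<inter> D" if W: "open W" "p \<in> W" for W
  proof -
    have "p \<in> W \<inter> interior D" using assms interior_D W by simp
    moreover have "open (W \<inter> interior D)" using W(1) by (intro open_Int open_interior)
    ultimately obtain t where "0 < t" "(fst p + t, snd p) \<in> W \<inter> interior D" "(fst p - t, snd p) \<in> W \<inter> interior D"
      using open_shift by blast
    then show ?thesis using interior_subset by blast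
  qed
  show "p \<notin> local_maxima D pz" "p \<notin> local_minima D pz"
    using shift unfolding local_maxima_iff local_minima_iff eventually_nhds pz_eq
    by fastforce+
qed

section \<open>The domain near the folds of \<open>C\<close>\<close>

text \<open>\<open>g\<close> is the normalised equation of the fold, restricted to the plane y = 0,
  and \<rho> is the sign of its x-derivative, which is nonzero by \<open>boundary_structure\<close>.
  These elementary properties of \<open>g\<close> are all that the geometry of the fold
  requires.\<close>

lemma fold_box:
  assumes C: "(x0, z0) \<in> C" and ncr: "\<not> crossing (sec S) (x0, 0) z0"
  obtains g :: "real \<Rightarrow> real \<Rightarrow> real" and a \<rho> :: real where "0 < a" "\<rho> = 1 \<or> \<rho> = -1"
    "\<And>x z. \<bar>x - x0\<bar> < a \<Longrightarrow> \<bar>z - z0\<bar> < a \<Longrightarrow> z \<in> sec S (x, 0) \<longleftrightarrow> g x z = 0"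
    "\<And>x z. \<bar>x - x0\<bar> < a \<Longrightarrow> \<bar>z - z0\<bar> < a \<Longrightarrow> (x, z) \<in> C \<longleftrightarrow> g x z = 0"
    "\<And>x x' z. \<bar>x - x0\<bar> < a \<Longrightarrow> \<bar>x' - x0\<bar> < a \<Longrightarrow> \<bar>z - z0\<bar> < a \<Longrightarrow> x < x' \<Longrightarrow> \<rho> * g x z < \<rho> * g x' z"
    "\<And>z. \<bar>z - z0\<bar> < a \<Longrightarrow> z \<noteq> z0 \<Longrightarrow> 0 < g x0 z" "g x0 z0 = 0"
    "\<And>x z. \<bar>x - x0\<bar> < a \<Longrightarrow> \<bar>z - z0\<bar> < a \<Longrightarrow> isCont (\<lambda>x. g x z) x \<and> isCont (g x) z"
proof -
  obtain U f where tf: "tangent_equation S U f (x0, 0, z0)" "pd (1, 0, 0) f (x0, 0, z0) \<noteq> 0"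
    using boundary_structure(2)[OF C] ncr by blast
  then have reg: "regular_equation S U f" and p: "(x0, 0, z0) \<in> U" "f (x0, 0, z0) = 0" "dz f (x0, 0, z0) = 0"
    "0 < dz (dz f) (x0, 0, z0)" by (auto simp: tangent_equation_def)
  have sm: "open U" "smooth_on U f" using reg by (auto simp: regular_equation_def)
  define \<rho> where "\<rho> = sgn (pd (1, 0, 0) f (x0, 0, z0))"
  have \<rho>: "\<rho> = 1 \<or> \<rho> = -1" using tf(2) by (auto simp: \<rho>_def sgn_real_def)
  have "\<forall>\<^sub>F q in nhds (x0, 0, z0). q \<in> U \<and> 0 < dz (dz f) q"
    by (intro eventually_smooth_pos smooth_on_continuous smooth_on_pd sm p)
  moreover have "\<forall>\<^sub>F q in nhds (x0, 0, z0). q \<in> U \<and> 0 < \<rho> * pd (1, 0, 0) f q"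
  proof (rule eventually_smooth_pos[OF sm(1) _ p(1)])
    show "continuous_on U (\<lambda>q. \<rho> * pd (1, 0, 0) f q)"
      by (intro continuous_on_mult continuous_on_const smooth_on_continuous smooth_on_pd sm)
    show "0 < \<rho> * pd (1, 0, 0) f (x0, 0, z0)" using tf(2) by (auto simp: \<rho>_def sgn_real_def)
  qed
  ultimately have "\<forall>\<^sub>F q in nhds (x0, 0, z0). q \<in> U \<and> 0 < dz (dz f) q \<and> 0 < \<rho> * pd (1, 0, 0) f q"
    by eventually_elim auto
  then obtain d where d: "0 < d" "\<And>r s t. \<bar>r - x0\<bar> < d \<Longrightarrow> \<bar>s - 0\<bar> < d \<Longrightarrow> \<bar>t - z0\<bar> < d \<Longrightarrow>
      (r, s, t) \<in> U \<and> 0 < dz (dz f) (r, s, t) \<and> 0 < \<rho> * pd (1, 0, 0) f (r, s, t)"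
    by (rule eventually_nhds_triple_box) blast
  obtain d' where d': "0 < d'" "\<And>x z. \<bar>x - x0\<bar> < d' \<Longrightarrow> \<bar>z - z0\<bar> < d' \<Longrightarrow> z \<in> sec S (x, 0) \<longleftrightarrow> (x, z) \<in> C"
    using eventually_C_iff[OF C] by (elim eventually_nhds_Pair_box) auto
  define a where "a = min d d'"
  have U: "(x, 0, z) \<in> U \<and> 0 < dz (dz f) (x, 0, z) \<and> 0 < \<rho> * pd (1, 0, 0) f (x, 0, z)"
    if "\<bar>x - x0\<bar> < a" "\<bar>z - z0\<bar> < a" for x z
    using that d(1) by (intro d(2)) (auto simp: a_def)
  have xder: "((\<lambda>x. f (x, 0, z)) has_real_derivative pd (1, 0, 0) f (x, 0, z)) (at x)"
    if "\<bar>x - x0\<bar> < a" "\<bar>z - z0\<bar> < a" for x z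
    using smooth_on_line_deriv[OF sm(2), of "(0, 0, z)" x "(1, 0, 0)"] U[OF that] by simp
  show thesis
  proof (rule that[of a \<rho> "\<lambda>x z. f (x, 0, z)"])
    show "0 < a" using d(1) d'(1) by (simp add: a_def)
    show "\<rho> = 1 \<or> \<rho> = -1" by (rule \<rho>)
    show "f (x0, 0, z0) = 0" by (rule p)
    fix x z
    show mem: "z \<in> sec S (x, 0) \<longleftrightarrow> f (x, 0, z) = 0" if "\<bar>x - x0\<bar> < a" "\<bar>z - z0\<bar> < a"
      using reg U[OF that] unfolding regular_equation_def sec_def by auto
    show "(x, z) \<in> C \<longleftrightarrow> f (x, 0, z) = 0" if "\<bar>x - x0\<bar> < a" "\<bar>z - z0\<bar> < a"
      using mem[OF that] d'(2)[of x z] that by (simp add: a_def)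
    show "isCont (\<lambda>x. f (x, 0, z)) x \<and> isCont (\<lambda>z. f (x, 0, z)) z" if "\<bar>x - x0\<bar> < a" "\<bar>z - z0\<bar> < a"
      using DERIV_isCont[OF xder[OF that]] DERIV_isCont[OF smooth_on_fiber_deriv[OF sm(2), of x 0 z]] U[OF that] by blast
    show "\<rho> * f (x, 0, z) < \<rho> * f (x', 0, z)" if "\<bar>x - x0\<bar> < a" "\<bar>x' - x0\<bar> < a" "\<bar>z - z0\<bar> < a" "x < x'" for x'
    proof (rule deriv_pos_less[OF that(4), of "\<lambda>x. \<rho> * f (x, 0, z)" "\<lambda>x. \<rho> * pd (1, 0, 0) f (x, 0, z)"])
      fix t assume "x \<le> t" "t \<le> x'"
      then have t: "\<bar>t - x0\<bar> < a" using that by auto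
      show "((\<lambda>x. \<rho> * f (x, 0, z)) has_real_derivative \<rho> * pd (1, 0, 0) f (t, 0, z)) (at t)"
        by (intro DERIV_cmult xder t that)
      show "0 < \<rho> * pd (1, 0, 0) f (t, 0, z)" using U[OF t that(3)] by simp
    qed
    show "0 < f (x0, 0, z)" if "\<bar>z - z0\<bar> < a" "z \<noteq> z0"
    proof (rule fiber_pos[OF reg p(1,2) _ p(3,4) _ that])
      show "\<forall>\<zeta>. \<bar>\<zeta> - z0\<bar> < a \<longrightarrow> (x0, 0, \<zeta>) \<in> U \<and> 0 < dz (dz f) (x0, 0, \<zeta>)"
        using U[of x0] \<open>0 < a\<close> by simp
    qed simp
  qed
qed

text \<open>The fiber over \<open>x\<close> meets \<open>C\<close> twice near the fold on the side \<open>\<rho> (x - x0) < 0\<close>. The region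
  \<open>0 < g\<close> of \<open>fold_box\<close> contains the vertical line through the fold; \<open>inn\<close> tells whether it
  lies in \<open>D\<close>, and the fold is an extremum of \<open>x\<close> on \<open>D\<close> if it does not.\<close>

lemma fold_geometry:
  assumes C: "(x0, z0) \<in> C" and ncr: "\<not> crossing (sec S) (x0, 0) z0"
  obtains \<rho> :: real and inn :: bool where "\<rho> = 1 \<or> \<rho> = -1"
    "\<forall>\<^sub>F e in at_right 0. \<forall>\<^sub>F x in nhds x0. card (sec S (x, 0) \<inter> ball z0 e) = 2 \<longleftrightarrow> \<rho> * (x - x0) < 0"
    "\<forall>\<^sub>F q in nhds (x0, z0). q \<in> C \<longrightarrow> \<rho> * (fst q - x0) \<le> 0"
    "\<forall>\<^sub>F \<zeta> in at z0. (x0, \<zeta>) \<in> D \<longleftrightarrow> inn"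
    "(x0, z0) \<in> local_maxima D pz \<longleftrightarrow> \<rho> = 1 \<and> \<not> inn"
    "(x0, z0) \<in> local_minima D pz \<longleftrightarrow> \<rho> = -1 \<and> \<not> inn"
proof -
  obtain g a \<rho> where a: "0 < a" and \<rho>: "\<rho> = 1 \<or> \<rho> = (-1::real)"
    and sec: "\<And>x z. \<bar>x - x0\<bar> < a \<Longrightarrow> \<bar>z - z0\<bar> < a \<Longrightarrow> z \<in> sec S (x, 0) \<longleftrightarrow> g x z = 0"
    and CC: "\<And>x z. \<bar>x - x0\<bar> < a \<Longrightarrow> \<bar>z - z0\<bar> < a \<Longrightarrow> (x, z) \<in> C \<longleftrightarrow> g x z = 0"
    and mono: "\<And>x x' z. \<bar>x - x0\<bar> < a \<Longrightarrow> \<bar>x' - x0\<bar> < a \<Longrightarrow> \<bar>z - z0\<bar> < a \<Longrightarrow> x < x' \<Longrightarrow> \<rho> * g x z < \<rho> * g x' z"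
    and pos: "\<And>z. \<bar>z - z0\<bar> < a \<Longrightarrow> z \<noteq> z0 \<Longrightarrow> 0 < g x0 z" and zero: "g x0 z0 = 0"
    and cont: "\<And>x z. \<bar>x - x0\<bar> < a \<Longrightarrow> \<bar>z - z0\<bar> < a \<Longrightarrow> isCont (\<lambda>x. g x z) x \<and> isCont (g x) z"
    by (rule fold_box[OF C ncr]) (rule that)
  have less: "g x z < g x' z" if "\<bar>x - x0\<bar> < a" "\<bar>x' - x0\<bar> < a" "\<bar>z - z0\<bar> < a" "0 < \<rho> * (x' - x)" for x x' z
    using mono[of x x' z] mono[of x' x z] that \<rho> by auto
  have nonneg: "0 \<le> g x0 z" if "\<bar>z - z0\<bar> < a" for z
    using pos[OF that] zero by (cases "z = z0") auto
  have out: "0 < g x z" if "\<bar>x - x0\<bar> < a" "\<bar>z - z0\<bar> < a" "0 < \<rho> * (x - x0)" for x z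
    using less[of x0 x z] nonneg[of z] that a by simp
  \<comment> \<open>Where \<open>\<rho> * (x - x0) < 0\<close>, the value at \<open>z0\<close> is
    negative between positive ends, and the fold chart sharpens at least two points to exactly two.
    Elsewhere \<open>g\<close> is positive except at the fold itself.\<close>
  have count: "\<forall>\<^sub>F x in nhds x0. card (sec S (x, 0) \<inter> ball z0 e) = 2 \<longleftrightarrow> \<rho> * (x - x0) < 0"
    if e: "0 < e" "e < a" and fc: "\<forall>\<^sub>F v in upper (x0, 0). fold_chart (sec S) z0 e v" for e
  proof -
    have near: "\<forall>\<^sub>F x in nhds x0. \<bar>x - x0\<bar> < a"
      using a unfolding eventually_nhds_metric by (intro exI[of _ a]) (auto simp: dist_real_def)
    have ends: "\<forall>\<^sub>F x in nhds x0. 0 < g x z" if "\<bar>z - z0\<bar> < a" "z \<noteq> z0" for z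
    proof -
      have "isCont (\<lambda>x. g x z) x0" using cont[of x0 z] that a by simp
      then have "((\<lambda>x. g x z) \<longlongrightarrow> g x0 z) (nhds x0)"
        using tendsto_at_iff_tendsto_nhds[of "\<lambda>x. g x z" x0] by (simp add: isCont_def)
      from order_tendstoD(1)[OF this pos[OF that]] show ?thesis .
    qed
    have "\<forall>\<^sub>F x in nhds x0. 0 < g x (z0 - e)" "\<forall>\<^sub>F x in nhds x0. 0 < g x (z0 + e)"
      using e by (auto intro: ends)
    with near eventually_upper_line[OF fc] show ?thesis
    proof eventually_elim
      case (elim x)
      have sb: "\<zeta> \<in> sec S (x, 0) \<inter> ball z0 e \<longleftrightarrow> \<bar>\<zeta> - z0\<bar> < e \<and> g x \<zeta> = 0" for \<zeta>
        using sec[OF elim(1), of \<zeta>] e by (auto simp: dist_real_def abs_minus_commute)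
      show ?case
      proof (cases "\<rho> * (x - x0) < 0")
        case True
        then have "g x z0 < g x0 z0" using elim(1) a by (intro less) (auto simp: algebra_simps)
        then have neg: "g x z0 < 0" using zero by simp
        have c: "isCont (g x) z" if "\<bar>z - z0\<bar> \<le> e" for z using cont[OF elim(1), of z] that e by simp
        obtain \<zeta>1 where z1: "z0 - e \<le> \<zeta>1" "\<zeta>1 \<le> z0" "g x \<zeta>1 = 0"
          using IVT2[of "g x" z0 0 "z0 - e"] elim neg e c by force
        obtain \<zeta>2 where z2: "z0 \<le> \<zeta>2" "\<zeta>2 \<le> z0 + e" "g x \<zeta>2 = 0"
          using IVT[of "g x" z0 0 "z0 + e"] elim neg e c by force
        have "\<zeta>1 \<noteq> z0" "\<zeta>1 \<noteq> z0 - e" "\<zeta>2 \<noteq> z0" "\<zeta>2 \<noteq> z0 + e" using z1 z2 neg elim by auto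
        then have "\<zeta>1 \<in> sec S (x, 0) \<inter> ball z0 e" "\<zeta>2 \<in> sec S (x, 0) \<inter> ball z0 e" "\<zeta>1 \<noteq> \<zeta>2"
          unfolding sb using z1 z2 by auto
        with elim(2) have "card (sec S (x, 0) \<inter> ball z0 e) = 2"
          unfolding fold_chart_def by (metis card_2_iff empty_iff singletonD)
        with True show ?thesis by simp
      next
        case False
        have "sec S (x, 0) \<inter> ball z0 e \<subseteq> {z0}"
        proof
          fix \<zeta> assume "\<zeta> \<in> sec S (x, 0) \<inter> ball z0 e"
          then have \<zeta>: "\<bar>\<zeta> - z0\<bar> < e" "g x \<zeta> = 0" unfolding sb by auto
          have "\<not> 0 < \<rho> * (x - x0)" using out[OF elim(1), of \<zeta>] \<zeta> e by auto
          with False have "x = x0" using \<rho> by auto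
          then show "\<zeta> \<in> {z0}" using pos[of \<zeta>] \<zeta> e by auto
        qed
        then have "card (sec S (x, 0) \<inter> ball z0 e) \<le> 1"
          by (metis card_mono card.empty card_insert_disjoint empty_iff finite.emptyI finite.insertI One_nat_def)
        with False show ?thesis by simp
      qed
    qed
  qed
  obtain U f where "tangent_equation S U f (x0, 0, z0)"
    using boundary_structure(2)[OF C] ncr by blast
  from tangent_not_crossing(2)[OF this]
  have "\<forall>\<^sub>F e in at_right 0. \<forall>\<^sub>F v in upper (x0, 0). fold_chart (sec S) z0 e v" by simp
  moreover have "\<forall>\<^sub>F e in at_right 0. e < a" "\<forall>\<^sub>F e in at_right 0. (0::real) < e"
    using a eventually_at_right_less[of 0] by (auto simp: eventually_at_right_field)
  ultimately have count': "\<forall>\<^sub>F e in at_right 0. \<forall>\<^sub>F x in nhds x0. card (sec S (x, 0) \<inter> ball z0 e) = 2 \<longleftrightarrow> \<rho> * (x - x0) < 0"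
    by eventually_elim (rule count)
  \<comment> \<open>The abscissa of a reference point on the side of the fold that \<open>C\<close>
    avoids.\<close>
  define x1 where "x1 = x0 + \<rho> * (a / 2)"
  have x1: "\<bar>x1 - x0\<bar> < a" "0 < \<rho> * (x1 - x0)" using a \<rho> by (auto simp: x1_def)
  \<comment> \<open>A point with \<open>0 < g\<close> is joined to the reference point by a
    horizontal and a vertical segment. On both \<open>g\<close> stays positive, by monotonicity in x
    or because the empty side has been reached, so they miss \<open>C\<close>.\<close>
  have side: "(x, z) \<in> D \<longleftrightarrow> (x1, z0) \<in> D" if b: "\<bar>x - x0\<bar> < a" "\<bar>z - z0\<bar> < a" "0 < g x z" for x z
  proof -
    have "(x, z) \<in> D \<longleftrightarrow> (x1, z) \<in> D"
    proof (rule same_side[of "{min x x1..max x x1} \<times> {z}"])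
      show "connected ({min x x1..max x x1} \<times> {z})" by (intro convex_connected convex_Times) auto
      have "(x', z) \<notin> C" if x': "min x x1 \<le> x'" "x' \<le> max x x1" for x'
      proof -
        have ba: "\<bar>x' - x0\<bar> < a" using x' b(1) x1(1) by auto
        have "0 < g x' z"
        proof (cases "0 < \<rho> * (x' - x0)")
          case True then show ?thesis by (intro out ba b)
        next
          case False
          then have "x' = x \<or> 0 < \<rho> * (x' - x)" using x' x1(2) \<rho> by (auto simp: min_def max_def split: if_splits)
          then show ?thesis using less[OF b(1) ba b(2)] b(3) by auto
        qed
        then show ?thesis using CC[OF ba b(2)] by simp
      qed
      then show "{min x x1..max x x1} \<times> {z} \<inter> C = {}" by auto
    qed auto
    also have "(x1, z) \<in> D \<longleftrightarrow> (x1, z0) \<in> D"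
    proof (rule same_side[of "{x1} \<times> {z0 - a<..<z0 + a}"])
      show "connected ({x1} \<times> {z0 - a<..<z0 + a})" by (intro convex_connected convex_Times) auto
      have "(x1, \<zeta>) \<notin> C" if "\<bar>\<zeta> - z0\<bar> < a" for \<zeta>
        using CC[OF x1(1) that] out[OF x1(1) that x1(2)] by simp
      then show "{x1} \<times> {z0 - a<..<z0 + a} \<inter> C = {}" by (auto simp: abs_less_iff)
    qed (use b a in \<open>auto simp: abs_less_iff\<close>)
    finally show ?thesis .
  qed
  define inn where "inn \<longleftrightarrow> (x1, z0) \<in> D"
  have near: "\<forall>\<^sub>F q in nhds (x0, z0). \<bar>fst q - x0\<bar> < a \<and> \<bar>snd q - z0\<bar> < a"
    by (rule eventually_nhds_Pair_boxI[OF a]) auto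
  have onC: "\<forall>\<^sub>F q in nhds (x0, z0). q \<in> C \<longrightarrow> \<rho> * (fst q - x0) \<le> 0"
    using near
  proof eventually_elim
    case (elim q)
    show ?case using CC[of "fst q" "snd q"] out[of "fst q" "snd q"] elim by fastforce
  qed
  have vert: "\<forall>\<^sub>F \<zeta> in at z0. (x0, \<zeta>) \<in> D \<longleftrightarrow> inn"
    unfolding eventually_at inn_def using side[of x0] pos a by (intro exI[of _ a]) (auto simp: dist_real_def)
  have pD: "(x0, z0) \<in> D" using C C_D by blast
  have ext: "\<forall>\<^sub>F q in nhds (x0, z0). q \<in> D \<longrightarrow> \<rho> * (fst q - x0) \<le> 0" if "\<not> inn"
    using near
  proof eventually_elim
    case (elim q)
    show ?case
      using side[of "fst q" "snd q"] out[of "fst q" "snd q"] elim that by (fastforce simp: inn_def)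
  qed
  \<comment> \<open>\<open>D\<close> is the closure of its interior, so near the fold it does not
    fit into a vertical line, and the fold is not a maximum and a minimum at once.\<close>
  have not_both: "\<not> (\<forall>\<^sub>F q in nhds (x0, z0). q \<in> D \<longrightarrow> fst q = x0)"
  proof
    assume "\<forall>\<^sub>F q in nhds (x0, z0). q \<in> D \<longrightarrow> fst q = x0"
    then obtain W where W: "open W" "(x0, z0) \<in> W" "\<And>q. q \<in> W \<Longrightarrow> q \<in> D \<Longrightarrow> fst q = x0"
      unfolding eventually_nhds by blast
    obtain q where q: "q \<in> W \<inter> interior D" using interior_near[OF pD W(1,2)] by blast
    moreover have "open (W \<inter> interior D)" using W(1) by (intro open_Int open_interior)
    ultimately obtain t where t: "0 < t" "(fst q + t, snd q) \<in> W \<inter> interior D"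
      using open_shift by blast
    have "fst q = x0" using q W(3)[of q] interior_subset by blast
    moreover have "fst q + t = x0" using t W(3)[of "(fst q + t, snd q)"] interior_subset by fastforce
    ultimately show False using t(1) by simp
  qed
  \<comment> \<open>If the region \<open>0 < g\<close> lies in \<open>D\<close>, points slightly
    above the fold and on both sides of its vertical line belong to \<open>D\<close>, which rules
    out an extremum.\<close>
  have inside: "\<exists>q q'. q \<in> W \<inter> D \<and> fst q < x0 \<and> q' \<in> W \<inter> D \<and> x0 < fst q'" if "inn" "open W" "(x0, z0) \<in> W" for W
  proof -
    have "\<forall>\<^sub>F q in nhds (x0, z0). q \<in> W" using that by (intro eventually_nhds_in_open)
    then obtain d where d: "0 < d" "\<And>s t. \<bar>s - x0\<bar> < d \<Longrightarrow> \<bar>t - z0\<bar> < d \<Longrightarrow> (s, t) \<in> W"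
      by (rule eventually_nhds_Pair_box) blast
    define \<zeta> where "\<zeta> = z0 + min a d / 2"
    have \<zeta>: "\<bar>\<zeta> - z0\<bar> < a" "\<bar>\<zeta> - z0\<bar> < d" "\<zeta> \<noteq> z0" using a d(1) by (auto simp: \<zeta>_def)
    have "isCont (\<lambda>x. g x \<zeta>) x0" using cont[of x0 \<zeta>] \<zeta> a by simp
    then have "((\<lambda>x. g x \<zeta>) \<longlongrightarrow> g x0 \<zeta>) (nhds x0)"
      using tendsto_at_iff_tendsto_nhds[of "\<lambda>x. g x \<zeta>" x0] by (simp add: isCont_def)
    from order_tendstoD(1)[OF this pos[OF \<zeta>(1,3)]] obtain b where
      b: "0 < b" "\<And>x. \<bar>x - x0\<bar> < b \<Longrightarrow> 0 < g x \<zeta>"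
      unfolding eventually_nhds_metric by (auto simp: dist_real_def)
    define t where "t = min b (min a d) / 2"
    have t: "0 < t" "t < b" "t < a" "t < d" using a b(1) d(1) by (auto simp: t_def)
    have "(x0 + t, \<zeta>) \<in> D" "(x0 - t, \<zeta>) \<in> D"
      using side[of "x0 + t" \<zeta>] side[of "x0 - t" \<zeta>] b(2) t \<zeta> \<open>inn\<close> by (auto simp: inn_def)
    moreover have "(x0 + t, \<zeta>) \<in> W" "(x0 - t, \<zeta>) \<in> W" using t \<zeta> by (auto intro!: d(2))
    ultimately show ?thesis using t(1) by (intro exI[of _ "(x0 - t, \<zeta>)"] exI[of _ "(x0 + t, \<zeta>)"]) auto
  qed
  have max: "(x0, z0) \<in> local_maxima D pz \<longleftrightarrow> \<rho> = 1 \<and> \<not> inn"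
  proof (cases inn)
    case True
    have "(x0, z0) \<notin> local_maxima D pz"
      using inside[OF True] unfolding local_maxima_iff eventually_nhds pz_eq by fastforce
    with True show ?thesis by simp
  next
    case False
    show ?thesis
    proof (cases "\<rho> = 1")
      case True
      with ext[OF False] pD False show ?thesis by (simp add: local_maxima_iff pz_eq)
    next
      case neg: False
      then have "\<rho> = -1" using \<rho> by simp
      have "(x0, z0) \<notin> local_maxima D pz"
      proof
        assume "(x0, z0) \<in> local_maxima D pz"
        then have "\<forall>\<^sub>F q in nhds (x0, z0). q \<in> D \<longrightarrow> fst q \<le> x0" by (simp add: local_maxima_iff pz_eq)
        with ext[OF False] have "\<forall>\<^sub>F q in nhds (x0, z0). q \<in> D \<longrightarrow> fst q = x0"
          by eventually_elim (use \<open>\<rho> = -1\<close> in auto)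
        with not_both show False ..
      qed
      with neg show ?thesis by simp
    qed
  qed
  have min: "(x0, z0) \<in> local_minima D pz \<longleftrightarrow> \<rho> = -1 \<and> \<not> inn"
  proof (cases inn)
    case True
    have "(x0, z0) \<notin> local_minima D pz"
      using inside[OF True] unfolding local_minima_iff eventually_nhds pz_eq by fastforce
    with True show ?thesis by simp
  next
    case False
    show ?thesis
    proof (cases "\<rho> = -1")
      case True
      with ext[OF False] pD False show ?thesis by (simp add: local_minima_iff pz_eq)
    next
      case neg: False
      then have "\<rho> = 1" using \<rho> by simp
      have "(x0, z0) \<notin> local_minima D pz"
      proof
        assume "(x0, z0) \<in> local_minima D pz"
        then have "\<forall>\<^sub>F q in nhds (x0, z0). q \<in> D \<longrightarrow> x0 \<le> fst q" by (simp add: local_minima_iff pz_eq)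
        with ext[OF False] have "\<forall>\<^sub>F q in nhds (x0, z0). q \<in> D \<longrightarrow> fst q = x0"
          by eventually_elim (use \<open>\<rho> = 1\<close> in auto)
        with not_both show False ..
      qed
      with neg show ?thesis by simp
    qed
  qed
  show thesis by (rule that[OF \<rho> count' onC vert max min])
qed

section \<open>Crossings of \<open>C\<close>, and membership in \<open>D\<close> by parity\<close>

text \<open>Two radii are used: the single point of \<open>C\<close> over each nearby
  \<open>x\<close> is confined to the inner one, which leaves the heights at distance between
  \<open>e / 2\<close> and \<open>e\<close> from \<open>z0\<close> free of \<open>C\<close>.\<close>

lemma crossing_box:
  assumes C: "(x0, z0) \<in> C" and cr: "crossing (sec S) (x0, 0) z0" and r: "0 < r"
  obtains d e where "0 < d" "0 < e" "e < r"
    "\<And>x. \<bar>x - x0\<bar> < d \<Longrightarrow> \<exists>\<zeta>. \<bar>\<zeta> - z0\<bar> < e / 2 \<and> (\<forall>z. \<bar>z - z0\<bar> < e \<longrightarrow> ((x, z) \<in> C \<longleftrightarrow> z = \<zeta>))"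
proof -
  obtain a where a: "0 < a" "\<And>x z. \<bar>x - x0\<bar> < a \<Longrightarrow> \<bar>z - z0\<bar> < a \<Longrightarrow> z \<in> sec S (x, 0) \<longleftrightarrow> (x, z) \<in> C"
    using eventually_C_iff[OF C] by (elim eventually_nhds_Pair_box) auto
  obtain e1 where e1: "0 < e1" "\<And>e. 0 < e \<Longrightarrow> e < e1 \<Longrightarrow> \<forall>\<^sub>F v in upper (x0, 0). \<exists>\<zeta>. sec S v \<inter> ball z0 e = {\<zeta>}"
    using cr unfolding crossing_def eventually_at_right_field by auto
  define e where "e = min (min a r) e1 / 2"
  have e: "0 < e" "e < a" "e < r" "e < e1" using a(1) r e1(1) by (auto simp: e_def)
  have "\<forall>\<^sub>F x in nhds x0. \<exists>\<zeta>. sec S (x, 0) \<inter> ball z0 e = {\<zeta>}"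
    "\<forall>\<^sub>F x in nhds x0. \<exists>\<zeta>. sec S (x, 0) \<inter> ball z0 (e / 2) = {\<zeta>}"
    using e by (auto intro!: eventually_upper_line e1(2))
  then have "\<forall>\<^sub>F x in nhds x0. (\<exists>\<zeta>. sec S (x, 0) \<inter> ball z0 e = {\<zeta>}) \<and> (\<exists>\<zeta>. sec S (x, 0) \<inter> ball z0 (e / 2) = {\<zeta>})"
    by (rule eventually_conj)
  then obtain d where d: "0 < d" "\<And>x. \<bar>x - x0\<bar> < d \<Longrightarrow>
      (\<exists>\<zeta>. sec S (x, 0) \<inter> ball z0 e = {\<zeta>}) \<and> (\<exists>\<zeta>. sec S (x, 0) \<inter> ball z0 (e / 2) = {\<zeta>})"
    unfolding eventually_nhds_metric dist_real_def by blast
  show thesis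
  proof (rule that[of "min d a" e])
    show "0 < min d a" "0 < e" "e < r" using d(1) a(1) e by auto
    fix x assume x: "\<bar>x - x0\<bar> < min d a"
    then obtain \<zeta> \<zeta>' where \<zeta>: "sec S (x, 0) \<inter> ball z0 e = {\<zeta>}" "sec S (x, 0) \<inter> ball z0 (e / 2) = {\<zeta>'}"
      using d(2)[of x] by auto
    have "\<zeta>' \<in> sec S (x, 0) \<inter> ball z0 (e / 2)" using \<zeta>(2) by blast
    then have z': "\<zeta>' \<in> sec S (x, 0)" "\<bar>\<zeta>' - z0\<bar> < e / 2"
      unfolding ball_real Int_iff greaterThanLessThan_iff by (blast, linarith)
    have eq: "z \<in> sec S (x, 0) \<longleftrightarrow> z = \<zeta>" if "\<bar>z - z0\<bar> < e" for z
    proof -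
      have "z \<in> ball z0 e" using that by (auto simp: dist_real_def)
      then show ?thesis using \<zeta>(1) by blast
    qed
    have "\<zeta>' = \<zeta>" using eq[of \<zeta>'] z' e(1) by auto
    then have "\<bar>\<zeta> - z0\<bar> < e / 2" using z' by simp
    moreover have "(x, z) \<in> C \<longleftrightarrow> z = \<zeta>" if "\<bar>z - z0\<bar> < e" for z
      using eq[OF that] a(2)[of x z] x that e by simp
    ultimately show "\<exists>\<zeta>. \<bar>\<zeta> - z0\<bar> < e / 2 \<and> (\<forall>z. \<bar>z - z0\<bar> < e \<longrightarrow> ((x, z) \<in> C \<longleftrightarrow> z = \<zeta>))" by blast
  qed
qed

text \<open>The curve itself, which is part of \<open>D\<close>, has points close to the crossing
  over abscissae on both sides of \<open>x0\<close>.\<close>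

lemma crossing_not_extremal:
  assumes C: "(x0, z0) \<in> C" and cr: "crossing (sec S) (x0, 0) z0"
  shows "(x0, z0) \<notin> local_maxima D pz" "(x0, z0) \<notin> local_minima D pz"
proof -
  have pts: "\<exists>q q'. q \<in> W \<inter> D \<and> fst q < x0 \<and> q' \<in> W \<inter> D \<and> x0 < fst q'" if W: "open W" "(x0, z0) \<in> W" for W
  proof -
    have "\<forall>\<^sub>F q in nhds (x0, z0). q \<in> W" using W by (intro eventually_nhds_in_open)
    then obtain r where r: "0 < r" "\<And>s t. \<bar>s - x0\<bar> < r \<Longrightarrow> \<bar>t - z0\<bar> < r \<Longrightarrow> (s, t) \<in> W"
      by (rule eventually_nhds_Pair_box) blast
    obtain d e where de: "0 < d" "0 < e" "e < r"
      "\<And>x. \<bar>x - x0\<bar> < d \<Longrightarrow> \<exists>\<zeta>. \<bar>\<zeta> - z0\<bar> < e / 2 \<and> (\<forall>z. \<bar>z - z0\<bar> < e \<longrightarrow> ((x, z) \<in> C \<longleftrightarrow> z = \<zeta>))"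
      by (rule crossing_box[OF C cr r(1)]) blast
    have on: "\<exists>z. (x, z) \<in> W \<inter> D" if x: "\<bar>x - x0\<bar> < d" "\<bar>x - x0\<bar> < r" for x
    proof -
      obtain \<zeta> where z: "\<bar>\<zeta> - z0\<bar> < e / 2" "\<And>z. \<bar>z - z0\<bar> < e \<Longrightarrow> (x, z) \<in> C \<longleftrightarrow> z = \<zeta>"
        using de(4)[OF x(1)] by blast
      have "(x, \<zeta>) \<in> C" using z(2)[of \<zeta>] z(1) de(2) by simp
      then show ?thesis using r(2)[of x \<zeta>] z(1) x de C_D by (intro exI[of _ \<zeta>]) auto
    qed
    define t where "t = min d r / 2"
    have t: "0 < t" "t < d" "t < r" using de(1) r(1) by (auto simp: t_def)
    obtain z z' where "(x0 - t, z) \<in> W \<inter> D" "(x0 + t, z') \<in> W \<inter> D"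
      using on[of "x0 - t"] on[of "x0 + t"] t by auto
    then show ?thesis using t(1) by (intro exI[of _ "(x0 - t, z)"] exI[of _ "(x0 + t, z')"]) auto
  qed
  show "(x0, z0) \<notin> local_maxima D pz" "(x0, z0) \<notin> local_minima D pz"
    using pts unfolding local_maxima_iff local_minima_iff eventually_nhds pz_eq by fastforce+
qed

text \<open>In the box the points above \<open>C\<close> agree on membership in \<open>D\<close>,
  and so do the points below. If both parts belonged to \<open>D\<close>, the whole box would, and
  the point of \<open>C\<close> would be interior; if neither did, \<open>D\<close> would have no
  interior points near it.\<close>

lemma crossing_flip:
  assumes C: "(x0, z0) \<in> C" and cr: "crossing (sec S) (x0, 0) z0"
  shows "\<exists>e>0. \<forall>\<zeta> \<zeta>'. z0 < \<zeta> \<and> \<zeta> < z0 + e \<and> z0 - e < \<zeta>' \<and> \<zeta>' < z0 \<longrightarrow> ((x0, \<zeta>) \<in> D \<longleftrightarrow> (x0, \<zeta>') \<notin> D)"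
proof -
  obtain d e where d: "0 < d" and e: "0 < e" "e < (1::real)" and
    box: "\<And>x. \<bar>x - x0\<bar> < d \<Longrightarrow> \<exists>\<zeta>. \<bar>\<zeta> - z0\<bar> < e / 2 \<and> (\<forall>z. \<bar>z - z0\<bar> < e \<longrightarrow> ((x, z) \<in> C \<longleftrightarrow> z = \<zeta>))"
    using crossing_box[OF C cr zero_less_one] by blast
  define c where "c = (\<lambda>x. SOME \<zeta>. \<bar>\<zeta> - z0\<bar> < e / 2 \<and> (\<forall>z. \<bar>z - z0\<bar> < e \<longrightarrow> ((x, z) \<in> C \<longleftrightarrow> z = \<zeta>)))"
  have c: "\<bar>c x - z0\<bar> < e / 2" "\<And>z. \<bar>z - z0\<bar> < e \<Longrightarrow> (x, z) \<in> C \<longleftrightarrow> z = c x" if "\<bar>x - x0\<bar> < d" for x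
    using someI_ex[OF box[OF that]] unfolding c_def by blast+
  have cx0: "c x0 = z0" using c(2)[of x0 z0] C d e by auto
  have vertical: "(x, z) \<in> D \<longleftrightarrow> (x, z') \<in> D"
    if "\<bar>x - x0\<bar> < d" "\<bar>z - z0\<bar> < e" "\<bar>z' - z0\<bar> < e" "(c x < z \<and> c x < z') \<or> (z < c x \<and> z' < c x)" for x z z'
  proof (rule same_side[of "{x} \<times> {min z z'..max z z'}"])
    show "connected ({x} \<times> {min z z'..max z z'})" by (intro convex_connected convex_Times) auto
    have "(x, w) \<notin> C" if w: "min z z' \<le> w" "w \<le> max z z'" for w
    proof -
      have "\<bar>w - z0\<bar> < e" "w \<noteq> c x"
        using \<open>\<bar>z - z0\<bar> < e\<close> \<open>\<bar>z' - z0\<bar> < e\<close> \<open>(c x < z \<and> c x < z') \<or> (z < c x \<and> z' < c x)\<close> w by auto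
      then show ?thesis using c(2)[OF \<open>\<bar>x - x0\<bar> < d\<close>] by simp
    qed
    then show "{x} \<times> {min z z'..max z z'} \<inter> C = {}" by auto
  qed auto
  have horizontal: "(x, h) \<in> D \<longleftrightarrow> (x0, h) \<in> D" if "\<bar>x - x0\<bar> < d" "\<bar>h - z0\<bar> < e" "e / 2 \<le> \<bar>h - z0\<bar>" for x h
  proof (rule same_side[of "{x0 - d<..<x0 + d} \<times> {h}"])
    show "connected ({x0 - d<..<x0 + d} \<times> {h})" by (intro convex_connected convex_Times) auto
    have "(w, h) \<notin> C" if w: "\<bar>w - x0\<bar> < d" for w
      using c[OF w] \<open>\<bar>h - z0\<bar> < e\<close> \<open>e / 2 \<le> \<bar>h - z0\<bar>\<close> by fastforce
    then show "{x0 - d<..<x0 + d} \<times> {h} \<inter> C = {}" by (auto simp: abs_less_iff)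
  qed (use that d in \<open>auto simp: abs_less_iff\<close>)
  \<comment> \<open>Three quarters of \<open>e\<close> lies in the range free of \<open>C\<close>,
    so these two levels link the vertical lines over different \<open>x\<close>.\<close>
  define up lo where "up = z0 + 3 * e / 4" and "lo = z0 - 3 * e / 4"
  have ul: "\<bar>up - z0\<bar> < e" "e / 2 \<le> \<bar>up - z0\<bar>" "\<bar>lo - z0\<bar> < e" "e / 2 \<le> \<bar>lo - z0\<bar>"
    using e by (auto simp: up_def lo_def)
  have cul: "c x < up" "lo < c x" if "\<bar>x - x0\<bar> < d" for x
    using c(1)[OF that] e unfolding up_def lo_def by linarith+
  have Up: "(x, z) \<in> D \<longleftrightarrow> (x0, up) \<in> D" if "\<bar>x - x0\<bar> < d" "\<bar>z - z0\<bar> < e" "c x < z" for x z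
    using vertical[OF that(1,2) ul(1)] horizontal[OF that(1) ul(1,2)] cul[OF that(1)] that(3) by blast
  have Lo: "(x, z) \<in> D \<longleftrightarrow> (x0, lo) \<in> D" if "\<bar>x - x0\<bar> < d" "\<bar>z - z0\<bar> < e" "z < c x" for x z
    using vertical[OF that(1,2) ul(3)] horizontal[OF that(1) ul(3,4)] cul[OF that(1)] that(3) by blast
  define B where "B = {x0 - d<..<x0 + d} \<times> {z0 - e<..<z0 + e}"
  have B: "open B" "(x0, z0) \<in> B" using d e by (auto simp: B_def intro: open_Times)
  have Bx: "\<bar>fst q - x0\<bar> < d" "\<bar>snd q - z0\<bar> < e" if "q \<in> B" for q
    using that by (auto simp: B_def abs_less_iff)
  have "\<not> ((x0, up) \<in> D \<and> (x0, lo) \<in> D)"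
  proof
    assume both: "(x0, up) \<in> D \<and> (x0, lo) \<in> D"
    have "B \<subseteq> D"
    proof
      fix q assume q: "q \<in> B"
      show "q \<in> D"
      proof (cases "snd q" "c (fst q)" rule: linorder_cases)
        case equal
        then have "(fst q, snd q) \<in> C" using c(2)[OF Bx(1)[OF q] Bx(2)[OF q]] by blast
        then have "q \<in> C" by (simp only: prod.collapse)
        then show ?thesis using C_D by blast
      qed (use Up[OF Bx[OF q]] Lo[OF Bx[OF q]] both in auto)
    qed
    then have "(x0, z0) \<in> interior D" using B by (meson interiorI)
    then show False using C interior_D by blast
  qed
  moreover have "(x0, up) \<in> D \<or> (x0, lo) \<in> D"
  proof (rule ccontr)
    assume none: "\<not> ((x0, up) \<in> D \<or> (x0, lo) \<in> D)"
    have "(x0, z0) \<in> D" using C C_D by blast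
    then obtain q where q: "q \<in> B" "q \<in> interior D" using interior_near[OF _ B] by blast
    then have "q \<in> D" "q \<notin> C" using interior_D by auto
    then have "(fst q, snd q) \<notin> C" by (simp only: prod.collapse not_False_eq_True)
    then have "snd q \<noteq> c (fst q)" using c(2)[OF Bx(1)[OF q(1)] Bx(2)[OF q(1)]] by blast
    then show False using Up[OF Bx[OF q(1)]] Lo[OF Bx[OF q(1)]] none \<open>q \<in> D\<close>
      by (cases "snd q" "c (fst q)" rule: linorder_cases) auto
  qed
  moreover have "(x0, \<zeta>) \<in> D \<longleftrightarrow> (x0, up) \<in> D" if "z0 < \<zeta>" "\<zeta> < z0 + e" for \<zeta>
    using Up[of x0 \<zeta>] that d cx0 by simp
  moreover have "(x0, \<zeta>) \<in> D \<longleftrightarrow> (x0, lo) \<in> D" if "z0 - e < \<zeta>" "\<zeta> < z0" for \<zeta>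
    using Lo[of x0 \<zeta>] that d cx0 by simp
  ultimately show ?thesis using e(1) by (intro exI[of _ e]) blast
qed

text \<open>A vertical line enters or leaves \<open>D\<close> exactly at its crossings, so \<open>h\<close> is constant along it.\<close>

lemma parity_locally_constant:
  fixes x a :: real
  defines "h \<equiv> (\<lambda>z. (x, z) \<in> D \<longleftrightarrow> even (card (above (x, 0) z)))"
  shows "\<exists>T. open T \<and> a \<in> T \<and> (\<forall>z\<in>T. \<forall>z'\<in>T. z \<notin> sec S (x, 0) \<and> z' \<notin> sec S (x, 0) \<longrightarrow> h z = h z')"
proof -
  define A where "A = sec S (x, 0)"
  have fin: "finite A" unfolding A_def by (rule finite_sec) simp
  have "open (- (A - {a}))" using fin by (intro open_Compl finite_imp_closed) auto
  then have "\<forall>\<^sub>F z in nhds a. z \<in> - (A - {a})" by (rule eventually_nhds_in_open) simp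
  then obtain e0 where e0: "0 < e0" "\<And>z. \<bar>z - a\<bar> < e0 \<Longrightarrow> z \<in> A \<Longrightarrow> z = a"
    unfolding eventually_nhds_metric dist_real_def by blast
  have seg: "(x, z) \<in> D \<longleftrightarrow> (x, z') \<in> D" if "{min z z'..max z z'} \<inter> A = {}" for z z'
  proof (rule same_side[of "{x} \<times> {min z z'..max z z'}"])
    show "connected ({x} \<times> {min z z'..max z z'})" by (intro convex_connected convex_Times) auto
    show "{x} \<times> {min z z'..max z z'} \<inter> C = {}" using that mem_C_sec by (auto simp: A_def)
  qed auto
  have abv: "above (x, 0) z = above (x, 0) z'" if "z \<le> z'" "{z<..z'} \<inter> A = {}" for z z'
    using that by (fastforce simp: above_def A_def)
  have half: "h z = h z'" if "z \<le> z'" "{z..z'} \<inter> A = {}" for z z'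
  proof -
    have "{z<..z'} \<subseteq> {z..z'}" by auto
    then have "{z<..z'} \<inter> A = {}" using that(2) by blast
    with seg[of z z'] abv[of z z'] that show ?thesis unfolding h_def by (simp add: min_def max_def)
  qed
  show ?thesis
  proof (cases "a \<in> A")
    case False
    define T where "T = {a - e0<..<a + e0}"
    have none: "{z..z'} \<inter> A = {}" if T: "z \<in> T" "z' \<in> T" for z z'
    proof -
      have "w \<notin> A" if w: "w \<in> {z..z'}" for w
      proof
        assume "w \<in> A"
        moreover have "\<bar>w - a\<bar> < e0" using T w by (auto simp: T_def)
        ultimately show False using e0(2)[of w] False by blast
      qed
      then show ?thesis by blast
    qed
    have "h z = h z'" if "z \<in> T" "z' \<in> T" for z z'
      using half[of z z', OF _ none[OF that]] half[of z' z, OF _ none[OF that(2,1)]]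
      by (metis linear)
    moreover have "open T" "a \<in> T" using e0(1) by (auto simp: T_def)
    ultimately show ?thesis by blast
  next
    case True
    have fin_above: "finite (above (x, 0) z)" for z
      by (rule finite_subset[OF _ fin]) (auto simp: above_def A_def)
    have "\<exists>e>0. e \<le> e0 \<and> (\<forall>z z'. a < z \<and> z < a + e \<and> a - e < z' \<and> z' < a \<longrightarrow> h z = h z')"
    proof (cases "crossing (sec S) (x, 0) a")
      case cr: True
      \<comment> \<open>A point of \<open>S\<close> in the plane y = 0 but off \<open>C\<close> is a
        touching point, hence a fold.\<close>
      have aC: "(x, a) \<in> C"
      proof (rule ccontr)
        assume "(x, a) \<notin> C"
        moreover have "(x, 0, a) \<in> S" using True by (simp add: A_def sec_def)
        ultimately obtain U f where "tangent_equation S U f (x, 0, a)" using touching_tangent by blast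
        from tangent_not_crossing(1)[OF this] cr show False by simp
      qed
      obtain e1 where e1: "0 < e1" "\<And>\<zeta> \<zeta>'. a < \<zeta> \<Longrightarrow> \<zeta> < a + e1 \<Longrightarrow> a - e1 < \<zeta>' \<Longrightarrow> \<zeta>' < a \<Longrightarrow>
          ((x, \<zeta>) \<in> D \<longleftrightarrow> (x, \<zeta>') \<notin> D)" using crossing_flip[OF aC cr] by blast
      have "h z = h z'" if z: "a < z" "z < a + min e0 e1" "a - min e0 e1 < z'" "z' < a" for z z'
      proof -
        \<comment> \<open>Going down through the crossing adds one crossing above and also switches
          membership in \<open>D\<close>, so \<open>h\<close> is unchanged.\<close>
        have "above (x, 0) z' = insert a (above (x, 0) z)"
        proof (intro equalityI subsetI)
          fix w assume w: "w \<in> above (x, 0) z'"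
          then have "w \<in> A" "z' < w" "crossing (sec S) (x, 0) w" by (auto simp: above_def A_def)
          then have "w = a \<or> z < w" using e0(2)[of w] z by fastforce
          then show "w \<in> insert a (above (x, 0) z)" using w by (auto simp: above_def)
        next
          fix w assume "w \<in> insert a (above (x, 0) z)"
          then show "w \<in> above (x, 0) z'" using True cr z by (auto simp: above_def A_def)
        qed
        moreover have "a \<notin> above (x, 0) z" using z by (simp add: above_def)
        ultimately have "card (above (x, 0) z') = Suc (card (above (x, 0) z))" using fin_above by simp
        moreover have "(x, z) \<in> D \<longleftrightarrow> (x, z') \<notin> D" using z by (intro e1(2)) auto
        ultimately show ?thesis unfolding h_def by auto
      qed
      then show ?thesis using e0(1) e1(1) by (intro exI[of _ "min e0 e1"]) auto
    next
      case ncr: False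
      \<comment> \<open>At a fold on \<open>C\<close> membership is the same just above and just
        below; at a touching point off \<open>C\<close> the vertical segment misses
        \<open>C\<close>.\<close>
      have "\<exists>e>0. e \<le> e0 \<and> (\<forall>z z'. a < z \<and> z < a + e \<and> a - e < z' \<and> z' < a \<longrightarrow> ((x, z) \<in> D \<longleftrightarrow> (x, z') \<in> D))"
      proof (cases "(x, a) \<in> C")
        case aC: True
        obtain inn where "\<forall>\<^sub>F \<zeta> in at a. (x, \<zeta>) \<in> D \<longleftrightarrow> inn"
          using fold_geometry[OF aC ncr] by metis
        then obtain e1 where "0 < e1" "\<And>\<zeta>. \<zeta> \<noteq> a \<Longrightarrow> \<bar>\<zeta> - a\<bar> < e1 \<Longrightarrow> (x, \<zeta>) \<in> D \<longleftrightarrow> inn"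
          unfolding eventually_at dist_real_def by blast
        then show ?thesis using e0(1) by (intro exI[of _ "min e0 e1"]) auto
      next
        case nC: False
        have "(x, z) \<in> D \<longleftrightarrow> (x, z') \<in> D" if z: "a < z" "z < a + e0" "a - e0 < z'" "z' < a" for z z'
        proof (rule same_side[of "{x} \<times> {z'..z}"])
          show "connected ({x} \<times> {z'..z})" by (intro convex_connected convex_Times) auto
          have "(x, w) \<notin> C" if "z' \<le> w" "w \<le> z" for w
          proof -
            have "\<bar>w - a\<bar> < e0" using z that by linarith
            then show ?thesis using e0(2)[of w] mem_C_sec[of x w] nC unfolding A_def by blast
          qed
          then show "{x} \<times> {z'..z} \<inter> C = {}" by auto
        qed (use z in auto)
        then show ?thesis using e0(1) by (intro exI[of _ e0]) auto
      qed
      then obtain e where e: "0 < e" "e \<le> e0"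
        "\<And>z z'. a < z \<Longrightarrow> z < a + e \<Longrightarrow> a - e < z' \<Longrightarrow> z' < a \<Longrightarrow> ((x, z) \<in> D \<longleftrightarrow> (x, z') \<in> D)" by blast
      have "h z = h z'" if z: "a < z" "z < a + e" "a - e < z'" "z' < a" for z z'
      proof -
        have "above (x, 0) z' = above (x, 0) z"
        proof (intro equalityI subsetI)
          fix w assume w: "w \<in> above (x, 0) z'"
          then have "w \<in> A" "z' < w" "w \<noteq> a" using ncr by (auto simp: above_def A_def)
          then have "z < w" using e0(2)[of w] e(2) z by fastforce
          then show "w \<in> above (x, 0) z" using w by (auto simp: above_def)
        qed (use z in \<open>auto simp: above_def\<close>)
        with e(3)[OF z] show ?thesis unfolding h_def by simp
      qed
      then show ?thesis using e(1,2) by blast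
    qed
    then obtain e where e: "0 < e" "e \<le> e0" "\<And>z z'. a < z \<Longrightarrow> z < a + e \<Longrightarrow> a - e < z' \<Longrightarrow> z' < a \<Longrightarrow> h z = h z'"
      by blast
    define T where "T = {a - e<..<a + e}"
    have TA: "z = a" if "z \<in> T" "z \<in> A" for z
      using that e0(2)[of z] e(2) by (auto simp: T_def abs_less_iff)
    have key: "h z = h z'" if z: "z \<in> T" "z' \<in> T" "z \<notin> A" "z' \<notin> A" "z \<le> z'" for z z'
    proof (cases "z < a \<and> a < z'")
      case True
      then show ?thesis using e(3)[of z' z] z by (auto simp: T_def)
    next
      case False
      have "z \<noteq> a" "z' \<noteq> a" using z True by auto
      with False have "a \<notin> {z..z'}" by auto
      moreover have "w \<in> T" if "w \<in> {z..z'}" for w using z that by (auto simp: T_def)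
      ultimately have "{z..z'} \<inter> A = {}" using TA by blast
      then show ?thesis by (rule half[OF z(5)])
    qed
    have "h z = h z'" if "z \<in> T" "z' \<in> T" "z \<notin> A" "z' \<notin> A" for z z'
      using key[OF that] key[OF that(2,1,4,3)] by (metis linear)
    moreover have "open T" "a \<in> T" using e(1) by (auto simp: T_def)
    ultimately show ?thesis unfolding A_def by blast
  qed
qed

text \<open>Far above, the point is outside \<open>D\<close> and no crossing lies above it. The
  relation between membership and parity is locally constant off the finite set
  \<open>sec S (x, 0)\<close>, whose complement is dense in the line, so it persists along the whole
  fiber.\<close>

lemma mem_D_iff_odd_above:
  assumes "z \<notin> sec S (x, 0)"
  shows "(x, z) \<in> D \<longleftrightarrow> odd (card (above (x, 0) z))"
proof -
  define h where "h = (\<lambda>z. (x, z) \<in> D \<longleftrightarrow> even (card (above (x, 0) z)))"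
  define P where "P = (\<lambda>z. z \<notin> sec S (x, 0))"
  have fin: "finite (sec S (x, 0))" by (rule finite_sec) simp
  obtain M where M: "\<And>p. p \<in> D \<Longrightarrow> norm p \<le> M" using compact_imp_bounded[OF compact_D] bounded_iff by blast
  obtain N where N: "\<And>\<zeta>. \<zeta> \<in> sec S (x, 0) \<Longrightarrow> norm \<zeta> \<le> N" using finite_imp_bounded[OF fin] bounded_iff by blast
  define b where "b = \<bar>M\<bar> + \<bar>N\<bar> + 1"
  have "norm b \<le> norm (x, b)" by (metis norm_snd_le snd_conv)
  then have "(x, b) \<notin> D" using M[of "(x, b)"] by (auto simp: b_def)
  moreover have "above (x, 0) b = {}" using N by (fastforce simp: above_def b_def)
  moreover have "P b" using N[of b] by (auto simp: P_def b_def)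
  ultimately have b: "P b" "\<not> h b" by (auto simp: h_def)
  have "h z = h b"
  proof (rule connected_equivalence_relation_gen[of "UNIV :: real set" z b P "\<lambda>s t. h s = h t"])
    show "P z" using assms by (simp add: P_def)
    fix T :: "real set" and a assume "openin (top_of_set UNIV) T" "a \<in> T"
    then have "open T" "T \<noteq> {}" unfolding openin_open by auto
    then have "\<not> finite T" using finite_imp_not_open by blast
    then have "\<not> T \<subseteq> sec S (x, 0)" using fin finite_subset by blast
    then show "\<exists>z. z \<in> T \<and> P z" by (auto simp: P_def)
  next
    fix a :: real
    show "\<exists>T. openin (top_of_set UNIV) T \<and> a \<in> T \<and> (\<forall>s\<in>T. \<forall>t\<in>T. P s \<and> P t \<longrightarrow> h s = h t)"
    proof -
      obtain T where T: "open T" "a \<in> T" "\<forall>s\<in>T. \<forall>t\<in>T. P s \<and> P t \<longrightarrow> h s = h t"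
        using parity_locally_constant[of a x] unfolding P_def h_def by blast
      moreover have "openin (top_of_set UNIV) T" unfolding openin_open using T(1) by blast
      ultimately show ?thesis by blast
    qed
  qed (use b in auto)
  with b show ?thesis by (auto simp: h_def)
qed

text \<open>At a height \<zeta> just above the fold, parity decides membership in \<open>D\<close>,
  which is the flag \<open>inn\<close> of \<open>fold_geometry\<close>. No point of the fiber lies
  between the fold and \<zeta>, so the crossings above \<zeta> are those counted in
  \<open>outer_fold\<close>.\<close>

lemma fold_extremal:
  assumes C: "(x0, z0) \<in> C" and ncr: "\<not> crossing (sec S) (x0, 0) z0"
  obtains \<rho> :: real where "\<rho> = 1 \<or> \<rho> = -1"
    "\<forall>\<^sub>F e in at_right 0. \<forall>\<^sub>F x in nhds x0. card (sec S (x, 0) \<inter> ball z0 e) = 2 \<longleftrightarrow> \<rho> * (x - x0) < 0"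
    "\<forall>\<^sub>F q in nhds (x0, z0). q \<in> C \<longrightarrow> \<rho> * (fst q - x0) \<le> 0"
    "(x0, z0) \<in> local_maxima D pz \<longleftrightarrow> \<rho> = 1 \<and> outer_fold (x0, 0) z0"
    "(x0, z0) \<in> local_minima D pz \<longleftrightarrow> \<rho> = -1 \<and> outer_fold (x0, 0) z0"
proof -
  obtain \<rho> :: real and inn where g: "\<rho> = 1 \<or> \<rho> = -1"
    "\<forall>\<^sub>F e in at_right 0. \<forall>\<^sub>F x in nhds x0. card (sec S (x, 0) \<inter> ball z0 e) = 2 \<longleftrightarrow> \<rho> * (x - x0) < 0"
    "\<forall>\<^sub>F q in nhds (x0, z0). q \<in> C \<longrightarrow> \<rho> * (fst q - x0) \<le> 0"
    "\<forall>\<^sub>F \<zeta> in at z0. (x0, \<zeta>) \<in> D \<longleftrightarrow> inn"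
    "(x0, z0) \<in> local_maxima D pz \<longleftrightarrow> \<rho> = 1 \<and> \<not> inn"
    "(x0, z0) \<in> local_minima D pz \<longleftrightarrow> \<rho> = -1 \<and> \<not> inn"
    by (rule fold_geometry[OF C ncr])
  have fin: "finite (sec S (x0, 0))" by (rule finite_sec) simp
  have "open (- (sec S (x0, 0) - {z0}))" using fin by (intro open_Compl finite_imp_closed) auto
  then have "\<forall>\<^sub>F z in nhds z0. z \<in> - (sec S (x0, 0) - {z0})" by (rule eventually_nhds_in_open) simp
  then obtain e0 where e0: "0 < e0" "\<And>z. \<bar>z - z0\<bar> < e0 \<Longrightarrow> z \<in> sec S (x0, 0) \<Longrightarrow> z = z0"
    unfolding eventually_nhds_metric dist_real_def by blast
  obtain e1 where e1: "0 < e1" "\<And>\<zeta>. \<zeta> \<noteq> z0 \<Longrightarrow> \<bar>\<zeta> - z0\<bar> < e1 \<Longrightarrow> (x0, \<zeta>) \<in> D \<longleftrightarrow> inn"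
    using g(4) unfolding eventually_at dist_real_def by blast
  define \<zeta> where "\<zeta> = z0 + min e0 e1 / 2"
  have \<zeta>: "z0 < \<zeta>" "\<zeta> < z0 + e0" "\<zeta> < z0 + e1" using e0(1) e1(1) by (auto simp: \<zeta>_def)
  have "\<zeta> \<notin> sec S (x0, 0)" using e0(2)[of \<zeta>] \<zeta> by auto
  then have "inn \<longleftrightarrow> odd (card (above (x0, 0) \<zeta>))"
    using mem_D_iff_odd_above[of \<zeta> x0] e1(2)[of \<zeta>] \<zeta> by auto
  also have "above (x0, 0) \<zeta> = above (x0, 0) z0"
  proof (intro equalityI subsetI)
    fix w assume w: "w \<in> above (x0, 0) z0"
    then have "\<not> \<bar>w - z0\<bar> < e0" using e0(2)[of w] by (auto simp: above_def)
    then show "w \<in> above (x0, 0) \<zeta>" using w \<zeta> by (auto simp: above_def)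
  qed (use \<zeta> in \<open>auto simp: above_def\<close>)
  finally have "\<not> inn \<longleftrightarrow> outer_fold (x0, 0) z0"
    using ncr mem_C_sec[OF C] by (simp add: outer_fold_def)
  with g show thesis by (intro that[of \<rho>]) auto
qed

section \<open>Finiteness of the folds and the count along the line\<close>

definition folds :: "(real \<times> real) set"
  where "folds = {p \<in> C. \<not> crossing (sec S) (fst p, 0) (snd p)}"

text \<open>Near a crossing all points of \<open>C\<close> are crossings. Near a fold, another fold
  would be alone in the ball, hence not on the side with two points, while \<open>C\<close> has no
  points on the other side. So it lies over \<open>x0\<close>, where the ball contains the given
  fold alone.\<close>

lemma isolated_fold:
  assumes "(x0, z0) \<in> C"
  shows "\<forall>\<^sub>F q in nhds (x0, z0). q \<in> folds \<longrightarrow> q = (x0, z0)"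
proof -
  have lift: "\<forall>\<^sub>F q in nhds (x0, z0). Q (fst q) \<and> \<bar>snd q - z0\<bar> < e" if "eventually Q (nhds x0)" "0 < e" for Q and e :: real
  proof -
    have "\<forall>\<^sub>F z in nhds z0. \<bar>z - z0\<bar> < e"
      using that(2) unfolding eventually_nhds_metric dist_real_def by blast
    with that(1) show ?thesis unfolding nhds_prod eventually_prod_filter by auto
  qed
  show ?thesis
  proof (cases "crossing (sec S) (x0, 0) z0")
    case True
    have "\<forall>\<^sub>F e in at_right 0. 0 < e \<and> (\<forall>\<^sub>F v in upper (x0, 0). crossing_chart (sec S) z0 e v)"
      using eventually_crossing_chart[of "(x0, 0)" z0] True eventually_at_right_less[of 0] by (auto intro: eventually_conj)
    then obtain e where e: "0 < e" "\<forall>\<^sub>F v in upper (x0, 0). crossing_chart (sec S) z0 e v"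
      using eventually_happens trivial_limit_at_right_real by blast
    from lift[OF eventually_upper_line[OF e(2)] e(1)] show ?thesis
    proof eventually_elim
      case (elim q)
      show ?case
      proof
        assume q: "q \<in> folds"
        then have "(fst q, snd q) \<in> C" by (simp add: folds_def)
        then have "snd q \<in> sec S (fst q, 0) \<inter> ball z0 e"
          using mem_C_sec elim by (simp add: dist_real_def abs_minus_commute)
        moreover obtain \<zeta> where \<zeta>: "sec S (fst q, 0) \<inter> ball z0 e = {\<zeta>}" "crossing (sec S) (fst q, 0) \<zeta>"
          using elim unfolding crossing_chart_def by blast
        ultimately have "snd q = \<zeta>" by (metis singletonD)
        with \<zeta>(2) show "q = (x0, z0)" using q unfolding folds_def by blast
      qed
    qed
  next
    case False
    obtain \<rho> :: real where \<rho>: "\<rho> = 1 \<or> \<rho> = -1"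
      "\<forall>\<^sub>F e in at_right 0. \<forall>\<^sub>F x in nhds x0. card (sec S (x, 0) \<inter> ball z0 e) = 2 \<longleftrightarrow> \<rho> * (x - x0) < 0"
      "\<forall>\<^sub>F q in nhds (x0, z0). q \<in> C \<longrightarrow> \<rho> * (fst q - x0) \<le> 0"
      by (rule fold_extremal[OF assms False])
    have "\<forall>\<^sub>F e in at_right 0. \<forall>\<^sub>F v in upper (x0, 0). fold_chart (sec S) z0 e v"
      using fold[of "(x0, 0)" z0] False mem_C_sec[OF assms] by simp
    with \<rho>(2) eventually_at_right_less[of 0]
    have "\<forall>\<^sub>F e in at_right 0. 0 < e \<and> (\<forall>\<^sub>F x in nhds x0. card (sec S (x, 0) \<inter> ball z0 e) = 2 \<longleftrightarrow> \<rho> * (x - x0) < 0) \<and>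
      (\<forall>\<^sub>F v in upper (x0, 0). fold_chart (sec S) z0 e v)"
      by eventually_elim blast
    then obtain e where e: "0 < e" "\<forall>\<^sub>F x in nhds x0. card (sec S (x, 0) \<inter> ball z0 e) = 2 \<longleftrightarrow> \<rho> * (x - x0) < 0"
      "\<forall>\<^sub>F v in upper (x0, 0). fold_chart (sec S) z0 e v"
      using eventually_happens trivial_limit_at_right_real by blast
    have "\<forall>\<^sub>F x in nhds x0. (card (sec S (x, 0) \<inter> ball z0 e) = 2 \<longleftrightarrow> \<rho> * (x - x0) < 0) \<and> fold_chart (sec S) z0 e (x, 0)"
      by (intro eventually_conj e(2) eventually_upper_line[OF e(3)])
    from lift[OF this e(1)] \<rho>(3) show ?thesis
    proof eventually_elim
      case (elim q)
      show ?case
      proof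
        assume q: "q \<in> folds"
        then have qC: "q \<in> C" and ncr: "\<not> crossing (sec S) (fst q, 0) (snd q)" by (auto simp: folds_def)
        have "(fst q, snd q) \<in> C" using qC by simp
        then have mem: "snd q \<in> sec S (fst q, 0) \<inter> ball z0 e"
          using mem_C_sec elim by (simp add: dist_real_def abs_minus_commute)
        have "fold_chart (sec S) z0 e (fst q, 0)" using elim by blast
        then have single: "sec S (fst q, 0) \<inter> ball z0 e = {snd q}"
          using mem ncr unfolding fold_chart_def by (metis empty_iff insert_iff)
        then have "\<not> \<rho> * (fst q - x0) < 0" using elim(1) by simp
        then have "fst q = x0" using elim(2) qC \<rho>(1) by auto
        moreover have "z0 \<in> sec S (x0, 0) \<inter> ball z0 e" using mem_C_sec[OF assms] e(1) by simp
        ultimately have "z0 = snd q" using single by (metis singletonD)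
        with \<open>fst q = x0\<close> show "q = (x0, z0)" by (metis prod.collapse)
      qed
    qed
  qed
qed

text \<open>\<open>C\<close> is compact and its folds are isolated. Finiteness makes the numbers of
  extrema genuine, as \<open>card\<close> of an infinite set is 0.\<close>

lemma finite_folds: "finite folds"
proof (rule ccontr)
  assume "infinite folds"
  moreover have "compact C" using compact_frontier[OF compact_D] frontier_D by simp
  moreover have "folds \<subseteq> C" by (auto simp: folds_def)
  ultimately obtain p where p: "p \<in> C" "p islimpt folds"
    unfolding compact_eq_Bolzano_Weierstrass by blast
  obtain W where "open W" "p \<in> W" "\<And>q. q \<in> W \<Longrightarrow> q \<in> folds \<Longrightarrow> q = p"
    using isolated_fold[of "fst p" "snd p"] p(1) unfolding eventually_nhds by auto
  then show False using p(2) unfolding islimpt_def by blast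
qed

lemma extrema_folds: "local_maxima D pz \<subseteq> folds" "local_minima D pz \<subseteq> folds"
proof -
  have "p \<in> folds" if p: "p \<in> D" "p \<in> local_maxima D pz \<or> p \<in> local_minima D pz" for p
  proof -
    have "p \<in> C" using interior_not_extremal[OF p(1)] p(2) by blast
    moreover have "\<not> crossing (sec S) (fst p, 0) (snd p)"
      using crossing_not_extremal[of "fst p" "snd p"] p(2) calculation by auto
    ultimately show ?thesis by (simp add: folds_def)
  qed
  then show "local_maxima D pz \<subseteq> folds" "local_minima D pz \<subseteq> folds"
    by (auto simp: local_maxima_iff local_minima_iff)
qed

text \<open>The equation is nonnegative on the plane y = 0 and convex along the fibers, so two zeros
  on one fiber would enclose a negative value.\<close>

lemma touching_count:
  assumes "(x, 0, z) \<in> S" "(x, z) \<notin> C"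
  shows "\<forall>\<^sub>F e in at_right 0. \<forall>\<^sub>F t in nhds x. card (sec S (t, 0) \<inter> ball z e) \<noteq> 2"
proof -
  obtain U f where f: "tangent_equation S U f (x, 0, z)" "\<forall>\<^sub>F q in nhds (x, 0, z). fst (snd q) = 0 \<longrightarrow> 0 \<le> f q"
    using touching_tangent[OF assms] by blast
  then have reg: "regular_equation S U f" and p: "(x, 0, z) \<in> U" "f (x, 0, z) = 0" "dz f (x, 0, z) = 0"
    "0 < dz (dz f) (x, 0, z)" by (auto simp: tangent_equation_def)
  have sm: "open U" "smooth_on U f" using reg by (auto simp: regular_equation_def)
  have "\<forall>\<^sub>F q in nhds (x, 0, z). q \<in> U \<and> 0 < dz (dz f) q"
    by (intro eventually_smooth_pos smooth_on_continuous smooth_on_pd sm p)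
  with f(2) have "\<forall>\<^sub>F q in nhds (x, 0, z). q \<in> U \<and> 0 < dz (dz f) q \<and> (fst (snd q) = 0 \<longrightarrow> 0 \<le> f q)"
    by eventually_elim blast
  then obtain e0 where e0: "0 < e0" "\<forall>\<^sub>F v in nhds (x, 0). \<forall>\<zeta>. \<bar>\<zeta> - z\<bar> < e0 \<longrightarrow>
      (fst v, snd v, \<zeta>) \<in> U \<and> 0 < dz (dz f) (fst v, snd v, \<zeta>) \<and> (fst (snd (fst v, snd v, \<zeta>)) = 0 \<longrightarrow> 0 \<le> f (fst v, snd v, \<zeta>))"
    by (rule eventually_nhds_fiber)
  have line: "\<forall>\<^sub>F t in nhds x. \<forall>\<zeta>. \<bar>\<zeta> - z\<bar> < e0 \<longrightarrow>
      (t, 0, \<zeta>) \<in> U \<and> 0 < dz (dz f) (t, 0, \<zeta>) \<and> 0 \<le> f (t, 0, \<zeta>)"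
  proof -
    have "\<forall>\<^sub>F v in upper (x, 0). \<forall>\<zeta>. \<bar>\<zeta> - z\<bar> < e0 \<longrightarrow>
        (fst v, snd v, \<zeta>) \<in> U \<and> 0 < dz (dz f) (fst v, snd v, \<zeta>) \<and> (snd v = 0 \<longrightarrow> 0 \<le> f (fst v, snd v, \<zeta>))"
      unfolding eventually_upper using e0(2) by (rule eventually_mono) simp
    from eventually_upper_line[OF this] show ?thesis by simp
  qed
  have "\<forall>\<^sub>F t in nhds x. card (sec S (t, 0) \<inter> ball z e) \<noteq> 2" if e: "e < e0" for e
    using line
  proof eventually_elim
    case (elim t)
    have no_two: False if \<zeta>: "\<zeta>1 < \<zeta>2" "\<zeta>1 \<in> sec S (t, 0) \<inter> ball z e" "\<zeta>2 \<in> sec S (t, 0) \<inter> ball z e" for \<zeta>1 \<zeta>2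
    proof -
      have b: "\<bar>\<zeta>1 - z\<bar> < e0" "\<bar>\<zeta>2 - z\<bar> < e0" using \<zeta> e by (auto simp: dist_real_def abs_minus_commute)
      then have "f (t, 0, \<zeta>1) = 0" "f (t, 0, \<zeta>2) = 0"
        using elim \<zeta> reg unfolding regular_equation_def sec_def by auto
      moreover have "\<forall>\<zeta>\<in>{\<zeta>1..\<zeta>2}. (t, 0, \<zeta>) \<in> U \<and> 0 < dz (dz f) (t, 0, \<zeta>)"
        using elim b by (auto simp: abs_less_iff)
      from convex_between_less[OF fiber_convex[OF reg p(1,2) _ p(3,4) this], of \<zeta>1 "(\<zeta>1 + \<zeta>2) / 2" \<zeta>2 0]
      have "f (t, 0, (\<zeta>1 + \<zeta>2) / 2) < 0" using \<zeta>(1) calculation by simp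
      moreover have "\<bar>(\<zeta>1 + \<zeta>2) / 2 - z\<bar> < e0" using b by (auto simp: abs_less_iff field_simps)
      ultimately show False using elim by fastforce
    qed
    show ?case
    proof
      assume "card (sec S (t, 0) \<inter> ball z e) = 2"
      then obtain \<zeta>1 \<zeta>2 where "sec S (t, 0) \<inter> ball z e = {\<zeta>1, \<zeta>2}" "\<zeta>1 \<noteq> \<zeta>2"
        by (auto simp: card_2_iff)
      then show False using no_two[of \<zeta>1 \<zeta>2] no_two[of \<zeta>2 \<zeta>1] by (metis insertI1 insertI2 linorder_neqE)
    qed
  qed
  then show ?thesis using e0(1) by (intro eventually_at_rightI[of 0 e0]) auto
qed

text \<open>At an outer fold on \<open>C\<close> the pair lies to the right of a minimum and to the
  left of a maximum. For crossings, touching points and folds that are not outer both sides of the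
  equivalence are false.\<close>

lemma eventually_germ_summand:
  assumes z: "z \<in> sec S (x, 0)"
  shows "\<forall>\<^sub>F t in nhds x. outer_fold (x, 0) z \<and> card (sec S (t, 0) \<inter> ball z (radius (x, 0))) = 2 \<longleftrightarrow>
    (x, z) \<in> local_minima D pz \<and> x < t \<or> (x, z) \<in> local_maxima D pz \<and> t < x"
proof (cases "crossing (sec S) (x, 0) z")
  case True
  have "(x, z) \<notin> local_minima D pz" "(x, z) \<notin> local_maxima D pz"
    using extrema_folds True by (auto simp: folds_def)
  with True show ?thesis by (simp add: outer_fold_def)
next
  case False
  have r: "0 < radius (x, 0)" using admissible_radius[of "(x, 0)"] by (simp add: admissible_def)
  \<comment> \<open>The local counts are known for all small radii; one below
    \<open>radius (x, 0)\<close> is picked and the ball is then enlarged without gaining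
    points.\<close>
  have to_radius: "\<forall>\<^sub>F t in nhds x. Q t (card (sec S (t, 0) \<inter> ball z (radius (x, 0))))"
    if Q: "\<forall>\<^sub>F e in at_right 0. \<forall>\<^sub>F t in nhds x. Q t (card (sec S (t, 0) \<inter> ball z e))" for Q
  proof -
    have "\<forall>\<^sub>F e in at_right 0. e < radius (x, 0)" "\<forall>\<^sub>F e in at_right 0. (0::real) < e"
      using r eventually_at_right_less[of 0] by (auto simp: eventually_at_right_field)
    with Q have "\<forall>\<^sub>F e in at_right 0. 0 < e \<and> e < radius (x, 0) \<and> (\<forall>\<^sub>F t in nhds x. Q t (card (sec S (t, 0) \<inter> ball z e)))"
      by eventually_elim blast
    then obtain e where e: "0 < e" "e < radius (x, 0)" "\<forall>\<^sub>F t in nhds x. Q t (card (sec S (t, 0) \<inter> ball z e))"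
      using eventually_happens trivial_limit_at_right_real by blast
    have "\<forall>\<^sub>F v in upper (x, 0). sec S v \<inter> ball z (radius (x, 0)) = sec S v \<inter> ball z e"
      by (rule eventually_sec_ball_radius) (use z e in auto)
    from eventually_upper_line[OF this] e(3) show ?thesis
      by eventually_elim simp
  qed
  show ?thesis
  proof (cases "(x, z) \<in> C")
    case nC: False
    have "(x, z) \<notin> local_minima D pz" "(x, z) \<notin> local_maxima D pz"
      using extrema_folds nC by (auto simp: folds_def)
    moreover have "\<forall>\<^sub>F t in nhds x. card (sec S (t, 0) \<inter> ball z (radius (x, 0))) \<noteq> 2"
      using to_radius[of "\<lambda>t n. n \<noteq> 2"] touching_count[of x z] nC z by (simp add: sec_def)
    ultimately show ?thesis by (auto elim: eventually_mono)
  next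
    case C: True
    obtain \<rho> :: real where \<rho>: "\<rho> = 1 \<or> \<rho> = -1"
      "\<forall>\<^sub>F e in at_right 0. \<forall>\<^sub>F t in nhds x. card (sec S (t, 0) \<inter> ball z e) = 2 \<longleftrightarrow> \<rho> * (t - x) < 0"
      "(x, z) \<in> local_maxima D pz \<longleftrightarrow> \<rho> = 1 \<and> outer_fold (x, 0) z"
      "(x, z) \<in> local_minima D pz \<longleftrightarrow> \<rho> = -1 \<and> outer_fold (x, 0) z"
      by (rule fold_extremal[OF C False])
    from to_radius[of "\<lambda>t n. n = 2 \<longleftrightarrow> \<rho> * (t - x) < 0", OF \<rho>(2)] show ?thesis
      by eventually_elim (use \<rho> in auto)
  qed
qed

text \<open>\<open>f\<close> is an explicit primitive of the germs along the line. Left of all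
  extrema it equals the number of maxima and right of them the number of minima, so a vanishing
  total increase is the claim.\<close>

lemma card_maxima_eq_minima: "card (local_maxima D pz) = card (local_minima D pz)"
proof -
  define Mx Mn where "Mx = local_maxima D pz" and "Mn = local_minima D pz"
  have finM: "finite Mx" "finite Mn"
    using extrema_folds finite_folds finite_subset unfolding Mx_def Mn_def by blast+
  have M_sec: "z \<in> sec S (x, 0)" if "(x, z) \<in> Mx \<or> (x, z) \<in> Mn" for x z
    using that extrema_folds mem_C_sec unfolding Mx_def Mn_def folds_def by blast
  \<comment> \<open>The strict inequalities matter at \<open>t = x\<close>: over its own abscissa an
    extremum is a single point and not a pair, so the germ and both counts leave it out.\<close>
  define f where "f = (\<lambda>t. real (card {p \<in> Mn. fst p < t}) + real (card {p \<in> Mx. t < fst p}))"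
  obtain R where R: "0 < R" "\<And>p. p \<in> S \<Longrightarrow> norm p < R"
    using compact_imp_bounded[OF compact_S] by (metis bounded_pos_less)
  have sec_empty: "sec S v = {}" if v: "R \<le> \<bar>fst v\<bar> \<or> R \<le> \<bar>snd v\<bar>" for v
  proof (rule ccontr)
    assume "sec S v \<noteq> {}"
    then obtain z where "(fst v, snd v, z) \<in> S" by (auto simp: sec_def)
    then have n: "norm (fst v, snd v, z) < R" by (rule R(2))
    have "\<bar>fst v\<bar> \<le> norm (fst v, snd v, z)" by (metis norm_fst_le fst_conv real_norm_def)
    moreover have "\<bar>snd v\<bar> \<le> norm (snd v, z)" by (metis norm_fst_le fst_conv real_norm_def)
    moreover have "norm (snd v, z) \<le> norm (fst v, snd v, z)" by (metis norm_snd_le snd_conv)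
    ultimately show False using v n by linarith
  qed
  have "f (- R) = f R"
  proof (rule total_germ)
    show "0 \<le> R" using R(1) by simp
    show "\<And>v. R \<le> \<bar>fst v\<bar> \<or> R \<le> \<bar>snd v\<bar> \<Longrightarrow> sec S v = {}" by (rule sec_empty)
    fix x
    have fin: "finite (sec S (x, 0))" by (rule finite_sec) simp
    have "\<forall>\<^sub>F t in nhds x. \<forall>z\<in>sec S (x, 0). outer_fold (x, 0) z \<and> card (sec S (t, 0) \<inter> ball z (radius (x, 0))) = 2 \<longleftrightarrow>
        (x, z) \<in> Mn \<and> x < t \<or> (x, z) \<in> Mx \<and> t < x"
      unfolding Mx_def Mn_def by (intro eventually_ball_finite fin ballI eventually_germ_summand)
    \<comment> \<open>Extrema over other abscissae stay on their side of \<open>t\<close>, so they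
      contribute only to the constant.\<close>
    moreover have "\<forall>\<^sub>F t in nhds x. \<forall>s\<in>fst ` (Mx \<union> Mn). s \<noteq> x \<longrightarrow> (s < t \<longleftrightarrow> s < x) \<and> (t < s \<longleftrightarrow> x < s)"
    proof (intro eventually_ball_finite ballI)
      fix s assume "s \<in> fst ` (Mx \<union> Mn)"
      have "\<forall>\<^sub>F t in nhds x. \<bar>t - x\<bar> < \<bar>s - x\<bar>" if "s \<noteq> x"
        using that unfolding eventually_nhds_metric dist_real_def
        by (metis abs_zero diff_self eq_iff_diff_eq_0 zero_less_abs_iff)
      then show "\<forall>\<^sub>F t in nhds x. s \<noteq> x \<longrightarrow> (s < t \<longleftrightarrow> s < x) \<and> (t < s \<longleftrightarrow> x < s)"
        by (cases "s = x") (auto elim!: eventually_mono)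
    qed (use finM in auto)
    ultimately have "\<forall>\<^sub>F t in nhds x. f t = germ (x, 0) (t, 0) + (real (card {p \<in> Mn. fst p < x}) + real (card {p \<in> Mx. x < fst p}))"
    proof eventually_elim
      case (elim t)
      have fib: "card {z. (x, z) \<in> M} = card {p \<in> M. fst p = x}" for M :: "(real \<times> real) set"
        by (rule bij_betw_same_card[of "Pair x"]) (auto simp: bij_betw_def inj_on_def)
      have "{z. outer_fold (x, 0) z \<and> card (sec S (t, 0) \<inter> ball z (radius (x, 0))) = 2} =
          {z. (x, z) \<in> Mn \<and> x < t \<or> (x, z) \<in> Mx \<and> t < x}"
        using elim(1) M_sec unfolding outer_fold_def by blast
      then have germ: "germ (x, 0) (t, 0) = real (card {z. (x, z) \<in> Mn \<and> x < t \<or> (x, z) \<in> Mx \<and> t < x})"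
        by (simp add: germ_def)
      have near: "fst p < t \<longleftrightarrow> fst p < x" "t < fst p \<longleftrightarrow> x < fst p" if "p \<in> Mx \<or> p \<in> Mn" "fst p \<noteq> x" for p
        using elim(2) that by auto
      consider "x < t" | "t < x" | "t = x" by linarith
      then show ?case
      proof cases
        case 1
        have "{p \<in> Mn. fst p < t} = {p \<in> Mn. fst p < x} \<union> {p \<in> Mn. fst p = x}"
          using near 1 by (auto; metis less_irrefl)
        then have "card {p \<in> Mn. fst p < t} = card {p \<in> Mn. fst p < x} + card {p \<in> Mn. fst p = x}"
          using finM by (simp add: card_Un_disjoint disjoint_iff)
        moreover have "{p \<in> Mx. t < fst p} = {p \<in> Mx. x < fst p}"
          using near 1 by (auto; metis less_irrefl)
        ultimately show ?thesis using 1 by (simp add: f_def germ fib)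
      next
        case 2
        have "{p \<in> Mx. t < fst p} = {p \<in> Mx. x < fst p} \<union> {p \<in> Mx. fst p = x}"
          using near 2 by (auto; metis less_irrefl)
        then have "card {p \<in> Mx. t < fst p} = card {p \<in> Mx. x < fst p} + card {p \<in> Mx. fst p = x}"
          using finM by (simp add: card_Un_disjoint disjoint_iff)
        moreover have "{p \<in> Mn. fst p < t} = {p \<in> Mn. fst p < x}"
          using near 2 by (auto; metis less_irrefl)
        ultimately show ?thesis using 2 by (simp add: f_def germ fib)
      next
        case 3
        show ?thesis unfolding germ using 3 by (simp add: f_def)
      qed
    qed
    then show "\<exists>k. \<forall>\<^sub>F t in nhds x. f t = germ (x, 0) (t, 0) + k" by blast
  qed
  moreover have range: "- R < fst p" "fst p < R" if "p \<in> Mx \<or> p \<in> Mn" for p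
  proof -
    have "snd p \<in> sec S (fst p, 0)" using M_sec[of "fst p" "snd p"] that by simp
    then have "\<not> R \<le> \<bar>fst p\<bar>" using sec_empty[of "(fst p, 0)"] by auto
    then show "- R < fst p" "fst p < R" by auto
  qed
  have ends: "{p \<in> Mn. fst p < - R} = {}" "{p \<in> Mx. - R < fst p} = Mx" "{p \<in> Mn. fst p < R} = Mn" "{p \<in> Mx. R < fst p} = {}"
    using range by (auto; fastforce)+
  have "f (- R) = real (card Mx)" "f R = real (card Mn)" unfolding f_def ends by simp_all
  ultimately show ?thesis by (simp add: Mx_def Mn_def)
qed

end

theorem proposition1p1:
  fixes \<gamma> :: "real \<Rightarrow> real \<times> real"
    and C D :: "(real \<times> real) set"
    and S :: "(real \<times> real \<times> real) set"
  assumes "smooth_simple_closed_curve \<gamma> C"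
    and "compact_domain D"
    and "frontier D = C"
    and "only_quadratic_folds \<gamma>"
    and "positively_concave D \<or> negatively_concave D"
    and "smooth_compact_surface S"
    and "S \<subseteq> {(x, y, z). 0 \<le> y}"
    and "bounds S C"
  shows "\<exists>p\<in>S. \<exists>m\<ge>3. fiber_multiplicity S p m"
proof (rule ccontr)
  assume "\<not> (\<exists>p\<in>S. \<exists>m\<ge>3. fiber_multiplicity S p m)"
  then have "\<And>p m. p \<in> S \<Longrightarrow> fiber_multiplicity S p m \<Longrightarrow> m < 3"
    by (meson linorder_not_less)
  then interpret spanned_domain S C D
    using assms by unfold_locales auto
  show False
    using card_maxima_eq_minima assms(5) by (simp add: positively_concave_def negatively_concave_def)
qed

end
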